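(* The bounded error public coin randomised $t$-round communication complexity of $\mathrm{GT}_n$ is lower bounded by $\Omega(n^{1/t}t^{-2})$. For bounded error $t$-round quantum protocols with input-independent prior entanglement for $\mathrm{GT}_n$, there is a lower bound of $\Omega(n^{1/t}t^{-1})$ on the communication complexity. (Here the constants in the $\Omega$'s are absolute, i.e. independent of $n$ and $t$.)
   Context: $\mathrm{GT}_n$ is the two-party communication problem in which Alice is given $x\in\{0,1\}^n$, Bob is given $y\in\{0,1\}^n$, and they must decide whether $x>y$, treating $x,y$ as integers between $0$ and $2^n-1$. A $t$-round protocol is one in which Alice and Bob alternately send messages, with $t\ge 1$ messages in total; the last recipient of a message outputs the answer. Bounded error means that on every input the probability of an incorrect output is less than $1/3$. A public coin randomised protocol is a probability distribution over finitely many deterministic protocols; its communication complexity is the maximum total number of bits exchanged (over inputs and coin tosses). The $t$-round communication complexity of a problem is the minimum communication complexity of a $t$-round protocol for it. Quantum protocols (Yao's interacting unitary circuits model): Alice and Bob, with inputs in computational basis states, alternately apply unitary transformations (depending on their own input) to the qubits in their possession and send some of these qubits to the other player; the number and lengths of the messages are fixed and independent of the inputs; no measurement is made during the protocol, and at the end the last recipient of a message measures certain answer qubits (chosen independently of the inputs) in the computational basis. Input-independent prior entanglement means that before the protocol the players may share an arbitrary quantum state that does not depend on the inputs. The communication complexity of a quantum protocol is the total number of qubits sent. *)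

theory Defs
  imports "HOL-Probability.Probability"
begin

text \<open>Inputs in \<open>{0,1}\<^sup>n\<close> are lists of booleans of length \<open>n\<close>, most significant bit first.\<close>

definition inputs :: "nat \<Rightarrow> bool list set" where
  "inputs n = {u. length u = n}"

definition bits_val :: "bool list \<Rightarrow> nat" where
  "bits_val u = horner_sum of_bool 2 (rev u)"

definition GT_fun :: "bool list \<Rightarrow> bool list \<Rightarrow> bool" where
  "GT_fun x y \<longleftrightarrow> bits_val x > bits_val y"

datatype player = Alice | Bob

primrec other :: "player \<Rightarrow> player" where
  "other Alice = Bob"
| "other Bob = Alice"

primrec input_of :: "player \<Rightarrow> bool list \<Rightarrow> bool list \<Rightarrow> bool list" where
  "input_of Alice x y = x"
| "input_of Bob x y = y"

text \<open>
  Messages are numbered from \<open>0\<close>; \<open>turn p i\<close> is the sender of message \<open>i\<close> if player \<open>p\<close> sends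
  message \<open>0\<close>. In a \<open>t\<close>-round protocol with \<open>t \<ge> 1\<close> the last recipient, who receives message
  \<open>t - 1\<close>, is \<open>turn p t\<close>.
\<close>

definition turn :: "player \<Rightarrow> nat \<Rightarrow> player" where
  "turn p i = (if even i then p else other p)"


subsection \<open>Public coin randomised protocols\<close>

text \<open>
  A message is an arbitrary bit string, whose length may depend on the input and on the history;
  messages are not required to be prefix-free. Both \<open>msg\<close> and \<open>ans\<close> are applied to the
  acting player's own input and to the list of all messages sent so far, whose length
  determines who is acting.
\<close>

record det_protocol =
  starter :: player
  msg :: "bool list \<Rightarrow> bool list list \<Rightarrow> bool list"
  ans :: "bool list \<Rightarrow> bool list list \<Rightarrow> bool"

primrec transcript :: "det_protocol \<Rightarrow> bool list \<Rightarrow> bool list \<Rightarrow> nat \<Rightarrow> bool list list" where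
  "transcript P x y 0 = []"
| "transcript P x y (Suc i) =
     transcript P x y i @ [msg P (input_of (turn (starter P) i) x y) (transcript P x y i)]"

definition det_output :: "nat \<Rightarrow> det_protocol \<Rightarrow> bool list \<Rightarrow> bool list \<Rightarrow> bool" where
  "det_output t P x y = ans P (input_of (turn (starter P) t) x y) (transcript P x y t)"

definition bits_sent :: "nat \<Rightarrow> det_protocol \<Rightarrow> bool list \<Rightarrow> bool list \<Rightarrow> nat" where
  "bits_sent t P x y = (\<Sum>m\<leftarrow>transcript P x y t. length m)"

definition public_coin_protocol ::
  "nat \<Rightarrow> nat \<Rightarrow> (bool list \<Rightarrow> bool list \<Rightarrow> bool) \<Rightarrow> det_protocol pmf \<Rightarrow> bool" where
  "public_coin_protocol n t f R \<longleftrightarrow>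
     finite (set_pmf R) \<and>
     (\<forall>x\<in>inputs n. \<forall>y\<in>inputs n. measure_pmf.prob R {P. det_output t P x y \<noteq> f x y} < 1/3)"

definition public_coin_cost :: "nat \<Rightarrow> nat \<Rightarrow> det_protocol pmf \<Rightarrow> nat" where
  "public_coin_cost n t R =
     Max {bits_sent t P x y | P x y. P \<in> set_pmf R \<and> x \<in> inputs n \<and> y \<in> inputs n}"

definition public_coin_cc :: "nat \<Rightarrow> nat \<Rightarrow> (bool list \<Rightarrow> bool list \<Rightarrow> bool) \<Rightarrow> enat" where
  "public_coin_cc n t f =
     (INF R\<in>{R. public_coin_protocol n t f R}. enat (public_coin_cost n t R))"


subsection \<open>Quantum protocols with prior entanglement\<close>

text \<open>
  Qubits are named by natural numbers. A computational basis state of a finite set \<open>S\<close> of qubits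
  is identified with the set \<open>z \<subseteq> S\<close> of those qubits that are in state 1, so a state of \<open>S\<close> is
  given by its amplitudes on \<open>Pow S\<close>, and an operator on \<open>S\<close> by its matrix entries on
  \<open>Pow S \<times> Pow S\<close>; values outside these index sets are irrelevant.
\<close>

type_synonym qstate = "nat set \<Rightarrow> complex"
type_synonym qop = "nat set \<Rightarrow> nat set \<Rightarrow> complex"

definition unitary_on :: "nat set \<Rightarrow> qop \<Rightarrow> bool" where
  "unitary_on S U \<longleftrightarrow>
     (\<forall>z\<in>Pow S. \<forall>z'\<in>Pow S.
        (\<Sum>w\<in>Pow S. U z w * cnj (U z' w)) = of_bool (z = z') \<and>
        (\<Sum>w\<in>Pow S. cnj (U w z) * U w z') = of_bool (z = z'))"

text \<open>The action of \<open>U \<otimes> I\<close>, with \<open>U\<close> acting on the qubits in \<open>S\<close> and \<open>I\<close> on all others.\<close>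

definition apply_on :: "nat set \<Rightarrow> qop \<Rightarrow> qstate \<Rightarrow> qstate" where
  "apply_on S U \<psi> = (\<lambda>z. \<Sum>w\<in>Pow S. U (z \<inter> S) w * \<psi> ((z - S) \<union> w))"

text \<open>
  \<open>inreg p\<close> lists the qubits holding the input of player \<open>p\<close>, and \<open>work p\<close> is the set of all other
  qubits initially held by \<open>p\<close>. The input-independent state \<open>prior\<close> of \<open>work Alice \<union> work Bob\<close>
  comprises the ancillas and the shared entanglement; a mixed shared state is covered by
  giving a purifying system to one of the players.
  Before sending the qubits \<open>sent i\<close>, the sender of message \<open>i\<close>, on input \<open>u\<close>, applies \<open>qgate i u\<close>
  to all qubits in their possession. The last recipient likewise applies \<open>qgate t u\<close>
  before measuring the qubits \<open>ansreg\<close>; \<open>decode\<close> reads the answer off the measurement outcome.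
\<close>

record quantum_protocol =
  qstarter :: player
  inreg :: "player \<Rightarrow> nat list"
  work :: "player \<Rightarrow> nat set"
  prior :: qstate
  qgate :: "nat \<Rightarrow> bool list \<Rightarrow> qop"
  sent :: "nat \<Rightarrow> nat set"
  ansreg :: "nat set"
  decode :: "nat set \<Rightarrow> bool"

text \<open>The qubits held by player \<open>p\<close> after the first \<open>i\<close> messages.\<close>

primrec held :: "quantum_protocol \<Rightarrow> player \<Rightarrow> nat \<Rightarrow> nat set" where
  "held Q p 0 = set (inreg Q p) \<union> work Q p"
| "held Q p (Suc i) =
     (if turn (qstarter Q) i = p then held Q p i - sent Q i else held Q p i \<union> sent Q i)"

definition all_qubits :: "quantum_protocol \<Rightarrow> nat set" where
  "all_qubits Q = held Q Alice 0 \<union> held Q Bob 0"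

definition encode :: "nat list \<Rightarrow> bool list \<Rightarrow> nat set" where
  "encode qs u = {q. (q, True) \<in> set (zip qs u)}"

definition initial_state :: "quantum_protocol \<Rightarrow> bool list \<Rightarrow> bool list \<Rightarrow> qstate" where
  "initial_state Q x y = (\<lambda>z.
     if (\<forall>p. z \<inter> set (inreg Q p) = encode (inreg Q p) (input_of p x y))
     then prior Q (z \<inter> (work Q Alice \<union> work Q Bob)) else 0)"

text \<open>
  Sending qubits changes only their owner, not the global state, so \<open>qstate_at Q x y i\<close> is the
  state after the first \<open>i\<close> gates.
\<close>

primrec qstate_at :: "quantum_protocol \<Rightarrow> bool list \<Rightarrow> bool list \<Rightarrow> nat \<Rightarrow> qstate" where
  "qstate_at Q x y 0 = initial_state Q x y"
| "qstate_at Q x y (Suc i) =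
     (let p = turn (qstarter Q) i
      in apply_on (held Q p i) (qgate Q i (input_of p x y)) (qstate_at Q x y i))"

definition qprob :: "nat \<Rightarrow> quantum_protocol \<Rightarrow> bool list \<Rightarrow> bool list \<Rightarrow> bool \<Rightarrow> real" where
  "qprob t Q x y b =
     (\<Sum>z | z \<subseteq> all_qubits Q \<and> decode Q (z \<inter> ansreg Q) = b. (cmod (qstate_at Q x y (Suc t) z))\<^sup>2)"

definition wf_quantum :: "nat \<Rightarrow> nat \<Rightarrow> quantum_protocol \<Rightarrow> bool" where
  "wf_quantum n t Q \<longleftrightarrow>
     (\<forall>p. length (inreg Q p) = n \<and> distinct (inreg Q p) \<and>
          finite (work Q p) \<and> set (inreg Q p) \<inter> work Q p = {}) \<and>
     held Q Alice 0 \<inter> held Q Bob 0 = {} \<and>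
     (\<Sum>w\<in>Pow (work Q Alice \<union> work Q Bob). (cmod (prior Q w))\<^sup>2) = 1 \<and>
     (\<forall>i<t. sent Q i \<subseteq> held Q (turn (qstarter Q) i) i) \<and>
     (\<forall>i\<le>t. \<forall>u\<in>inputs n. unitary_on (held Q (turn (qstarter Q) i) i) (qgate Q i u)) \<and>
     ansreg Q \<subseteq> held Q (turn (qstarter Q) t) t"

definition bounded_error_quantum ::
  "nat \<Rightarrow> nat \<Rightarrow> (bool list \<Rightarrow> bool list \<Rightarrow> bool) \<Rightarrow> quantum_protocol \<Rightarrow> bool" where
  "bounded_error_quantum n t f Q \<longleftrightarrow>
     wf_quantum n t Q \<and>
     (\<forall>x\<in>inputs n. \<forall>y\<in>inputs n. qprob t Q x y (\<not> f x y) < 1/3)"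

definition quantum_cost :: "nat \<Rightarrow> quantum_protocol \<Rightarrow> nat" where
  "quantum_cost t Q = (\<Sum>i<t. card (sent Q i))"

definition quantum_cc :: "nat \<Rightarrow> nat \<Rightarrow> (bool list \<Rightarrow> bool list \<Rightarrow> bool) \<Rightarrow> enat" where
  "quantum_cc n t f =
     (INF Q\<in>{Q. bounded_error_quantum n t f Q}. enat (quantum_cost t Q))"

end

theory Submission imports Defs begin

text \<open>
  The lower bound is proved by round elimination for a single hard distribution on pairs of inputs.
  Inputs are split into \<open>k\<close> blocks; for a random \<open>i\<close> the first \<open>i\<close> blocks of the two inputs coincide,
  block \<open>i\<close> is drawn recursively, and the remaining blocks are independent. The distribution is
  symmetric in the two players and both marginals are uniform, so it is hard no matter who starts;
  this matters because the protocols in the support of a public coin protocol may have different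
  starters.

  If the first message is drawn from an alphabet of size \<open>d\<close>, the other player's state after it is
  dominated by \<open>d\<^sup>2\<close> times a state independent of the input, so by the chain rule the blocks together
  reveal at most \<open>2 ln d\<close> nats, that is, \<open>2 ln d / k\<close> on average over the block \<open>i\<close>. Relative entropy
  bounds the squared distance of the canonical purifications, and by Uhlmann's argument (polar
  decomposition) the sender can therefore replace a purification that does not depend on block \<open>i\<close>
  by the correct one with a local isometry, which is merged into the sender's next gate. This removes
  one message and costs error \<open>O(\<surd>(ln d / k))\<close>. With \<open>k\<close> proportional to \<open>t\<close> times the quantum cost,
  the Cauchy-Schwarz inequality makes the total loss a small constant, so that \<open>4 k\<^sup>t < n\<close> is
  impossible. A deterministic classical protocol is a quantum protocol whose gates map basis states to basis states;
  its \<open>t\<close> messages each have up to the total number \<open>c\<close> of bits, whence the additional factor \<open>t\<close>.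
\<close>

section \<open>Spectral theorem for functions on a finite set\<close>

text \<open>The class of protocols has to be closed under the elimination of a message. An
  elimination leaves behind a new shared state, a sender whose memory has gained a control register
  and junk dimensions, and gates between spaces of different size; hence the abstract model with
  arbitrary finite memories, isometric gates and an arbitrary initial state. Prior entanglement then
  comes for free; its price is the factor 2 in \<open>2 ln d\<close>, as in superdense coding.

  The blocks after block \<open>i\<close> are treated asymmetrically. Those of the recipient can be
  fixed from outside, but those of the sender have to stay random, because the chain rule compares
  states conditioned on the prefix alone. They are kept in superposition, so that the sender holds a
  purification of the averaged state.

  The former recipient moves first in the new protocol, so the induction alternates between the
  problem and its complement; the Boolean argument of \<open>err\<close> carries this.

  The construction needs \<open>k \<ge> 1\<close>, which leaves protocols of cost zero. Those are
  refuted on three inputs, since the input of a single player then determines the outcome.\<close>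

definition ip :: "'a set \<Rightarrow> ('a \<Rightarrow> complex) \<Rightarrow> ('a \<Rightarrow> complex) \<Rightarrow> complex" where
  "ip C x y = (\<Sum>c\<in>C. cnj (x c) * y c)"

definition nsq :: "'a set \<Rightarrow> ('a \<Rightarrow> complex) \<Rightarrow> real" where
  "nsq C x = (\<Sum>c\<in>C. (cmod (x c))^2)"

definition mat_app :: "'a set \<Rightarrow> ('a \<Rightarrow> 'a \<Rightarrow> complex) \<Rightarrow> ('a \<Rightarrow> complex) \<Rightarrow> 'a \<Rightarrow> complex" where
  "mat_app C \<rho> x = (\<lambda>c. \<Sum>c'\<in>C. \<rho> c c' * x c')"

definition herm :: "'a set \<Rightarrow> ('a \<Rightarrow> 'a \<Rightarrow> complex) \<Rightarrow> bool" where
  "herm C \<rho> \<longleftrightarrow> (\<forall>c\<in>C. \<forall>c'\<in>C. \<rho> c c' = cnj (\<rho> c' c))"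

lemma ip_cong:
  "(\<And>c. c \<in> C \<Longrightarrow> x c = x' c) \<Longrightarrow> (\<And>c. c \<in> C \<Longrightarrow> y c = y' c) \<Longrightarrow> ip C x y = ip C x' y'"
  by (simp add: ip_def)

lemma ip_add_right: "ip C x (\<lambda>c. y c + z c) = ip C x y + ip C x z"
  by (simp add: ip_def algebra_simps sum.distrib)

lemma ip_diff_right: "ip C x (\<lambda>c. y c - z c) = ip C x y - ip C x z"
  by (simp add: ip_def algebra_simps sum_subtractf)

lemma ip_scale_right: "ip C x (\<lambda>c. a * y c) = a * ip C x y"
  by (simp add: ip_def sum_distrib_left mult_ac)

lemma ip_sum_right: "ip C x (\<lambda>c. \<Sum>i\<in>I. f i c) = (\<Sum>i\<in>I. ip C x (f i))"
  by (simp add: ip_def sum_distrib_left) (rule sum.swap)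

lemma ip_cnj: "cnj (ip C x y) = ip C y x"
  by (simp add: ip_def mult_ac)

lemma ip_add_left: "ip C (\<lambda>c. y c + z c) x = ip C y x + ip C z x"
  by (simp add: ip_def algebra_simps sum.distrib)

lemma ip_scale_left: "ip C (\<lambda>c. a * y c) x = cnj a * ip C y x"
  by (simp add: ip_def sum_distrib_left mult_ac)

lemma cmod_sq_eq: "of_real ((cmod z)^2) = cnj z * z"
  using complex_norm_square by (simp add: mult.commute)

lemma ip_self: "ip C x x = of_real (nsq C x)"
  unfolding ip_def nsq_def of_real_sum cmod_sq_eq ..

lemma nsq_nonneg [simp]: "0 \<le> nsq C x"
  by (simp add: nsq_def sum_nonneg)

lemma nsq_eq_0: "finite C \<Longrightarrow> nsq C x = 0 \<longleftrightarrow> (\<forall>c\<in>C. x c = 0)"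
  by (simp add: nsq_def sum_nonneg_eq_0_iff)

lemma nsq_coord_le: "finite C \<Longrightarrow> nsq C x = 1 \<Longrightarrow> c \<in> C \<Longrightarrow> cmod (x c) \<le> 1"
  using member_le_sum[of c C "\<lambda>c. (cmod (x c))^2"] by (simp add: nsq_def power_le_one_iff)

lemma nsq_scale: "nsq C (\<lambda>c. a * x c) = (cmod a)^2 * nsq C x"
  by (simp add: nsq_def norm_mult power_mult_distrib sum_distrib_left)

lemma ip_mat_app:
  assumes "herm C \<rho>" shows "ip C x (mat_app C \<rho> y) = ip C (mat_app C \<rho> x) y"
proof -
  have "ip C x (mat_app C \<rho> y) = (\<Sum>c\<in>C. \<Sum>c'\<in>C. cnj (x c) * (\<rho> c c' * y c'))"
    by (simp add: ip_def mat_app_def sum_distrib_left)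
  also have "... = (\<Sum>c\<in>C. \<Sum>c'\<in>C. cnj (\<rho> c' c * x c) * y c')"
  proof (intro sum.cong refl)
    fix c c' assume "c \<in> C" "c' \<in> C"
    then have "cnj (\<rho> c' c) = \<rho> c c'" using assms unfolding herm_def by metis
    then show "cnj (x c) * (\<rho> c c' * y c') = cnj (\<rho> c' c * x c) * y c'" by (simp add: mult_ac)
  qed
  also have "... = (\<Sum>c'\<in>C. \<Sum>c\<in>C. cnj (\<rho> c' c * x c) * y c')"
    by (rule sum.swap)
  also have "... = ip C (mat_app C \<rho> x) y"
    by (simp add: ip_def mat_app_def sum_distrib_right)
  finally show ?thesis .
qed

lemma mat_app_add_scale:
  "mat_app C \<rho> (\<lambda>c. x c + a * y c) = (\<lambda>c. mat_app C \<rho> x c + a * mat_app C \<rho> y c)"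
  by (simp add: mat_app_def algebra_simps sum.distrib sum_distrib_left)

text \<open>Tychonoff's theorem. Pinning the coordinates outside \<open>C\<close> to 0 is what makes
  the set of functions on all of \<open>'a\<close> compact, so the maximisation below runs over such
  functions.\<close>

lemma compact_poly:
  "compact {z :: 'a \<Rightarrow> complex. (\<forall>c\<in>C. cmod (z c) \<le> 1) \<and> (\<forall>c. c \<notin> C \<longrightarrow> z c = 0)}"
proof -
  let ?S = "\<lambda>c. if c \<in> C then cball (0::complex) 1 else {0}"
  have "compactin (product_topology (\<lambda>c::'a. euclidean) UNIV) (PiE UNIV ?S)"
    by (subst compactin_PiE) (auto simp: compactin_euclidean_iff)
  then have "compact (PiE UNIV ?S)"
    by (simp add: euclidean_product_topology compactin_euclidean_iff)
  moreover have "PiE UNIV ?S = {z. (\<forall>c\<in>C. cmod (z c) \<le> 1) \<and> (\<forall>c. c \<notin> C \<longrightarrow> z c = 0)}"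
    by (auto simp: PiE_def Pi_def extensional_def split: if_splits)
  ultimately show ?thesis by simp
qed

section \<open>Orthonormal systems and Bessel's identity\<close>

definition orthonormal :: "'a set \<Rightarrow> nat \<Rightarrow> (nat \<Rightarrow> 'a \<Rightarrow> complex) \<Rightarrow> bool" where
  "orthonormal C r v \<longleftrightarrow> (\<forall>i<r. \<forall>j<r. ip C (v i) (v j) = of_bool (i = j))"

lemma proj_residual:
  assumes "orthonormal C r v" "j < r"
  shows "ip C (v j) (\<lambda>c. x c - (\<Sum>i<r. ip C (v i) x * v i c)) = 0"
proof -
  have "ip C (v j) (\<lambda>c. x c - (\<Sum>i<r. ip C (v i) x * v i c)) =
     ip C (v j) x - (\<Sum>i<r. ip C (v i) x * ip C (v j) (v i))"
    by (simp add: ip_diff_right ip_sum_right ip_scale_right)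
  also have "(\<Sum>i<r. ip C (v i) x * ip C (v j) (v i)) = (\<Sum>i<r. if i = j then ip C (v i) x else 0)"
    using assms by (intro sum.cong) (auto simp: orthonormal_def)
  finally show ?thesis using assms by simp
qed

lemma nsq_residual:
  assumes "orthonormal C r v"
  shows "nsq C (\<lambda>c. x c - (\<Sum>i<r. ip C (v i) x * v i c)) = nsq C x - (\<Sum>i<r. (cmod (ip C (v i) x))^2)"
proof -
  let ?y = "\<lambda>c. x c - (\<Sum>i<r. ip C (v i) x * v i c)"
  have "ip C ?y (\<lambda>c. \<Sum>i<r. ip C (v i) x * v i c) = 0"
    unfolding ip_sum_right ip_scale_right
    using proj_residual[OF assms] by (subst (2) ip_cnj[symmetric]) (simp add: ip_cnj)
  then have "ip C ?y ?y = ip C ?y x"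
    by (subst ip_diff_right) simp
  also have "... = cnj (ip C x ?y)" by (simp add: ip_cnj)
  also have "ip C x ?y = ip C x x - (\<Sum>i<r. ip C (v i) x * ip C x (v i))"
    by (simp add: ip_diff_right ip_sum_right ip_scale_right)
  also have "(\<Sum>i<r. ip C (v i) x * ip C x (v i)) = of_real (\<Sum>i<r. (cmod (ip C (v i) x))^2)"
    unfolding of_real_sum cmod_sq_eq ip_cnj by (simp add: mult.commute)
  finally have "complex_of_real (nsq C ?y) = of_real (nsq C x - (\<Sum>i<r. (cmod (ip C (v i) x))^2))"
    by (simp add: ip_self)
  then show ?thesis by (simp only: of_real_eq_iff)
qed

lemma nsq_unit: "finite C \<Longrightarrow> c \<in> C \<Longrightarrow> nsq C (\<lambda>c'. of_bool (c' = c)) = 1"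
  by (simp add: nsq_def of_bool_def if_distrib if_distribR cong: if_cong)

lemma ip_unit: "finite C \<Longrightarrow> c \<in> C \<Longrightarrow> ip C x (\<lambda>c'. of_bool (c' = c)) = cnj (x c)"
  by (simp add: ip_def)

lemma nsq_orthonormal:
  assumes "orthonormal C r v" "i < r" shows "nsq C (v i) = 1"
proof -
  have "complex_of_real (nsq C (v i)) = of_real 1"
    using assms by (simp add: orthonormal_def ip_self[symmetric])
  then show ?thesis by (simp only: of_real_eq_iff)
qed

lemma sum_coords:
  assumes "orthonormal C r v"
  shows "(\<Sum>c\<in>C. \<Sum>i<r. (cmod (v i c))^2) = real r"
  by (subst sum.swap) (simp add: nsq_def[symmetric] nsq_orthonormal[OF assms])

text \<open>By \<open>sum_coords\<close> the squared lengths of the projections of the coordinate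
  vectors onto the span add up to \<open>r\<close>, which is less than \<open>card C\<close>; so
  some coordinate vector has a nonzero residual, and its normalisation is the witness.\<close>

lemma exists_orthogonal_unit:
  assumes "finite C" "orthonormal C r v" "r < card C"
  shows "\<exists>z. nsq C z = 1 \<and> (\<forall>i<r. ip C (v i) z = 0)"
proof -
  have "\<exists>c\<in>C. (\<Sum>i<r. (cmod (v i c))^2) < 1"
  proof (rule ccontr)
    assume "\<not> ?thesis"
    then have "(\<Sum>c\<in>C. 1) \<le> (\<Sum>c\<in>C. \<Sum>i<r. (cmod (v i c))^2)"
      by (intro sum_mono) (auto simp: not_less)
    then show False using assms sum_coords[OF assms(2)] by simp
  qed
  then obtain c where c: "c \<in> C" "(\<Sum>i<r. (cmod (v i c))^2) < 1" by blast
  define e where "e = (\<lambda>c'. of_bool (c' = c) :: complex)"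
  define y where "y = (\<lambda>c. e c - (\<Sum>i<r. ip C (v i) e * v i c))"
  have "nsq C e = 1" unfolding e_def by (rule nsq_unit[OF assms(1) c(1)])
  then have pos: "nsq C y > 0"
    using c nsq_residual[OF assms(2), of e] ip_unit[OF assms(1) c(1)] by (simp add: y_def e_def)
  define z where "z = (\<lambda>c. of_real (1 / sqrt (nsq C y)) * y c)"
  have "nsq C z = 1"
    using pos by (simp only: z_def nsq_scale) (simp add: norm_divide power_divide)
  moreover have "ip C (v i) z = 0" if "i < r" for i
    unfolding z_def ip_scale_right unfolding y_def proj_residual[OF assms(2) that] by simp
  ultimately show ?thesis by blast
qed

text \<open>The quadratic form is maximised over the unit vectors orthogonal to the eigenvectors
  found so far; the first-order condition at a maximiser is the eigenvalue equation, with the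
  maximum as eigenvalue.\<close>

lemma exists_next_eigenvector:
  assumes C: "finite C" and h: "herm C \<rho>" and on: "orthonormal C r v" and r: "r < card C"
    and ev: "\<And>i c. i < r \<Longrightarrow> c \<in> C \<Longrightarrow> mat_app C \<rho> (v i) c = of_real (\<mu> i) * v i c"
  shows "\<exists>z l. nsq C z = 1 \<and> (\<forall>i<r. ip C (v i) z = 0) \<and>
           (\<forall>c\<in>C. mat_app C \<rho> z c = of_real l * z c)"
proof -
  define K where "K = {z. (\<forall>c\<in>C. cmod (z c) \<le> 1) \<and> (\<forall>c. c \<notin> C \<longrightarrow> z c = 0)}"
  define S where "S = K \<inter> ({z. nsq C z = 1} \<inter> {z. \<forall>i\<in>{..<r}. ip C (v i) z = 0})"
  let ?q = "\<lambda>z. Re (ip C z (mat_app C \<rho> z))"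
  have cl1: "closed {z. nsq C z = 1}"
    unfolding nsq_def by (intro closed_Collect_eq continuous_intros) auto
  have cl2: "closed {z. \<forall>i\<in>{..<r}. ip C (v i) z = 0}"
  proof -
    have "closed (\<Inter>i\<in>{..<r}. {z. ip C (v i) z = 0})"
      unfolding ip_def by (intro closed_INT ballI closed_Collect_eq continuous_intros) auto
    moreover have "(\<Inter>i\<in>{..<r}. {z. ip C (v i) z = 0}) = {z. \<forall>i\<in>{..<r}. ip C (v i) z = 0}" by auto
    ultimately show ?thesis by simp
  qed
  have "compact S"
    unfolding S_def K_def by (intro compact_Int_closed compact_poly closed_Int cl1 cl2)
  moreover have "S \<noteq> {}"
  proof -
    obtain z where z: "nsq C z = 1" "\<forall>i<r. ip C (v i) z = 0"
      using exists_orthogonal_unit[OF C on r] by blast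
    define z' where "z' = (\<lambda>c. if c \<in> C then z c else 0)"
    have "nsq C z' = 1" "\<forall>i<r. ip C (v i) z' = 0"
      using z by (simp_all add: z'_def nsq_def ip_def)
    moreover from this(1) have "cmod (z' c) \<le> 1" if "c \<in> C" for c
      using nsq_coord_le[OF C _ that] by blast
    ultimately have "z' \<in> S" by (auto simp: S_def K_def z'_def)
    then show ?thesis by blast
  qed
  moreover have "continuous_on S ?q"
    unfolding ip_def mat_app_def
    by (intro continuous_intros continuous_on_subset[OF continuous_on_product_coordinates]) auto
  ultimately obtain z where z: "z \<in> S" and mx: "\<And>y. y \<in> S \<Longrightarrow> ?q y \<le> ?q z"
    using continuous_attains_sup[of S ?q] by blast
  define l where "l = ?q z"
  have z1: "nsq C z = 1" and zo: "\<And>i. i < r \<Longrightarrow> ip C (v i) z = 0" and z0: "\<And>c. c \<notin> C \<Longrightarrow> z c = 0"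
    using z by (auto simp: S_def K_def)
  have qbound: "?q y \<le> l * nsq C y" if yo: "\<And>i. i < r \<Longrightarrow> ip C (v i) y = 0" for y
  proof (cases "nsq C y = 0")
    case True
    then have "\<forall>c\<in>C. y c = 0" using nsq_eq_0[OF C] by blast
    then have "?q y = 0" by (simp add: ip_def)
    then show ?thesis using True by simp
  next
    case False
    then have pos: "nsq C y > 0" using nsq_nonneg[of C y] by linarith
    define a where "a = complex_of_real (1 / sqrt (nsq C y))"
    have a2: "(cmod a)^2 = 1 / nsq C y" using pos by (simp add: a_def norm_divide power_divide)
    define y' where "y' = (\<lambda>c. if c \<in> C then a * y c else 0)"
    have n1: "nsq C y' = 1"
    proof -
      have "nsq C y' = nsq C (\<lambda>c. a * y c)" by (simp add: nsq_def y'_def)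
      then show ?thesis using pos by (simp add: nsq_scale a2)
    qed
    have "cmod (y' c) \<le> 1" if "c \<in> C" for c
      by (rule nsq_coord_le[OF C n1 that])
    moreover have "ip C (v i) y' = 0" if "i < r" for i
    proof -
      have "ip C (v i) y' = ip C (v i) (\<lambda>c. a * y c)" by (rule ip_cong) (auto simp: y'_def)
      then show ?thesis using yo[OF that] by (simp add: ip_scale_right)
    qed
    ultimately have "y' \<in> S" using n1 by (auto simp: S_def K_def y'_def)
    then have "?q y' \<le> l" using mx by (simp add: l_def)
    moreover have "ip C y' (mat_app C \<rho> y') = of_real (1 / nsq C y) * ip C y (mat_app C \<rho> y)"
    proof -
      have m: "mat_app C \<rho> y' = (\<lambda>c. a * mat_app C \<rho> y c)"
        unfolding mat_app_def y'_def sum_distrib_left by (intro ext sum.cong) (auto simp: mult_ac)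
      have "ip C y' (mat_app C \<rho> y') = ip C (\<lambda>c. a * y c) (\<lambda>c. a * mat_app C \<rho> y c)"
        unfolding m by (rule ip_cong) (auto simp: y'_def)
      then show ?thesis unfolding a2[symmetric] cmod_sq_eq by (simp add: ip_scale_right ip_scale_left)
    qed
    ultimately have "?q y / nsq C y \<le> l"
      by (simp del: of_real_divide)
    then show ?thesis using pos by (simp add: divide_le_eq)
  qed
  \<comment> \<open>The residual of the eigenvalue equation. It is orthogonal to the earlier
    eigenvectors because \<rho> preserves their span, so \<open>z + s * h\<close> is an admissible
    competitor for every real \<open>s\<close>.\<close>
  define h where "h = (\<lambda>c. mat_app C \<rho> z c - of_real l * z c)"
  have ho: "ip C (v i) h = 0" if i: "i < r" for i
  proof -
    have "ip C (v i) (mat_app C \<rho> z) = ip C (mat_app C \<rho> (v i)) z" by (rule ip_mat_app[OF assms(2)])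
    also have "... = ip C (\<lambda>c. of_real (\<mu> i) * v i c) z" using ev[OF i] by (intro ip_cong) auto
    also have "... = 0" by (simp add: ip_scale_left zo[OF i])
    finally show ?thesis by (simp add: h_def ip_diff_right ip_scale_right zo[OF i])
  qed
  have "nsq C h = 0"
  proof (rule ccontr)
    assume "nsq C h \<noteq> 0"
    then have hp: "nsq C h > 0" using nsq_nonneg[of C h] by linarith
    have ineq: "2 * s * nsq C h \<le> s^2 * (l * nsq C h - ?q h)" for s :: real
    proof -
      let ?y = "\<lambda>c. z c + of_real s * h c"
      have "?q ?y \<le> l * nsq C ?y"
        by (rule qbound) (simp add: ip_add_right ip_scale_right zo ho)
      moreover have "nsq C ?y = 1 + 2 * s * Re (ip C h z) + s^2 * nsq C h"
      proof -
        have "complex_of_real (nsq C ?y) = ip C z z + of_real s * ip C z h + of_real s * ip C h z + of_real (s^2) * ip C h h"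
          unfolding ip_self[symmetric]
          by (simp add: ip_add_right ip_add_left ip_scale_left ip_scale_right power2_eq_square algebra_simps)
        then have "Re (complex_of_real (nsq C ?y)) = Re (ip C z z + of_real s * ip C z h + of_real s * ip C h z + of_real (s^2) * ip C h h)"
          by simp
        moreover have "Re (ip C z h) = Re (ip C h z)" using ip_cnj[of C z h] by (metis complex_cnj(1) cnj.simps(1))
        ultimately show ?thesis by (simp add: ip_self z1)
      qed
      moreover have "?q ?y = l + 2 * s * Re (ip C h (mat_app C \<rho> z)) + s^2 * ?q h"
      proof -
        have "Re (ip C z (mat_app C \<rho> h)) = Re (ip C h (mat_app C \<rho> z))"
          using ip_mat_app[OF assms(2), of z h] ip_cnj[of C h "mat_app C \<rho> z"] by (metis cnj.simps(1))
        then show ?thesis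
          by (simp add: mat_app_add_scale ip_add_right ip_add_left ip_scale_left ip_scale_right l_def
               power2_eq_square algebra_simps)
      qed
      moreover have "Re (ip C h (mat_app C \<rho> z)) - l * Re (ip C h z) = nsq C h"
      proof -
        have "ip C h h = ip C h (mat_app C \<rho> z) - of_real l * ip C h z"
          by (subst (2) h_def) (simp add: ip_diff_right ip_scale_right)
        from arg_cong[OF this, of Re] show ?thesis by (simp add: ip_self)
      qed
      ultimately have I: "l + 2 * s * Re (ip C h (mat_app C \<rho> z)) + s^2 * ?q h
            \<le> l * (1 + 2 * s * Re (ip C h z) + s^2 * nsq C h)"
          and N: "nsq C h = Re (ip C h (mat_app C \<rho> z)) - l * Re (ip C h z)"
        by simp_all
      have "2 * s * nsq C h = 2 * s * Re (ip C h (mat_app C \<rho> z)) - l * (2 * s * Re (ip C h z))"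
        by (subst N) (simp add: algebra_simps)
      then show ?thesis using I by (simp only: distrib_left right_diff_distrib mult_1_right mult_ac)
    qed
    define b where "b = l * nsq C h - ?q h"
    \<comment> \<open>Any \<open>s > 0\<close> with \<open>s * b < 2 * nsq C h\<close> contradicts
      \<open>ineq\<close>; the summand 1 in the denominator covers \<open>b = 0\<close>.\<close>
    define s where "s = nsq C h / (\<bar>b\<bar> + 1)"
    have sp: "s > 0" using hp by (simp add: s_def add_nonneg_pos)
    from ineq[of s] have "s * (2 * nsq C h) \<le> s * (s * b)" by (simp add: b_def power2_eq_square mult_ac)
    then have "2 * nsq C h \<le> s * b" using sp by (simp only: mult_le_cancel_left_pos)
    also have "s * b \<le> s * (\<bar>b\<bar> + 1)" using sp by (intro mult_left_mono) auto
    also have "... = nsq C h" by (simp add: s_def)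
    finally show False using hp by simp
  qed
  then have "\<forall>c\<in>C. mat_app C \<rho> z c = of_real l * z c"
    using nsq_eq_0[OF C] by (auto simp: h_def)
  then show ?thesis using z1 zo by blast
qed

definition eigen_dec :: "'a set \<Rightarrow> ('a \<Rightarrow> 'a \<Rightarrow> complex) \<Rightarrow> (nat \<Rightarrow> 'a \<Rightarrow> complex) \<Rightarrow> (nat \<Rightarrow> real) \<Rightarrow> bool" where
  "eigen_dec C \<rho> v \<mu> \<longleftrightarrow> orthonormal C (card C) v \<and>
     (\<forall>i<card C. \<forall>c\<in>C. mat_app C \<rho> (v i) c = of_real (\<mu> i) * v i c)"

lemma exists_eigen_dec:
  assumes C: "finite C" and h: "herm C \<rho>"
  shows "\<exists>v \<mu>. eigen_dec C \<rho> v \<mu>"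
proof -
  have "\<exists>v \<mu>. orthonormal C r v \<and> (\<forall>i<r. \<forall>c\<in>C. mat_app C \<rho> (v i) c = of_real (\<mu> i) * v i c)"
    if "r \<le> card C" for r
    using that
  proof (induction r)
    case 0
    then show ?case by (auto simp: orthonormal_def)
  next
    case (Suc r)
    then obtain v \<mu> where v: "orthonormal C r v" "\<forall>i<r. \<forall>c\<in>C. mat_app C \<rho> (v i) c = of_real (\<mu> i) * v i c"
      by auto
    obtain z l where z: "nsq C z = 1" "\<forall>i<r. ip C (v i) z = 0" "\<forall>c\<in>C. mat_app C \<rho> z c = of_real l * z c"
      using exists_next_eigenvector[OF C h v(1), of \<mu>] v(2) Suc.prems by auto
    have "ip C z (v i) = 0" if "i < r" for i
      using z(2) that ip_cnj[of C "v i" z] by simp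
    then have "orthonormal C (Suc r) (v(r := z))"
      using v(1) z by (auto simp: orthonormal_def ip_self less_Suc_eq)
    moreover have "\<forall>i<Suc r. \<forall>c\<in>C. mat_app C \<rho> ((v(r := z)) i) c = of_real ((\<mu>(r := l)) i) * (v(r := z)) i c"
      using v(2) z(3) by (auto simp: less_Suc_eq)
    ultimately show ?case by blast
  qed
  then show ?thesis unfolding eigen_dec_def by blast
qed

text \<open>Completeness by counting. Bessel's inequality bounds the squared projection of each
  coordinate vector by 1, and these numbers add up to \<open>card C\<close>; hence all are 1 and
  every coordinate vector lies in the span.\<close>

lemma orthonormal_expand:
  assumes C: "finite C" and on: "orthonormal C (card C) v" and c: "c \<in> C"
  shows "x c = (\<Sum>i<card C. ip C (v i) x * v i c)"
proof -
  have one: "(\<Sum>i<card C. (cmod (v i d))^2) = 1" if d: "d \<in> C" for d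
  proof -
    have le: "(\<Sum>i<card C. (cmod (v i d))^2) \<le> 1" if d: "d \<in> C" for d
    proof -
      let ?e = "\<lambda>c'. of_bool (c' = d) :: complex"
      show ?thesis
        using nsq_unit[OF C d] nsq_nonneg[of C "\<lambda>c. ?e c - (\<Sum>i<card C. ip C (v i) ?e * v i c)"]
        unfolding nsq_residual[OF on] using ip_unit[OF C d] by simp
    qed
    have "(\<Sum>d\<in>C. 1 - (\<Sum>i<card C. (cmod (v i d))^2)) = 0"
      using sum_coords[OF on] by (simp add: sum_subtractf)
    then show ?thesis
      using le d C by (subst (asm) sum_nonneg_eq_0_iff) auto
  qed
  have res: "nsq C (\<lambda>c. of_bool (c = d) - (\<Sum>i<card C. cnj (v i d) * v i c)) = 0" if d: "d \<in> C" for d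
  proof -
    let ?e = "\<lambda>c'. of_bool (c' = d) :: complex"
    show ?thesis
      using nsq_unit[OF C d] nsq_residual[OF on, of ?e] ip_unit[OF C d] one[OF d] by simp
  qed
  have comp: "(\<Sum>i<card C. cnj (v i d) * v i c) = of_bool (c = d)" if d: "d \<in> C" for d
    using res[OF d] c nsq_eq_0[OF C] by (metis (no_types, lifting) eq_iff_diff_eq_0)
  have "(\<Sum>i<card C. ip C (v i) x * v i c) = (\<Sum>d\<in>C. x d * (\<Sum>i<card C. cnj (v i d) * v i c))"
    by (simp add: ip_def sum_distrib_left sum_distrib_right mult_ac) (rule sum.swap)
  also have "... = (\<Sum>d\<in>C. x d * of_bool (c = d))" using comp by simp
  also have "... = x c" using C c by simp
  finally show ?thesis by simp
qed

lemma parseval: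
  assumes C: "finite C" and on: "orthonormal C (card C) v"
  shows "ip C x y = (\<Sum>i<card C. cnj (ip C (v i) x) * ip C (v i) y)"
proof -
  have "ip C x y = ip C x (\<lambda>c. \<Sum>i<card C. ip C (v i) y * v i c)"
    using orthonormal_expand[OF C on] by (intro ip_cong) auto
  also have "... = (\<Sum>i<card C. ip C (v i) y * ip C x (v i))"
    unfolding ip_sum_right ip_scale_right ..
  finally show ?thesis by (simp add: ip_cnj mult.commute)
qed

lemma parseval_nsq:
  assumes C: "finite C" and on: "orthonormal C (card C) v"
  shows "nsq C x = (\<Sum>i<card C. (cmod (ip C (v i) x))^2)"
proof -
  have "complex_of_real (nsq C x) = of_real (\<Sum>i<card C. (cmod (ip C (v i) x))^2)"
    unfolding ip_self[symmetric] parseval[OF C on, of x x] of_real_sum cmod_sq_eq ..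
  then show ?thesis by (simp only: of_real_eq_iff)
qed

section \<open>Relative entropy and canonical purifications\<close>

definition qf :: "'a set \<Rightarrow> ('a \<Rightarrow> 'a \<Rightarrow> complex) \<Rightarrow> ('a \<Rightarrow> complex) \<Rightarrow> real" where
  "qf C \<rho> x = Re (ip C x (mat_app C \<rho> x))"

definition psd :: "'a set \<Rightarrow> ('a \<Rightarrow> 'a \<Rightarrow> complex) \<Rightarrow> bool" where
  "psd C \<rho> \<longleftrightarrow> herm C \<rho> \<and> (\<forall>x. 0 \<le> qf C \<rho> x)"

definition trace_on :: "'a set \<Rightarrow> ('a \<Rightarrow> 'a \<Rightarrow> complex) \<Rightarrow> real" where
  "trace_on C \<rho> = (\<Sum>c\<in>C. Re (\<rho> c c))"

definition eigvec :: "'a set \<Rightarrow> ('a \<Rightarrow> 'a \<Rightarrow> complex) \<Rightarrow> nat \<Rightarrow> 'a \<Rightarrow> complex" where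
  "eigvec C \<rho> = fst (SOME p. eigen_dec C \<rho> (fst p) (snd p))"

definition eigval :: "'a set \<Rightarrow> ('a \<Rightarrow> 'a \<Rightarrow> complex) \<Rightarrow> nat \<Rightarrow> real" where
  "eigval C \<rho> = snd (SOME p. eigen_dec C \<rho> (fst p) (snd p))"

lemma eigen_dec_eig:
  assumes "finite C" "herm C \<rho>" shows "eigen_dec C \<rho> (eigvec C \<rho>) (eigval C \<rho>)"
proof -
  have "\<exists>p. eigen_dec C \<rho> (fst p) (snd p)" using exists_eigen_dec[OF assms] by auto
  then show ?thesis unfolding eigvec_def eigval_def by (rule someI_ex)
qed

lemma ip_eigvec_mat_app:
  assumes h: "herm C \<rho>" and e: "eigen_dec C \<rho> v \<mu>" and i: "i < card C"
  shows "ip C (v i) (mat_app C \<rho> x) = of_real (\<mu> i) * ip C (v i) x"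
proof -
  have "ip C (v i) (mat_app C \<rho> x) = ip C (mat_app C \<rho> (v i)) x" by (rule ip_mat_app[OF h])
  also have "... = ip C (\<lambda>c. of_real (\<mu> i) * v i c) x"
    using e i by (intro ip_cong) (auto simp: eigen_dec_def)
  finally show ?thesis by (simp add: ip_scale_left)
qed

lemma qf_eigen_dec:
  assumes C: "finite C" and h: "herm C \<rho>" and e: "eigen_dec C \<rho> v \<mu>"
  shows "qf C \<rho> x = (\<Sum>i<card C. \<mu> i * (cmod (ip C (v i) x))^2)"
proof -
  have on: "orthonormal C (card C) v" using e by (simp add: eigen_dec_def)
  have "ip C x (mat_app C \<rho> x) = (\<Sum>i<card C. of_real (\<mu> i) * (cnj (ip C (v i) x) * ip C (v i) x))"
    unfolding parseval[OF C on, of x "mat_app C \<rho> x"]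
    by (intro sum.cong) (simp_all add: ip_eigvec_mat_app[OF h e])
  also have "... = of_real (\<Sum>i<card C. \<mu> i * (cmod (ip C (v i) x))^2)"
    by (simp add: cmod_sq_eq[symmetric])
  finally show ?thesis by (simp add: qf_def)
qed

lemma matrix_eigen_dec:
  assumes C: "finite C" and h: "herm C \<rho>" and e: "eigen_dec C \<rho> v \<mu>" and c: "c \<in> C" "c' \<in> C"
  shows "\<rho> c c' = (\<Sum>i<card C. of_real (\<mu> i) * v i c * cnj (v i c'))"
proof -
  let ?e = "\<lambda>d. of_bool (d = c') :: complex"
  have on: "orthonormal C (card C) v" using e by (simp add: eigen_dec_def)
  have "\<rho> c c' = mat_app C \<rho> ?e c"
    using C c by (simp add: mat_app_def)
  also have "... = (\<Sum>i<card C. ip C (v i) (mat_app C \<rho> ?e) * v i c)"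
    by (rule orthonormal_expand[OF C on c(1)])
  finally show ?thesis
    by (simp add: ip_eigvec_mat_app[OF h e] ip_unit[OF C c(2)] mult_ac)
qed

lemma trace_eigen_dec:
  assumes C: "finite C" and h: "herm C \<rho>" and e: "eigen_dec C \<rho> v \<mu>"
  shows "trace_on C \<rho> = (\<Sum>i<card C. \<mu> i)"
proof -
  have on: "orthonormal C (card C) v" using e by (simp add: eigen_dec_def)
  have "trace_on C \<rho> = (\<Sum>c\<in>C. \<Sum>i<card C. \<mu> i * (cmod (v i c))^2)"
    unfolding trace_on_def
  proof (rule sum.cong)
    fix c assume c: "c \<in> C"
    have "\<rho> c c = of_real (\<Sum>i<card C. \<mu> i * (cmod (v i c))^2)"
      unfolding matrix_eigen_dec[OF C h e c c] of_real_sum of_real_mult cmod_sq_eq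
      by (simp add: mult_ac)
    then show "Re (\<rho> c c) = (\<Sum>i<card C. \<mu> i * (cmod (v i c))^2)" by simp
  qed simp
  also have "... = (\<Sum>i<card C. \<mu> i * nsq C (v i))"
    unfolding nsq_def sum_distrib_left by (rule sum.swap)
  also have "... = (\<Sum>i<card C. \<mu> i)"
    by (intro sum.cong) (simp_all add: nsq_orthonormal[OF on])
  finally show ?thesis .
qed

lemma qf_eigvec:
  assumes C: "finite C" and h: "herm C \<rho>" and e: "eigen_dec C \<rho> v \<mu>" and i: "i < card C"
  shows "qf C \<rho> (v i) = \<mu> i"
proof -
  have on: "orthonormal C (card C) v" using e by (simp add: eigen_dec_def)
  show ?thesis
    unfolding qf_def ip_eigvec_mat_app[OF h e i] ip_self using nsq_orthonormal[OF on i] by simp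
qed

lemma eigval_nonneg:
  assumes "finite C" "psd C \<rho>" "eigen_dec C \<rho> v \<mu>" "i < card C"
  shows "0 \<le> \<mu> i"
  using assms qf_eigvec[of C \<rho> v \<mu> i] unfolding psd_def by metis

text \<open>Negative von Neumann entropy and its cross version; \<open>ln 0 = 0\<close> makes null eigenvalues harmless.\<close>

definition eta :: "'a set \<Rightarrow> ('a \<Rightarrow> 'a \<Rightarrow> complex) \<Rightarrow> real" where
  "eta C \<rho> = (\<Sum>i<card C. eigval C \<rho> i * ln (eigval C \<rho> i))"

definition cross :: "'a set \<Rightarrow> ('a \<Rightarrow> 'a \<Rightarrow> complex) \<Rightarrow> ('a \<Rightarrow> 'a \<Rightarrow> complex) \<Rightarrow> real" where
  "cross C \<rho> \<tau> = (\<Sum>j<card C. qf C \<rho> (eigvec C \<tau> j) * ln (eigval C \<tau> j))"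

text \<open>The positive square root with its second index transposed, read as a bipartite state whose
  reduced state on the first index is \<open>\<rho>\<close>.\<close>

definition canon :: "'a set \<Rightarrow> ('a \<Rightarrow> 'a \<Rightarrow> complex) \<Rightarrow> 'a \<Rightarrow> 'a \<Rightarrow> complex" where
  "canon C \<rho> c a = (\<Sum>i<card C. of_real (sqrt (eigval C \<rho> i)) * (eigvec C \<rho> i c * cnj (eigvec C \<rho> i a)))"

definition nsq2 :: "'a set \<Rightarrow> 'b set \<Rightarrow> ('a \<Rightarrow> 'b \<Rightarrow> complex) \<Rightarrow> real" where
  "nsq2 A B \<psi> = (\<Sum>a\<in>A. \<Sum>b\<in>B. (cmod (\<psi> a b))^2)"

lemma cross_self:
  assumes "finite C" "herm C \<rho>" shows "cross C \<rho> \<rho> = eta C \<rho>"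
  unfolding cross_def eta_def
  by (intro sum.cong) (simp_all add: qf_eigvec[OF assms eigen_dec_eig[OF assms]])

lemma cmod_diff_sq: "(cmod (x - y))^2 = (cmod x)^2 + (cmod y)^2 - 2 * Re (cnj x * y)"
  unfolding cmod_power2 by (simp add: power2_eq_square algebra_simps)

lemma sum_mult_product:
  fixes k :: "'c::comm_semiring_0"
  shows "(\<Sum>c\<in>C. \<Sum>a\<in>A. k * (f c * g a)) = k * ((\<Sum>c\<in>C. f c) * (\<Sum>a\<in>A. g a))"
  by (subst sum_product) (simp add: sum_distrib_left)

text \<open>For positive matrices this is the trace of the product of their square roots, evaluated
  in the two eigenbases.\<close>

lemma sum_canon:
  assumes "finite C"
  shows "(\<Sum>c\<in>C. \<Sum>a\<in>C. cnj (canon C \<rho> c a) * canon C \<tau> c a) =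
    of_real (\<Sum>i<card C. \<Sum>j<card C. sqrt (eigval C \<rho> i) * sqrt (eigval C \<tau> j) *
       (cmod (ip C (eigvec C \<rho> i) (eigvec C \<tau> j)))^2)"
proof -
  let ?u = "eigvec C \<rho>" and ?v = "eigvec C \<tau>"
  let ?r = "\<lambda>i. complex_of_real (sqrt (eigval C \<rho> i))" and ?s = "\<lambda>i. complex_of_real (sqrt (eigval C \<tau> i))"
  let ?n = "card C"
  let ?E = "\<lambda>c a i j. ?r i * ?s j * ((cnj (?u i c) * ?v j c) * cnj (cnj (?u i a) * ?v j a))"
  have "(\<Sum>c\<in>C. \<Sum>a\<in>C. cnj (canon C \<rho> c a) * canon C \<tau> c a) =
    (\<Sum>c\<in>C. \<Sum>a\<in>C. \<Sum>i<?n. \<Sum>j<?n. ?E c a i j)"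
    by (simp add: canon_def sum_product mult_ac)
  also have "... = (\<Sum>c\<in>C. \<Sum>i<?n. \<Sum>a\<in>C. \<Sum>j<?n. ?E c a i j)"
    by (intro sum.cong sum.swap refl)
  also have "... = (\<Sum>i<?n. \<Sum>c\<in>C. \<Sum>a\<in>C. \<Sum>j<?n. ?E c a i j)"
    by (rule sum.swap)
  also have "... = (\<Sum>i<?n. \<Sum>c\<in>C. \<Sum>j<?n. \<Sum>a\<in>C. ?E c a i j)"
    by (intro sum.cong sum.swap refl)
  also have "... = (\<Sum>i<?n. \<Sum>j<?n. \<Sum>c\<in>C. \<Sum>a\<in>C. ?E c a i j)"
    by (intro sum.cong sum.swap refl)
  also have "... = (\<Sum>i<?n. \<Sum>j<?n. ?r i * ?s j * (ip C (?u i) (?v j) * cnj (ip C (?u i) (?v j))))"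
    by (simp only: ip_def cnj_sum sum_mult_product)
  also have "... = (\<Sum>i<?n. \<Sum>j<?n. ?r i * ?s j * of_real ((cmod (ip C (?u i) (?v j)))^2))"
    unfolding cmod_sq_eq by (simp only: mult.commute)
  finally show ?thesis by simp
qed

lemma nsq2_canon:
  assumes C: "finite C" and p: "psd C \<rho>"
  shows "nsq2 C C (canon C \<rho>) = trace_on C \<rho>"
proof -
  let ?u = "eigvec C \<rho>" and ?n = "card C"
  have h: "herm C \<rho>" using p by (simp add: psd_def)
  note e = eigen_dec_eig[OF C h]
  have on: "orthonormal C ?n ?u" using e by (simp add: eigen_dec_def)
  have "complex_of_real (nsq2 C C (canon C \<rho>)) = of_real (\<Sum>i<?n. \<Sum>j<?n. sqrt (eigval C \<rho> i) * sqrt (eigval C \<rho> j) *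
       (cmod (ip C (?u i) (?u j)))^2)"
    unfolding nsq2_def of_real_sum cmod_sq_eq unfolding sum_canon[OF C, of \<rho> \<rho>] by simp
  then have "nsq2 C C (canon C \<rho>) = (\<Sum>i<?n. \<Sum>j<?n. sqrt (eigval C \<rho> i) * sqrt (eigval C \<rho> j) *
       (cmod (ip C (?u i) (?u j)))^2)"
    by (simp only: of_real_eq_iff)
  also have "... = (\<Sum>i<?n. \<Sum>j<?n. if j = i then eigval C \<rho> i else 0)"
    using on eigval_nonneg[OF C p e] by (intro sum.cong refl) (auto simp: orthonormal_def)
  also have "... = trace_on C \<rho>" by (simp add: trace_eigen_dec[OF C h e])
  finally show ?thesis .
qed

lemma nsq2_canon_diff:
  assumes C: "finite C" and "psd C \<rho>" "psd C \<tau>"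
  shows "nsq2 C C (\<lambda>c a. canon C \<rho> c a - canon C \<tau> c a) = trace_on C \<rho> + trace_on C \<tau> -
     2 * (\<Sum>i<card C. \<Sum>j<card C. sqrt (eigval C \<rho> i) * sqrt (eigval C \<tau> j) *
       (cmod (ip C (eigvec C \<rho> i) (eigvec C \<tau> j)))^2)"
proof -
  have "nsq2 C C (\<lambda>c a. canon C \<rho> c a - canon C \<tau> c a) = nsq2 C C (canon C \<rho>) + nsq2 C C (canon C \<tau>) -
     2 * Re (\<Sum>c\<in>C. \<Sum>a\<in>C. cnj (canon C \<rho> c a) * canon C \<tau> c a)"
    unfolding nsq2_def cmod_diff_sq Re_sum by (simp add: sum_subtractf sum.distrib sum_distrib_left)
  then show ?thesis
    unfolding sum_canon[OF C] nsq2_canon[OF C assms(2)] nsq2_canon[OF C assms(3)] Re_complex_of_real .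
qed

text \<open>For \<open>x > 0\<close> this is \<open>ln s \<le> s - 1\<close> at
  \<open>s = sqrt (y / x)\<close>, multiplied by \<open>2 * x\<close>. The last assumption excludes
  \<open>x > 0 = y\<close>, where the convention \<open>ln 0 = 0\<close> would stand in for an
  infinite value.\<close>

lemma entropy_term_ge:
  fixes x y :: real
  assumes "0 \<le> x" "0 \<le> y" "y = 0 \<Longrightarrow> x = 0"
  shows "x + y - 2 * (sqrt x * sqrt y) \<le> x * ln x - x * ln y - x + y"
proof (cases "x = 0")
  case True
  then show ?thesis using assms by simp
next
  case False
  then have p: "x > 0" "y > 0" using assms by force+
  have "ln (sqrt (y / x)) \<le> sqrt (y / x) - 1" using p by (intro ln_le_minus_one) simp
  then have "ln y - ln x \<le> 2 * (sqrt (y / x) - 1)" using p by (simp add: ln_sqrt ln_div)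
  then have "x * (ln y - ln x) \<le> x * (2 * (sqrt (y / x) - 1))" using p by (intro mult_left_mono) auto
  moreover have "x * sqrt (y / x) = sqrt x * sqrt y"
    using p by (simp add: real_sqrt_divide) (metis less_imp_le mult.assoc mult.commute real_div_sqrt times_divide_eq_right)
  ultimately show ?thesis by (simp add: algebra_simps)
qed

text \<open>Domination forces the kernel of \<tau> into the kernel of \<rho>, so the terms with
  \<open>ln 0\<close> come with weight 0.\<close>

lemma dominated_null:
  assumes C: "finite C" and p: "psd C \<rho>" "psd C \<tau>" and dom: "\<And>x. qf C \<rho> x \<le> K * qf C \<tau> x"
    and ij: "i < card C" "j < card C" and z: "eigval C \<tau> j = 0"
  shows "eigval C \<rho> i * (cmod (ip C (eigvec C \<rho> i) (eigvec C \<tau> j)))^2 = 0"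
proof -
  have h: "herm C \<rho>" "herm C \<tau>" using p by (simp_all add: psd_def)
  note e = eigen_dec_eig[OF C h(1)] eigen_dec_eig[OF C h(2)]
  have "qf C \<rho> (eigvec C \<tau> j) \<le> 0"
    using dom[of "eigvec C \<tau> j"] z by (simp add: qf_eigvec[OF C h(2) e(2) ij(2)])
  then have "(\<Sum>i<card C. eigval C \<rho> i * (cmod (ip C (eigvec C \<rho> i) (eigvec C \<tau> j)))^2) \<le> 0"
    by (simp add: qf_eigen_dec[OF C h(1) e(1)])
  moreover have "eigval C \<rho> i * (cmod (ip C (eigvec C \<rho> i) (eigvec C \<tau> j)))^2 \<le>
      (\<Sum>i<card C. eigval C \<rho> i * (cmod (ip C (eigvec C \<rho> i) (eigvec C \<tau> j)))^2)"
    by (rule member_le_sum) (use ij eigval_nonneg[OF C p(1) e(1)] in auto)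
  moreover have "0 \<le> eigval C \<rho> i * (cmod (ip C (eigvec C \<rho> i) (eigvec C \<tau> j)))^2"
    using eigval_nonneg[OF C p(1) e(1) ij(1)] by simp
  ultimately show ?thesis by linarith
qed

lemma sum_overlap:
  assumes C: "finite C" and on: "orthonormal C (card C) u" "orthonormal C (card C) v" and i: "i < card C"
  shows "(\<Sum>j<card C. (cmod (ip C (u i) (v j)))^2) = 1" "(\<Sum>j<card C. (cmod (ip C (u j) (v i)))^2) = 1"
proof -
  show "(\<Sum>j<card C. (cmod (ip C (u j) (v i)))^2) = 1"
    using parseval_nsq[OF C on(1), of "v i"] nsq_orthonormal[OF on(2) i] by simp
  have "cmod (ip C (u i) (v j)) = cmod (ip C (v j) (u i))" for j
    by (metis complex_mod_cnj ip_cnj)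
  then show "(\<Sum>j<card C. (cmod (ip C (u i) (v j)))^2) = 1"
    using parseval_nsq[OF C on(2), of "u i"] nsq_orthonormal[OF on(1) i] by simp
qed

text \<open>Both sides are sums over pairs of eigenvectors with the doubly stochastic weights
  \<open>P i j\<close>, so \<open>entropy_term_ge\<close> can be applied pair by pair and no
  operator logarithm is needed. Domination guarantees that the relative entropy is finite. For two
  states the traces cancel, which leaves the bound on the distance of the purifications and,
  dropping it, Klein's inequality.\<close>

lemma relative_entropy_ge:
  assumes C: "finite C" and p: "psd C \<rho>" "psd C \<tau>" and dom: "\<And>x. qf C \<rho> x \<le> K * qf C \<tau> x"
  shows "trace_on C \<rho> - trace_on C \<tau> + nsq2 C C (\<lambda>c a. canon C \<rho> c a - canon C \<tau> c a)
     \<le> eta C \<rho> - cross C \<rho> \<tau>"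
proof -
  let ?n = "card C" and ?l = "eigval C \<rho>" and ?m = "eigval C \<tau>"
  define P where "P = (\<lambda>i j. (cmod (ip C (eigvec C \<rho> i) (eigvec C \<tau> j)))^2)"
  have h: "herm C \<rho>" "herm C \<tau>" using p by (simp_all add: psd_def)
  note e = eigen_dec_eig[OF C h(1)] eigen_dec_eig[OF C h(2)]
  have on: "orthonormal C ?n (eigvec C \<rho>)" "orthonormal C ?n (eigvec C \<tau>)"
    using e by (simp_all add: eigen_dec_def)
  note nn = eigval_nonneg[OF C p(1) e(1)] eigval_nonneg[OF C p(2) e(2)]
  have P1: "(\<Sum>j<?n. P i j) = 1" "(\<Sum>j<?n. P j i) = 1" if "i < ?n" for i
    using sum_overlap[OF C on that] by (simp_all add: P_def)
  have tm: "P i j * (?l i + ?m j - 2 * (sqrt (?l i) * sqrt (?m j))) \<le>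
      P i j * (?l i * ln (?l i) - ?l i * ln (?m j) - ?l i + ?m j)" if ij: "i < ?n" "j < ?n" for i j
  proof (cases "P i j = 0")
    case False
    then have "?m j = 0 \<Longrightarrow> ?l i = 0"
      using dominated_null[OF C p dom ij] by (simp add: P_def)
    then show ?thesis
      using nn ij by (intro mult_left_mono entropy_term_ge) (auto simp: P_def)
  qed simp
  have row: "(\<Sum>i<?n. \<Sum>j<?n. P i j * f i) = (\<Sum>i<?n. f i)" for f
    by (simp add: sum_distrib_right[symmetric] P1)
  have col: "(\<Sum>i<?n. \<Sum>j<?n. P i j * f j) = (\<Sum>j<?n. f j)" for f
    by (subst sum.swap) (simp add: sum_distrib_right[symmetric] P1)
  have "(\<Sum>i<?n. \<Sum>j<?n. P i j * (?l i + ?m j - 2 * (sqrt (?l i) * sqrt (?m j)))) \<le>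
      (\<Sum>i<?n. \<Sum>j<?n. P i j * (?l i * ln (?l i) - ?l i * ln (?m j) - ?l i + ?m j))"
    by (intro sum_mono tm) auto
  moreover have "(\<Sum>i<?n. \<Sum>j<?n. P i j * (?l i + ?m j - 2 * (sqrt (?l i) * sqrt (?m j)))) =
     (\<Sum>i<?n. \<Sum>j<?n. P i j * ?l i) + (\<Sum>i<?n. \<Sum>j<?n. P i j * ?m j) -
      2 * (\<Sum>i<?n. \<Sum>j<?n. sqrt (?l i) * sqrt (?m j) * P i j)"
    by (simp add: sum.distrib sum_subtractf sum_distrib_left algebra_simps)
  moreover have "(\<Sum>i<?n. \<Sum>j<?n. P i j * (?l i * ln (?l i) - ?l i * ln (?m j) - ?l i + ?m j)) =
     (\<Sum>i<?n. \<Sum>j<?n. P i j * (?l i * ln (?l i))) - (\<Sum>i<?n. \<Sum>j<?n. (?l i * P i j) * ln (?m j)) -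
     (\<Sum>i<?n. \<Sum>j<?n. P i j * ?l i) + (\<Sum>i<?n. \<Sum>j<?n. P i j * ?m j)"
    by (simp add: sum.distrib sum_subtractf sum_distrib_left algebra_simps)
  moreover have "(\<Sum>i<?n. \<Sum>j<?n. (?l i * P i j) * ln (?m j)) = cross C \<rho> \<tau>"
    unfolding cross_def qf_eigen_dec[OF C h(1) e(1)] P_def sum_distrib_right by (rule sum.swap)
  ultimately have "(\<Sum>i<?n. ?l i) + (\<Sum>i<?n. ?m i) - 2 * (\<Sum>i<?n. \<Sum>j<?n. sqrt (?l i) * sqrt (?m j) * P i j)
     \<le> eta C \<rho> - cross C \<rho> \<tau> - (\<Sum>i<?n. ?l i) + (\<Sum>i<?n. ?m i)"
    by (simp only: row col eta_def)
  then show ?thesis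
    unfolding nsq2_canon_diff[OF C p] trace_eigen_dec[OF C h(1) e(1)] trace_eigen_dec[OF C h(2) e(2)]
      P_def by simp
qed

text \<open>Stands in for operator monotonicity of the logarithm. The tangent bound
  \<open>ln x \<le> x - 1\<close> is applied to each pair of eigenvectors; it then remains to
  control, for each \<open>i\<close>, the mean of the reciprocal eigenvalues of \<tau> with weights
  \<open>P i j\<close>.\<close>

lemma relative_entropy_le:
  assumes C: "finite C" and p: "psd C \<rho>" "psd C \<tau>" and K: "K > 0"
    and dom: "\<And>x. qf C \<rho> x \<le> K * qf C \<tau> x"
  shows "eta C \<rho> - cross C \<rho> \<tau> \<le> trace_on C \<rho> * ln K"
proof -
  let ?n = "card C" and ?l = "eigval C \<rho>" and ?m = "eigval C \<tau>" and ?v = "eigvec C \<tau>" and ?u = "eigvec C \<rho>"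
  define P where "P = (\<lambda>i j. (cmod (ip C (eigvec C \<rho> i) (eigvec C \<tau> j)))^2)"
  have h: "herm C \<rho>" "herm C \<tau>" using p by (simp_all add: psd_def)
  note e = eigen_dec_eig[OF C h(1)] eigen_dec_eig[OF C h(2)]
  have on: "orthonormal C ?n (eigvec C \<rho>)" "orthonormal C ?n (eigvec C \<tau>)"
    using e by (simp_all add: eigen_dec_def)
  note nn = eigval_nonneg[OF C p(1) e(1)] eigval_nonneg[OF C p(2) e(2)]
  have P1: "(\<Sum>j<?n. P i j) = 1" if "i < ?n" for i
    using sum_overlap[OF C on that] by (simp_all add: P_def)
  have P0: "0 \<le> P i j" for i j by (simp add: P_def)
  have T: "?l i * (\<Sum>j<?n. P i j * inverse (?m j)) \<le> K" if i: "i < ?n" for i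
  proof -
    \<comment> \<open>The pseudo-inverse of \<tau> applied to \<open>?u i\<close>, where
      \<open>inverse 0 = 0\<close> removes the kernel. Both \<open>qf C \<tau> z\<close> and the
      inner product of \<open>?u i\<close> with \<open>z\<close> equal \<open>T\<close>, so testing
      domination on \<open>z\<close> gives \<open>?l i * T^2 \<le> K * T\<close>.\<close>
    define z where "z = (\<lambda>c. \<Sum>j<?n. (of_real (inverse (?m j)) * ip C (?v j) (?u i)) * ?v j c)"
    define T where "T = (\<Sum>j<?n. P i j * inverse (?m j))"
    have Tn: "T \<ge> 0" unfolding T_def using nn P0 by (intro sum_nonneg mult_nonneg_nonneg) auto
    have vz: "ip C (?v j) z = of_real (inverse (?m j)) * ip C (?v j) (?u i)" if j: "j < ?n" for j
    proof -
      have "ip C (?v j) z = (\<Sum>k<?n. of_real (inverse (?m k)) * ip C (?v k) (?u i) * ip C (?v j) (?v k))"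
        unfolding z_def ip_sum_right ip_scale_right ..
      also have "... = (\<Sum>k<?n. if k = j then of_real (inverse (?m k)) * ip C (?v k) (?u i) else 0)"
        using on(2) j by (intro sum.cong refl) (auto simp: orthonormal_def)
      finally show ?thesis using j by simp
    qed
    have sym: "(cmod (ip C (?v j) (?u i)))^2 = P i j" for j
      by (metis P_def complex_mod_cnj ip_cnj)
    have "qf C \<tau> z = (\<Sum>j<?n. ?m j * ((inverse (?m j))^2 * P i j))"
      unfolding qf_eigen_dec[OF C h(2) e(2)]
      by (intro sum.cong refl) (simp add: vz norm_mult power_mult_distrib sym power_inverse del: of_real_inverse)
    also have "... = T" unfolding T_def
      by (intro sum.cong refl) (auto simp: power2_eq_square field_simps)
    finally have qT: "qf C \<tau> z = T" .
    have "ip C (?u i) z = of_real T"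
    proof -
      have "ip C (?u i) z = (\<Sum>j<?n. of_real (inverse (?m j)) * (ip C (?v j) (?u i) * ip C (?u i) (?v j)))"
        unfolding z_def ip_sum_right ip_scale_right by (simp add: mult_ac)
      also have "... = (\<Sum>j<?n. of_real (inverse (?m j)) * of_real (P i j))"
        unfolding P_def cmod_sq_eq ip_cnj by simp
      finally show ?thesis by (simp add: T_def mult_ac)
    qed
    then have "?l i * T^2 = ?l i * (cmod (ip C (?u i) z))^2" by simp
    also have "... \<le> qf C \<rho> z"
      unfolding qf_eigen_dec[OF C h(1) e(1)] by (rule member_le_sum) (use i nn in auto)
    also have "... \<le> K * T" using dom[of z] by (simp add: qT)
    finally have "T * (?l i * T) \<le> T * K" by (simp add: power2_eq_square mult_ac)
    then have "?l i * T \<le> K" using Tn K by (cases "T = 0") auto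
    then show ?thesis by (simp add: T_def)
  qed
  have ent: "?l i * (\<Sum>j<?n. P i j * (ln (?l i) - ln (?m j))) \<le> ?l i * ln K" if i: "i < ?n" for i
  proof (cases "?l i = 0")
    case False
    then have lp: "?l i > 0" using nn(1)[OF i] by simp
    have tm: "P i j * (ln (?l i) - ln (?m j)) \<le> P i j * (ln K - 1 + ?l i * inverse (?m j) / K)" if j: "j < ?n" for j
    proof (cases "P i j = 0")
      case False
      then have "?m j \<noteq> 0" using dominated_null[OF C p dom i j] lp by (auto simp: P_def)
      then have mp: "?m j > 0" using nn(2)[OF j] by simp
      have "ln (?l i / (K * ?m j)) \<le> ?l i / (K * ?m j) - 1" using lp mp K by (intro ln_le_minus_one) simp
      then have "ln (?l i) - ln (?m j) \<le> ln K - 1 + ?l i * inverse (?m j) / K"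
        using lp mp K by (simp add: ln_div ln_mult field_simps)
      then show ?thesis using P0 by (intro mult_left_mono) auto
    qed simp
    have "(\<Sum>j<?n. P i j * (ln (?l i) - ln (?m j))) \<le> (\<Sum>j<?n. P i j * (ln K - 1 + ?l i * inverse (?m j) / K))"
      by (intro sum_mono tm) auto
    also have "... = (\<Sum>j<?n. P i j) * (ln K - 1) + ?l i * (\<Sum>j<?n. P i j * inverse (?m j)) / K"
      by (simp add: distrib_left sum.distrib sum_distrib_left sum_distrib_right sum_divide_distrib mult_ac)
    also have "... \<le> ln K" using T[OF i] K by (simp add: P1[OF i])
    finally show ?thesis using lp by (intro mult_left_mono) auto
  qed simp
  have "eta C \<rho> - cross C \<rho> \<tau> = (\<Sum>i<?n. ?l i * ln (?l i) * (\<Sum>j<?n. P i j)) - (\<Sum>i<?n. \<Sum>j<?n. (?l i * P i j) * ln (?m j))"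
  proof -
    have "(\<Sum>i<?n. \<Sum>j<?n. (?l i * P i j) * ln (?m j)) = cross C \<rho> \<tau>"
      unfolding cross_def qf_eigen_dec[OF C h(1) e(1)] P_def sum_distrib_right by (rule sum.swap)
    then show ?thesis by (simp add: eta_def P1)
  qed
  also have "... = (\<Sum>i<?n. ?l i * (\<Sum>j<?n. P i j * (ln (?l i) - ln (?m j))))"
    by (simp add: sum_subtractf sum_distrib_left sum_distrib_right algebra_simps)
  also have "... \<le> (\<Sum>i<?n. ?l i * ln K)" by (intro sum_mono ent) auto
  also have "... = trace_on C \<rho> * ln K"
    by (simp add: trace_eigen_dec[OF C h(1) e(1)] sum_distrib_right)
  finally show ?thesis .
qed

section \<open>Reduced states and local isometries\<close>

definition red :: "'b set \<Rightarrow> ('a \<Rightarrow> 'b \<Rightarrow> complex) \<Rightarrow> 'a \<Rightarrow> 'a \<Rightarrow> complex" where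
  "red B \<psi> c c' = (\<Sum>b\<in>B. \<psi> c b * cnj (\<psi> c' b))"

lemma herm_red: "herm C (red B \<psi>)"
  by (simp add: herm_def red_def mult.commute)

lemma ip_mat_app_red:
  "ip C x (mat_app C (red B \<psi>) y) =
     (\<Sum>b\<in>B. ip C x (\<lambda>c. \<psi> c b) * cnj (ip C y (\<lambda>c. \<psi> c b)))"
proof -
  have "ip C x (mat_app C (red B \<psi>) y) = (\<Sum>c\<in>C. \<Sum>c'\<in>C. \<Sum>b\<in>B. cnj (x c) * \<psi> c b * (cnj (\<psi> c' b) * y c'))"
    by (simp add: ip_def mat_app_def red_def sum_distrib_left sum_distrib_right mult_ac)
  also have "... = (\<Sum>c\<in>C. \<Sum>b\<in>B. \<Sum>c'\<in>C. cnj (x c) * \<psi> c b * (cnj (\<psi> c' b) * y c'))"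
    by (intro sum.cong refl sum.swap)
  also have "... = (\<Sum>b\<in>B. \<Sum>c\<in>C. \<Sum>c'\<in>C. cnj (x c) * \<psi> c b * (cnj (\<psi> c' b) * y c'))"
    by (rule sum.swap)
  also have "... = (\<Sum>b\<in>B. (\<Sum>c\<in>C. cnj (x c) * \<psi> c b) * (\<Sum>c'\<in>C. cnj (\<psi> c' b) * y c'))"
    by (simp only: sum_product)
  also have "... = (\<Sum>b\<in>B. ip C x (\<lambda>c. \<psi> c b) * cnj (ip C y (\<lambda>c. \<psi> c b)))"
    by (simp add: ip_def mult.commute)
  finally show ?thesis .
qed

lemma qf_red: "qf C (red B \<psi>) x = (\<Sum>b\<in>B. (cmod (ip C x (\<lambda>c. \<psi> c b)))^2)"
proof -
  have "ip C x (mat_app C (red B \<psi>) x) = of_real (\<Sum>b\<in>B. (cmod (ip C x (\<lambda>c. \<psi> c b)))^2)"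
    unfolding ip_mat_app_red of_real_sum cmod_sq_eq by (simp add: mult.commute)
  then show ?thesis by (simp add: qf_def)
qed

lemma psd_red: "psd C (red B \<psi>)"
  by (simp add: psd_def herm_red qf_red sum_nonneg)

lemma trace_red: "trace_on C (red B \<psi>) = nsq2 C B \<psi>"
proof -
  have "red B \<psi> c c = of_real (\<Sum>b\<in>B. (cmod (\<psi> c b))^2)" for c
    unfolding red_def of_real_sum cmod_sq_eq by (simp add: mult.commute)
  then show ?thesis by (simp add: trace_on_def nsq2_def)
qed

definition isom :: "'b set \<Rightarrow> 'a set \<Rightarrow> ('b \<Rightarrow> 'a \<Rightarrow> complex) \<Rightarrow> bool" where
  "isom D C V \<longleftrightarrow> (\<forall>a\<in>C. \<forall>a'\<in>C. (\<Sum>d\<in>D. V d a * cnj (V d a')) = of_bool (a = a'))"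

lemma isom_ip:
  assumes C: "finite C" and V: "isom D C V"
  shows "ip D (\<lambda>d. \<Sum>a\<in>C. V d a * x a) (\<lambda>d. \<Sum>a\<in>C. V d a * y a) = ip C x y"
proof -
  have "ip D (\<lambda>d. \<Sum>a\<in>C. V d a * x a) (\<lambda>d. \<Sum>a\<in>C. V d a * y a)
      = (\<Sum>d\<in>D. \<Sum>a'\<in>C. \<Sum>a\<in>C. (V d a * cnj (V d a')) * (cnj (x a') * y a))"
    unfolding ip_def cnj_sum sum_product by (simp add: mult_ac)
  also have "... = (\<Sum>a'\<in>C. \<Sum>a\<in>C. (\<Sum>d\<in>D. V d a * cnj (V d a')) * (cnj (x a') * y a))"
    by (subst sum.swap, rule sum.cong[OF refl], subst sum.swap) (simp add: sum_distrib_right)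
  also have "... = (\<Sum>a'\<in>C. \<Sum>a\<in>C. if a = a' then cnj (x a') * y a else 0)"
    using V by (intro sum.cong refl) (auto simp: isom_def)
  also have "... = ip C x y" using C by (simp add: ip_def)
  finally show ?thesis .
qed

lemma isom_nsq:
  assumes C: "finite C" and V: "isom D C V"
  shows "nsq D (\<lambda>d. \<Sum>a\<in>C. V d a * x a) = nsq C x"
proof -
  have "complex_of_real (nsq D (\<lambda>d. \<Sum>a\<in>C. V d a * x a)) = of_real (nsq C x)"
    unfolding ip_self[symmetric] by (rule isom_ip[OF C V])
  then show ?thesis by (simp only: of_real_eq_iff)
qed

text \<open>The vectors \<open>\<iota> c\<close> only complete the partial isometry of the polar decomposition to an isometry.\<close>

lemma polar:
  assumes C: "finite C" and D: "finite D" and inj: "inj_on \<iota> C" and dis: "\<iota> ` C \<inter> D = {}"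
    and \<rho>: "\<And>c c'. c \<in> C \<Longrightarrow> c' \<in> C \<Longrightarrow> \<rho> c c' = red D X c c'"
  shows "\<exists>V. isom (D \<union> \<iota> ` C) C V \<and>
     (\<forall>c\<in>C. \<forall>d\<in>D. (\<Sum>a\<in>C. V d a * canon C \<rho> c a) = X c d) \<and>
     (\<forall>c\<in>C. \<forall>d\<in>\<iota> ` C. (\<Sum>a\<in>C. V d a * canon C \<rho> c a) = 0)"
proof -
  let ?n = "card C"
  define v where "v = eigvec C \<rho>"
  define \<mu> where "\<mu> = eigval C \<rho>"
  have m: "mat_app C \<rho> y c = mat_app C (red D X) y c" if "c \<in> C" for y c
    using \<rho> that by (simp add: mat_app_def)
  have h: "herm C \<rho>"
    unfolding herm_def
  proof (intro ballI)
    fix c c' assume "c \<in> C" "c' \<in> C"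
    then show "\<rho> c c' = cnj (\<rho> c' c)" using \<rho>[of c c'] \<rho>[of c' c] by (simp add: red_def mult.commute)
  qed
  have qe: "qf C \<rho> y = qf C (red D X) y" for y
    unfolding qf_def using m by (intro arg_cong[where f=Re] ip_cong) auto
  have p: "psd C \<rho>" using h psd_red[of C D X] by (simp add: psd_def qe)
  have e: "eigen_dec C \<rho> v \<mu>" unfolding v_def \<mu>_def by (rule eigen_dec_eig[OF C h])
  have on: "orthonormal C ?n v" using e by (simp add: eigen_dec_def)
  have vv: "ip C (v i) (v j) = of_bool (i = j)" if "i < ?n" "j < ?n" for i j
    using on that by (simp add: orthonormal_def)
  define g where "g = (\<lambda>j d. ip C (v j) (\<lambda>c. X c d))"
  define J where "J = {j. j < ?n \<and> \<mu> j > 0}"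
  have finJ: "finite J" and Jn: "\<And>j. j \<in> J \<Longrightarrow> j < ?n" by (auto simp: J_def)
  have nn: "\<mu> j \<ge> 0" if "j < ?n" for j using eigval_nonneg[OF C p e that] .
  have gg: "(\<Sum>d\<in>D. g j d * cnj (g k d)) = of_real (\<mu> k) * of_bool (j = k)" if "j < ?n" "k < ?n" for j k
  proof -
    have "(\<Sum>d\<in>D. g j d * cnj (g k d)) = ip C (v j) (mat_app C (red D X) (v k))"
      by (simp add: ip_mat_app_red g_def)
    also have "... = ip C (v j) (mat_app C \<rho> (v k))" using m by (intro ip_cong) auto
    also have "... = of_real (\<mu> j) * ip C (v j) (v k)" by (rule ip_eigvec_mat_app[OF h e that(1)])
    finally show ?thesis using vv[OF that] by simp
  qed
  have g0: "g j d = 0" if j: "j < ?n" "j \<notin> J" and d: "d \<in> D" for j d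
  proof -
    have "\<mu> j = 0" using nn[OF j(1)] j by (auto simp: J_def)
    then have "complex_of_real (nsq D (g j)) = 0"
      using gg[OF j(1) j(1)] unfolding ip_self[symmetric] ip_def by (simp add: mult.commute)
    then show ?thesis using nsq_eq_0[OF D] d by simp
  qed
  have Xg: "X c d = (\<Sum>j\<in>J. g j d * v j c)" if "c \<in> C" "d \<in> D" for c d
  proof -
    have "X c d = (\<Sum>j<?n. g j d * v j c)"
      unfolding g_def by (rule orthonormal_expand[OF C on that(1)])
    also have "... = (\<Sum>j\<in>J. g j d * v j c)"
      using g0 that by (intro sum.mono_neutral_right) (auto simp: J_def)
    finally show ?thesis .
  qed
  \<comment> \<open>On the support of \<rho> the vectors \<open>f j\<close> are orthonormal. They
    are the images under \<open>V\<close> of the conjugated eigenvectors, which are the second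
    tensor factors in \<open>canon\<close>.\<close>
  define f where "f = (\<lambda>j d. g j d / of_real (sqrt (\<mu> j)))"
  have ff: "(\<Sum>d\<in>D. f j d * cnj (f k d)) = of_bool (j = k)" if "j \<in> J" "k \<in> J" for j k
  proof -
    have "(\<Sum>d\<in>D. f j d * cnj (f k d)) = (\<Sum>d\<in>D. g j d * cnj (g k d)) / (of_real (sqrt (\<mu> j)) * of_real (sqrt (\<mu> k)))"
      by (simp add: f_def sum_divide_distrib)
    also have "... = of_bool (j = k)"
      using gg[OF Jn[OF that(1)] Jn[OF that(2)]] that
      by (auto simp: J_def of_real_mult[symmetric] simp del: of_real_mult)
    finally show ?thesis .
  qed
  have vcanon: "(\<Sum>a\<in>C. v j a * canon C \<rho> c a) = of_real (sqrt (\<mu> j)) * v j c" if j: "j < ?n" for j c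
  proof -
    have "(\<Sum>a\<in>C. v j a * canon C \<rho> c a) = (\<Sum>a\<in>C. \<Sum>i<?n. of_real (sqrt (\<mu> i)) * v i c * (cnj (v i a) * v j a))"
      by (simp add: canon_def v_def \<mu>_def sum_distrib_left mult_ac)
    also have "... = (\<Sum>i<?n. of_real (sqrt (\<mu> i)) * v i c * ip C (v i) (v j))"
      by (subst sum.swap) (simp add: ip_def sum_distrib_left)
    also have "... = (\<Sum>i<?n. if i = j then of_real (sqrt (\<mu> i)) * v i c else 0)"
      by (intro sum.cong refl) (use vv j in auto)
    finally show ?thesis using j by simp
  qed
  \<comment> \<open>The projection onto the support of \<rho>. The rows of \<open>V\<close> in
    \<open>D\<close> contribute \<open>Q\<close> to the Gram matrix of its columns, the junk rows
    the missing \<open>1 - Q\<close>.\<close>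
  define Q where "Q = (\<lambda>a a'. \<Sum>j\<in>J. v j a * cnj (v j a'))"
  define V where "V = (\<lambda>d a. if d \<in> D then \<Sum>j\<in>J. f j d * v j a else of_bool (d = \<iota> a) - Q a (inv_into C \<iota> d))"
  have VD: "V d a = (\<Sum>j\<in>J. f j d * v j a)" if "d \<in> D" for d a using that by (simp add: V_def)
  have VJ: "V (\<iota> c) a = of_bool (c = a) - Q a c" if "c \<in> C" "a \<in> C" for c a
    using that dis inj by (auto simp: V_def inj_on_eq_iff)
  have "(\<Sum>a\<in>C. V d a * canon C \<rho> c a) = X c d" if c: "c \<in> C" and d: "d \<in> D" for c d
  proof -
    have "(\<Sum>a\<in>C. V d a * canon C \<rho> c a) = (\<Sum>j\<in>J. f j d * (\<Sum>a\<in>C. v j a * canon C \<rho> c a))"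
      by (simp add: VD[OF d] sum_distrib_left sum_distrib_right mult_ac) (rule sum.swap)
    also have "... = X c d"
      unfolding Xg[OF c d]
      by (intro sum.cong refl) (auto simp: vcanon Jn f_def, auto simp: J_def)
    finally show ?thesis .
  qed
  moreover have "(\<Sum>a\<in>C. V d a * canon C \<rho> c a) = 0" if c: "c \<in> C" and d: "d \<in> \<iota> ` C" for c d
  proof -
    obtain a' where a': "a' \<in> C" "d = \<iota> a'" using d by blast
    have "(\<Sum>a\<in>C. V d a * canon C \<rho> c a) =
       (\<Sum>a\<in>C. (if a = a' then canon C \<rho> c a else 0) - Q a a' * canon C \<rho> c a)"
      by (intro sum.cong refl) (auto simp: a' VJ algebra_simps)
    also have "... = canon C \<rho> c a' - (\<Sum>a\<in>C. Q a a' * canon C \<rho> c a)"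
      using C a' by (simp add: sum_subtractf)
    also have "(\<Sum>a\<in>C. Q a a' * canon C \<rho> c a) = (\<Sum>j\<in>J. cnj (v j a') * (\<Sum>a\<in>C. v j a * canon C \<rho> c a))"
      by (simp add: Q_def sum_distrib_left sum_distrib_right mult_ac) (rule sum.swap)
    also have "... = (\<Sum>j\<in>J. of_real (sqrt (\<mu> j)) * (v j c * cnj (v j a')))"
      by (intro sum.cong refl) (simp add: vcanon Jn mult_ac)
    also have "... = canon C \<rho> c a'"
      unfolding canon_def v_def[symmetric] \<mu>_def[symmetric]
      using nn by (intro sum.mono_neutral_left) (auto simp: J_def not_less intro: antisym)
    finally show ?thesis by simp
  qed
  moreover have "isom (D \<union> \<iota> ` C) C V"
    unfolding isom_def
  proof (intro ballI)
    fix a a' assume a: "a \<in> C" "a' \<in> C"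
    have "(\<Sum>d\<in>D. V d a * cnj (V d a')) = (\<Sum>d\<in>D. \<Sum>j\<in>J. \<Sum>k\<in>J. (f j d * cnj (f k d)) * (v j a * cnj (v k a')))"
      by (intro sum.cong refl) (simp add: VD sum_product mult_ac)
    also have "... = (\<Sum>j\<in>J. \<Sum>k\<in>J. (\<Sum>d\<in>D. f j d * cnj (f k d)) * (v j a * cnj (v k a')))"
      by (subst sum.swap, rule sum.cong[OF refl], subst sum.swap) (simp add: sum_distrib_right)
    also have "... = (\<Sum>j\<in>J. \<Sum>k\<in>J. if k = j then v j a * cnj (v k a') else 0)"
      by (intro sum.cong refl) (auto simp: ff)
    also have "... = Q a a'" using finJ by (simp add: Q_def)
    finally have 1: "(\<Sum>d\<in>D. V d a * cnj (V d a')) = Q a a'" .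
    have PP: "(\<Sum>c\<in>C. Q a c * cnj (Q a' c)) = Q a a'"
    proof -
      have "(\<Sum>c\<in>C. Q a c * cnj (Q a' c)) =
          (\<Sum>c\<in>C. \<Sum>j\<in>J. \<Sum>k\<in>J. (cnj (v j c) * v k c) * (v j a * cnj (v k a')))"
        unfolding Q_def cnj_sum sum_product by (simp add: mult_ac)
      also have "... = (\<Sum>j\<in>J. \<Sum>k\<in>J. ip C (v j) (v k) * (v j a * cnj (v k a')))"
        by (subst sum.swap, rule sum.cong[OF refl], subst sum.swap) (simp add: sum_distrib_right ip_def)
      also have "... = (\<Sum>j\<in>J. \<Sum>k\<in>J. if k = j then v j a * cnj (v k a') else 0)"
        by (intro sum.cong refl) (auto simp: vv Jn)
      also have "... = Q a a'" using finJ by (simp add: Q_def)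
      finally show ?thesis .
    qed
    have sym: "cnj (Q a' a) = Q a a'" by (simp add: Q_def mult.commute)
    have "(\<Sum>d\<in>\<iota> ` C. V d a * cnj (V d a')) = (\<Sum>c\<in>C. V (\<iota> c) a * cnj (V (\<iota> c) a'))"
      by (simp add: sum.reindex[OF inj] o_def)
    also have "... = (\<Sum>c\<in>C. (if c = a then of_bool (a = a') - cnj (Q a' a) else 0) -
         (if c = a' then Q a a' else 0) + Q a c * cnj (Q a' c))"
      using a by (intro sum.cong refl) (auto simp: VJ algebra_simps)
    also have "... = of_bool (a = a') - Q a a'"
      using C a by (simp add: sum.distrib sum_subtractf PP sym)
    finally have 2: "(\<Sum>d\<in>\<iota> ` C. V d a * cnj (V d a')) = of_bool (a = a') - Q a a'" .
    show "(\<Sum>d\<in>D \<union> \<iota> ` C. V d a * cnj (V d a')) = of_bool (a = a')"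
      using C D dis by (subst sum.union_disjoint) (auto simp: 1 2)
  qed
  ultimately show ?thesis by blast
qed

section \<open>An abstract protocol model\<close>

text \<open>
  Memory contents are basis labels: \<open>Recv m b\<close> is memory \<open>b\<close> after message \<open>m\<close> has arrived,
  \<open>Ctrl s a\<close> is memory \<open>a\<close> together with a register holding a string \<open>s\<close> (in superposition),
  and \<open>Junk\<close> labels the dimensions that are added by \<open>polar\<close>.
\<close>

datatype 'm mem = Cell 'm | Recv 'm "'m mem" | Ctrl "bool list" "'m mem" | Junk "'m mem"

type_synonym 'm gate = "bool list \<Rightarrow> 'm mem \<times> 'm \<Rightarrow> 'm mem \<Rightarrow> complex"

datatype 'm prot = Done "'m mem set" | Step "'m set" "'m mem set" "'m gate" "'m prot"

text \<open>
  In a state \<open>\<psi> a b\<close> and in the pair \<open>u\<close>, \<open>v\<close> of inputs the first component always belongs to the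
  player about to move, so every step exchanges the components. A gate maps the mover's memory
  isometrically to new memory and message. A protocol with \<open>t\<close> messages has \<open>t + 1\<close> steps, the last
  one being the output gate, whose message is irrelevant.
\<close>

definition recv :: "'m set \<Rightarrow> 'm mem set \<Rightarrow> 'm mem set" where
  "recv M B = (\<lambda>(m, b). Recv m b) ` (M \<times> B)"

definition step_state :: "'m mem set \<Rightarrow> ('m mem \<times> 'm \<Rightarrow> 'm mem \<Rightarrow> complex) \<Rightarrow>
    ('m mem \<Rightarrow> 'm mem \<Rightarrow> complex) \<Rightarrow> 'm mem \<Rightarrow> 'm mem \<Rightarrow> complex" where
  "step_state A G \<psi> = (\<lambda>c a'. case c of Recv m b \<Rightarrow> \<Sum>a\<in>A. G (a', m) a * \<psi> a b | _ \<Rightarrow> 0)"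

primrec acc :: "'m prot \<Rightarrow> 'm mem set \<Rightarrow> 'm mem set \<Rightarrow> bool list \<Rightarrow> bool list \<Rightarrow>
    ('m mem \<Rightarrow> 'm mem \<Rightarrow> complex) \<Rightarrow> real" where
  "acc (Done Q) A B u v \<psi> = (\<Sum>a\<in>A. \<Sum>b\<in>B. of_bool (b \<in> Q) * (cmod (\<psi> a b))^2)"
| "acc (Step M A' G p) A B u v \<psi> = acc p (recv M B) A' v u (step_state A (G u) \<psi>)"

primrec wf_prot :: "nat \<Rightarrow> 'm prot \<Rightarrow> 'm mem set \<Rightarrow> 'm mem set \<Rightarrow> bool" where
  "wf_prot n (Done Q) A B \<longleftrightarrow> True"
| "wf_prot n (Step M A' G p) A B \<longleftrightarrow> finite M \<and> M \<noteq> {} \<and> finite A' \<and>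
     (\<forall>u\<in>inputs n. isom (A' \<times> M) A (G u)) \<and> wf_prot n p (recv M B) A'"

primrec msgs :: "'m prot \<Rightarrow> nat list" where
  "msgs (Done Q) = []"
| "msgs (Step M A' G p) = card M # msgs p"

lemma finite_recv [simp]: "finite M \<Longrightarrow> finite B \<Longrightarrow> finite (recv M B)"
  by (simp add: recv_def)

lemma sum_recv: "(\<Sum>c\<in>recv M B. f c) = (\<Sum>m\<in>M. \<Sum>b\<in>B. f (Recv m b))"
  unfolding recv_def
  by (subst sum.reindex) (auto simp: inj_on_def sum.cartesian_product case_prod_unfold)

lemma ball_recv: "(\<forall>c\<in>recv M B. P c) \<longleftrightarrow> (\<forall>m\<in>M. \<forall>b\<in>B. P (Recv m b))"
  by (auto simp: recv_def)

lemma step_state_Recv: "step_state A G \<psi> (Recv m b) a' = (\<Sum>a\<in>A. G (a', m) a * \<psi> a b)"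
  by (simp add: step_state_def)

lemma isom_comp:
  assumes D: "finite D" and V: "isom D C V" and W: "isom E D W"
  shows "isom E C (\<lambda>e a. \<Sum>d\<in>D. W e d * V d a)"
  unfolding isom_def
proof (intro ballI)
  fix a a' assume a: "a \<in> C" "a' \<in> C"
  have "(\<Sum>e\<in>E. (\<Sum>d\<in>D. W e d * V d a) * cnj (\<Sum>d\<in>D. W e d * V d a')) = ip D (\<lambda>d. V d a') (\<lambda>d. V d a)"
    unfolding isom_ip[OF D W, symmetric] by (simp add: ip_def mult.commute)
  also have "... = of_bool (a = a')"
    using V a by (simp add: isom_def ip_def mult.commute)
  finally show "(\<Sum>e\<in>E. (\<Sum>d\<in>D. W e d * V d a) * cnj (\<Sum>d\<in>D. W e d * V d a')) = of_bool (a = a')" .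
qed

lemma nsq2_swap: "nsq2 A B \<psi> = (\<Sum>b\<in>B. nsq A (\<lambda>a. \<psi> a b))"
  unfolding nsq2_def nsq_def by (rule sum.swap)

lemma nsq2_nonneg [simp]: "0 \<le> nsq2 A B \<psi>"
  by (simp add: nsq2_def sum_nonneg)

lemma nsq2_step_state:
  assumes A: "finite A" and G: "isom (A' \<times> M) A G"
  shows "nsq2 (recv M B) A' (step_state A G \<psi>) = nsq2 A B \<psi>"
proof -
  have "nsq2 (recv M B) A' (step_state A G \<psi>) =
      (\<Sum>m\<in>M. \<Sum>b\<in>B. \<Sum>a'\<in>A'. (cmod (\<Sum>a\<in>A. G (a', m) a * \<psi> a b))^2)"
    by (simp add: nsq2_def sum_recv step_state_Recv)
  also have "... = (\<Sum>b\<in>B. \<Sum>m\<in>M. \<Sum>a'\<in>A'. (cmod (\<Sum>a\<in>A. G (a', m) a * \<psi> a b))^2)"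
    by (rule sum.swap)
  also have "... = (\<Sum>b\<in>B. nsq (A' \<times> M) (\<lambda>x. \<Sum>a\<in>A. G x a * \<psi> a b))"
    unfolding nsq_def
    by (intro sum.cong refl, subst sum.swap) (simp add: sum.cartesian_product case_prod_unfold)
  also have "... = nsq2 A B \<psi>"
    by (simp add: isom_nsq[OF A G] nsq2_swap)
  finally show ?thesis .
qed

lemma step_state_diff:
  "step_state A G (\<lambda>a b. \<psi> a b - \<phi> a b) = (\<lambda>c a'. step_state A G \<psi> c a' - step_state A G \<phi> c a')"
  by (auto simp: step_state_def fun_eq_iff algebra_simps sum_subtractf split: mem.split)

lemma acc_cong:
  assumes "\<And>a b. a \<in> A \<Longrightarrow> b \<in> B \<Longrightarrow> \<psi> a b = \<phi> a b"
  shows "acc p A B u v \<psi> = acc p A B u v \<phi>"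
  using assms
proof (induction p arbitrary: A B u v \<psi> \<phi>)
  case (Done Q)
  then show ?case by simp
next
  case (Step M A' G p)
  show ?case unfolding acc.simps
    by (rule Step.IH) (auto simp: recv_def step_state_Recv Step.prems)
qed

lemma acc_nonneg: "0 \<le> acc p A B u v \<psi>"
  by (induction p arbitrary: A B u v \<psi>) (auto intro!: sum_nonneg)

lemma acc_le_nsq2:
  assumes "wf_prot n p A B" "finite A" "finite B" "u \<in> inputs n" "v \<in> inputs n"
  shows "acc p A B u v \<psi> \<le> nsq2 A B \<psi>"
  using assms
proof (induction p arbitrary: A B u v \<psi>)
  case (Done Q)
  show ?case unfolding acc.simps nsq2_def by (intro sum_mono) (auto simp: of_bool_def)
next
  case (Step M A' G p)
  then show ?case using nsq2_step_state[of A A' M "G u" B \<psi>] by (metis acc.simps(2) finite_recv wf_prot.simps(2))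
qed

lemma nsq2_L2: "sqrt (nsq2 A B \<psi>) = L2_set (\<lambda>x. cmod (\<psi> (fst x) (snd x))) (A \<times> B)"
  by (simp add: nsq2_def L2_set_def sum.cartesian_product case_prod_unfold)

text \<open>All steps are linear and preserve the norm, so only the final measurement matters; there
  the difference of squares is factored and Cauchy-Schwarz is applied.\<close>

lemma acc_lipschitz:
  assumes "wf_prot n p A B" "finite A" "finite B" "u \<in> inputs n" "v \<in> inputs n"
  shows "\<bar>acc p A B u v \<psi> - acc p A B u v \<phi>\<bar> \<le>
     sqrt (nsq2 A B (\<lambda>a b. \<psi> a b - \<phi> a b)) * (sqrt (nsq2 A B \<psi>) + sqrt (nsq2 A B \<phi>))"
  using assms
proof (induction p arbitrary: A B u v \<psi> \<phi>)
  case (Done Q)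
  let ?d = "\<lambda>x. cmod (\<psi> (fst x) (snd x) - \<phi> (fst x) (snd x))"
  let ?f = "\<lambda>x. cmod (\<psi> (fst x) (snd x))" and ?g = "\<lambda>x. cmod (\<phi> (fst x) (snd x))"
  have "\<bar>acc (Done Q) A B u v \<psi> - acc (Done Q) A B u v \<phi>\<bar> =
      \<bar>\<Sum>x\<in>A\<times>B. of_bool (snd x \<in> Q) * ((?f x)^2 - (?g x)^2)\<bar>"
    by (simp add: sum.cartesian_product case_prod_unfold sum_subtractf algebra_simps)
  also have "... \<le> (\<Sum>x\<in>A\<times>B. \<bar>of_bool (snd x \<in> Q) * ((?f x)^2 - (?g x)^2)\<bar>)"
    by (rule sum_abs)
  also have "... \<le> (\<Sum>x\<in>A\<times>B. \<bar>?d x\<bar> * \<bar>?f x + ?g x\<bar>)"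
  proof (rule sum_mono)
    fix x
    have "\<bar>(?f x)^2 - (?g x)^2\<bar> = \<bar>?f x - ?g x\<bar> * \<bar>?f x + ?g x\<bar>"
      by (simp only: power2_eq_square square_diff_square_factored abs_mult mult.commute)
    also have "... \<le> \<bar>?d x\<bar> * \<bar>?f x + ?g x\<bar>"
      using norm_triangle_ineq3[of "\<psi> (fst x) (snd x)" "\<phi> (fst x) (snd x)"] by (intro mult_right_mono) auto
    finally show "\<bar>of_bool (snd x \<in> Q) * ((?f x)^2 - (?g x)^2)\<bar> \<le> \<bar>?d x\<bar> * \<bar>?f x + ?g x\<bar>"
      by (auto simp: of_bool_def)
  qed
  also have "... \<le> L2_set ?d (A\<times>B) * L2_set (\<lambda>x. ?f x + ?g x) (A\<times>B)"
    by (rule L2_set_mult_ineq)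
  also have "... \<le> L2_set ?d (A\<times>B) * (L2_set ?f (A\<times>B) + L2_set ?g (A\<times>B))"
    by (intro mult_left_mono L2_set_triangle_ineq L2_set_nonneg)
  finally show ?case by (simp only: nsq2_L2)
next
  case (Step M A' G p)
  then have w: "wf_prot n p (recv M B) A'" "finite (recv M B)" "finite A'" "isom (A' \<times> M) A (G u)" by auto
  show ?case
    using Step.IH[OF w(1,2,3) Step.prems(5,4), of "step_state A (G u) \<psi>" "step_state A (G u) \<phi>"]
    unfolding acc.simps step_state_diff[symmetric] nsq2_step_state[OF Step.prems(2) w(4)] .
qed

text \<open>
  \<open>merge\<close> absorbs a local isometry \<open>V\<close> of the player who moves second into that player's first gate.
  Without such a gate the isometry does not influence the outcome.
\<close>

definition rlift :: "('m mem \<Rightarrow> 'm mem \<Rightarrow> complex) \<Rightarrow> 'm mem \<Rightarrow> 'm mem \<Rightarrow> complex" where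
  "rlift V y' y = (case y' of Recv m b \<Rightarrow> (case y of Recv m' a \<Rightarrow> of_bool (m = m') * V b a | _ \<Rightarrow> 0) | _ \<Rightarrow> 0)"

lemma rlift_Recv [simp]: "rlift V (Recv m b) (Recv m' a) = of_bool (m = m') * V b a"
  by (simp add: rlift_def)

lemma isom_rlift:
  assumes M: "finite M" and V: "isom D C V" shows "isom (recv M D) (recv M C) (rlift V)"
  unfolding isom_def ball_recv
proof (intro ballI)
  fix m a m' a' assume m: "m \<in> M" "m' \<in> M" and a: "a \<in> C" "a' \<in> C"
  have "(\<Sum>d\<in>recv M D. rlift V d (Recv m a) * cnj (rlift V d (Recv m' a'))) =
     (\<Sum>k\<in>M. if k = m then of_bool (m = m') * (\<Sum>b\<in>D. V b a * cnj (V b a')) else 0)"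
    unfolding sum_recv by (intro sum.cong refl) (auto simp: of_bool_def)
  also have "... = of_bool (Recv m a = Recv m' a')"
    using M m V a by (simp add: isom_def)
  finally show "(\<Sum>d\<in>recv M D. rlift V d (Recv m a) * cnj (rlift V d (Recv m' a'))) = of_bool (Recv m a = Recv m' a')" .
qed

fun merge :: "'m mem set \<Rightarrow> (bool list \<Rightarrow> 'm mem \<Rightarrow> 'm mem \<Rightarrow> complex) \<Rightarrow> 'm prot \<Rightarrow> 'm prot" where
  "merge D V (Step M A' G (Step M2 A2 G2 p)) =
     Step M A' G (Step M2 A2 (\<lambda>u x y. \<Sum>y'\<in>recv M D. G2 u x y' * rlift (V u) y' y) p)"
| "merge D V p = p"

lemma msgs_merge [simp]: "msgs (merge D V p) = msgs p"
  by (cases "(D, V, p)" rule: merge.cases) auto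

lemma wf_prot_merge:
  assumes "wf_prot n p A D" "finite D" and V: "\<And>u. u \<in> inputs n \<Longrightarrow> isom D C (V u)"
  shows "wf_prot n (merge D V p) A C"
  using assms(1,2)
proof (cases "(D, V, p)" rule: merge.cases)
  case (1 D V M A' G M2 A2 G2 p)
  then show ?thesis using assms by (auto intro!: isom_comp isom_rlift)
qed auto

lemma acc_merge:
  assumes w: "wf_prot n p A D" and fin: "finite A" "finite C" "finite D" and V: "isom D C (V u)" and p: "msgs p \<noteq> []"
  shows "acc (merge D V p) A C v u \<phi> = acc p A D v u (\<lambda>a d. \<Sum>c\<in>C. V u d c * \<phi> a c)"
proof (cases "(D, V, p)" rule: merge.cases)
  case (1 D' V' M A' G M2 A2 G2 p2)
  then have eq: "D' = D" "V' = V" and p: "p = Step M A' G (Step M2 A2 G2 p2)" by auto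
  let ?D = "step_state A (G v) (\<lambda>a d. \<Sum>c\<in>C. V u d c * \<phi> a c)" and ?C = "step_state A (G v) \<phi>"
  have M: "finite M" using w p by simp
  have D: "?D y' a' = (\<Sum>y\<in>recv M C. rlift (V u) y' y * ?C y a')" if y'D: "y' \<in> recv M D" for y' a'
  proof -
    obtain m d where y': "y' = Recv m d" "m \<in> M" "d \<in> D" using y'D by (auto simp: recv_def)
    have "(\<Sum>y\<in>recv M C. rlift (V u) y' y * ?C y a') =
       (\<Sum>k\<in>M. if k = m then \<Sum>c\<in>C. V u d c * (\<Sum>a\<in>A. G v (a', m) a * \<phi> a c) else 0)"
      unfolding sum_recv y' by (intro sum.cong refl) (auto simp: step_state_Recv)
    also have "... = (\<Sum>c\<in>C. V u d c * (\<Sum>a\<in>A. G v (a', m) a * \<phi> a c))" using M y' by simp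
    also have "... = (\<Sum>a\<in>A. G v (a', m) a * (\<Sum>c\<in>C. V u d c * \<phi> a c))"
      by (simp add: sum_distrib_left mult_ac) (rule sum.swap)
    finally show ?thesis by (simp add: y' step_state_Recv)
  qed
  have "step_state (recv M D) (G2 u) ?D =
     step_state (recv M C) (\<lambda>x y. \<Sum>y'\<in>recv M D. G2 u x y' * rlift (V u) y' y) ?C"
  proof (intro ext)
    fix c a2
    show "step_state (recv M D) (G2 u) ?D c a2 =
       step_state (recv M C) (\<lambda>x y. \<Sum>y'\<in>recv M D. G2 u x y' * rlift (V u) y' y) ?C c a2"
    proof (cases c)
      case (Recv m2 a')
      have "(\<Sum>y'\<in>recv M D. G2 u (a2, m2) y' * ?D y' a') =
         (\<Sum>y'\<in>recv M D. \<Sum>y\<in>recv M C. G2 u (a2, m2) y' * (rlift (V u) y' y * ?C y a'))"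
        by (intro sum.cong refl) (simp add: D sum_distrib_left)
      also have "... = (\<Sum>y\<in>recv M C. (\<Sum>y'\<in>recv M D. G2 u (a2, m2) y' * rlift (V u) y' y) * ?C y a')"
        by (subst sum.swap) (simp add: sum_distrib_right sum_distrib_left mult_ac)
      finally show ?thesis by (simp add: Recv step_state_Recv)
    qed (simp_all add: step_state_def)
  qed
  then show ?thesis by (simp add: p)
next
  case ("2_2" D' V' M A' G Q)
  let ?Q = "\<lambda>a'. of_bool (a' \<in> Q) :: real"
  from "2_2" have p: "p = Step M A' G (Done Q)" by simp
  have *: "(\<Sum>d\<in>D. (cmod (\<Sum>a\<in>A. G v (a', m) a * (\<Sum>c\<in>C. V u d c * \<phi> a c)))^2) =
     (\<Sum>c\<in>C. (cmod (\<Sum>a\<in>A. G v (a', m) a * \<phi> a c))^2)" for a' m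
  proof -
    have "(\<Sum>a\<in>A. G v (a', m) a * (\<Sum>c\<in>C. V u d c * \<phi> a c)) = (\<Sum>c\<in>C. V u d c * (\<Sum>a\<in>A. G v (a', m) a * \<phi> a c))" for d
      by (simp add: sum_distrib_left mult_ac) (rule sum.swap)
    then show ?thesis
      using isom_nsq[OF fin(2) assms(5), of "\<lambda>c. \<Sum>a\<in>A. G v (a', m) a * \<phi> a c"] "2_2"
      by (simp add: nsq_def)
  qed
  have "acc p A D v u (\<lambda>a d. \<Sum>c\<in>C. V u d c * \<phi> a c) =
     (\<Sum>m\<in>M. \<Sum>a'\<in>A'. ?Q a' * (\<Sum>d\<in>D. (cmod (\<Sum>a\<in>A. G v (a', m) a * (\<Sum>c\<in>C. V u d c * \<phi> a c)))^2))"
    unfolding p acc.simps sum_recv step_state_Recv sum_distrib_left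
    by (intro sum.cong refl sum.swap)
  also have "... = (\<Sum>m\<in>M. \<Sum>a'\<in>A'. ?Q a' * (\<Sum>c\<in>C. (cmod (\<Sum>a\<in>A. G v (a', m) a * \<phi> a c))^2))"
    by (simp only: *)
  also have "... = acc p A C v u \<phi>"
    unfolding p acc.simps sum_recv step_state_Recv sum_distrib_left
    by (intro sum.cong refl sum.swap)
  finally show ?thesis unfolding p merge.simps by (rule sym)
qed (use p in auto)

definition ctrl :: "bool list set \<Rightarrow> 'm mem set \<Rightarrow> 'm mem set \<Rightarrow> 'm mem set" where
  "ctrl S A J = (\<lambda>(s, a). Ctrl s a) ` (S \<times> A) \<union> Junk ` J"

lemma finite_ctrl [simp]: "finite S \<Longrightarrow> finite A \<Longrightarrow> finite J \<Longrightarrow> finite (ctrl S A J)"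
  by (simp add: ctrl_def)

lemma sum_ctrl:
  assumes "finite S" "finite A" "finite J"
  shows "(\<Sum>c\<in>ctrl S A J. f c) = (\<Sum>s\<in>S. \<Sum>a\<in>A. f (Ctrl s a)) + (\<Sum>j\<in>J. f (Junk j))"
proof -
  have "(\<Sum>c\<in>ctrl S A J. f c) = (\<Sum>c\<in>(\<lambda>(s, a). Ctrl s a) ` (S \<times> A). f c) + (\<Sum>c\<in>Junk ` J. f c)"
    unfolding ctrl_def using assms by (intro sum.union_disjoint) auto
  also have "(\<Sum>c\<in>(\<lambda>(s, a). Ctrl s a) ` (S \<times> A). f c) = (\<Sum>s\<in>S. \<Sum>a\<in>A. f (Ctrl s a))"
    by (subst sum.reindex) (auto simp: inj_on_def sum.cartesian_product case_prod_unfold)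
  also have "(\<Sum>c\<in>Junk ` J. f c) = (\<Sum>j\<in>J. f (Junk j))"
    by (subst sum.reindex) (auto simp: inj_on_def)
  finally show ?thesis .
qed

lemma ball_ctrl: "(\<forall>c\<in>ctrl S A J. P c) \<longleftrightarrow> (\<forall>s\<in>S. \<forall>a\<in>A. P (Ctrl s a)) \<and> (\<forall>j\<in>J. P (Junk j))"
  by (auto simp: ctrl_def)

text \<open>The junk branch has to be isometric as well, because the isometry from
  \<open>polar\<close> may produce junk amplitude when applied to a state other than the one it was
  built for. It stores the received message and sends a fixed one.\<close>

definition ctrl_gate :: "(bool list \<Rightarrow> bool list \<Rightarrow> bool list) \<Rightarrow> 'm set \<Rightarrow> 'm gate \<Rightarrow> 'm gate" where
  "ctrl_gate g M G u = (\<lambda>(y, m) x. case x of Recv m0 z \<Rightarrow> (case z of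
       Ctrl s0 a \<Rightarrow> (case y of Ctrl s a' \<Rightarrow> of_bool (s = s0) * G (g u s) (a', m) (Recv m0 a) | _ \<Rightarrow> 0)
     | Junk j \<Rightarrow> of_bool (y = Junk (Recv m0 j) \<and> m = (SOME m. m \<in> M))
     | _ \<Rightarrow> 0) | _ \<Rightarrow> 0)"

lemma ctrl_gate_simps [simp]:
  "ctrl_gate g M G u (Ctrl s a', m) (Recv m0 (Ctrl s0 a)) = of_bool (s = s0) * G (g u s) (a', m) (Recv m0 a)"
  "ctrl_gate g M G u (Junk j', m) (Recv m0 (Ctrl s0 a)) = 0"
  "ctrl_gate g M G u (Ctrl s a', m) (Recv m0 (Junk j)) = 0"
  "ctrl_gate g M G u (Junk j', m) (Recv m0 (Junk j)) = of_bool (j' = Recv m0 j \<and> m = (SOME m. m \<in> M))"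
  by (simp_all add: ctrl_gate_def)

lemma isom_ctrl_gate:
  assumes fin: "finite S" "finite A" "finite A'" "finite J" "finite M0" "finite M" and M: "M \<noteq> {}"
    and G: "\<And>s. s \<in> S \<Longrightarrow> isom (A' \<times> M) (recv M0 A) (G (g u s))"
  shows "isom (ctrl S A' (recv M0 J) \<times> M) (recv M0 (ctrl S A J)) (ctrl_gate g M G u)"
proof -
  let ?g = "ctrl_gate g M G u" and ?D = "ctrl S A' (recv M0 J) \<times> M"
  define m1 where "m1 = (SOME m. m \<in> M)"
  have m1: "m1 \<in> M" using M by (simp add: m1_def some_in_eq)
  have split: "(\<Sum>d\<in>ctrl S A' (recv M0 J) \<times> M. F d) =
     (\<Sum>s\<in>S. \<Sum>d\<in>A' \<times> M. F (Ctrl s (fst d), snd d)) + (\<Sum>m0\<in>M0. \<Sum>j\<in>J. \<Sum>m\<in>M. F (Junk (Recv m0 j), m))" for F :: "_ \<Rightarrow> complex"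
  proof -
    have inner: "(\<Sum>y\<in>A'. \<Sum>m\<in>M. h y m) = (\<Sum>d\<in>A' \<times> M. h (fst d) (snd d))" for h :: "_ \<Rightarrow> _ \<Rightarrow> complex"
      by (simp add: sum.cartesian_product case_prod_unfold)
    have "(\<Sum>d\<in>ctrl S A' (recv M0 J) \<times> M. F d) = (\<Sum>y\<in>ctrl S A' (recv M0 J). \<Sum>m\<in>M. F (y, m))"
      by (simp add: sum.cartesian_product case_prod_unfold)
    then show ?thesis using fin by (simp only: sum_ctrl finite_recv sum_recv inner)
  qed
  show ?thesis
    unfolding isom_def ball_recv ball_ctrl
  proof (intro conjI ballI)
    fix m0 s a m0' s' a'
    assume *: "m0 \<in> M0" "s \<in> S" "a \<in> A" "m0' \<in> M0" "s' \<in> S" "a' \<in> A"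
    have "(\<Sum>d\<in>?D. ?g d (Recv m0 (Ctrl s a)) * cnj (?g d (Recv m0' (Ctrl s' a')))) =
      (\<Sum>k\<in>S. if k = s then of_bool (s = s') * (\<Sum>d\<in>A' \<times> M. G (g u s) d (Recv m0 a) * cnj (G (g u s) d (Recv m0' a'))) else 0)"
      unfolding split ctrl_gate_simps mult_zero_left sum.neutral_const add_0_right
      by (intro sum.cong refl) (auto simp: of_bool_def)
    also have "... = of_bool (Recv m0 (Ctrl s a) = Recv m0' (Ctrl s' a'))"
      using G[OF \<open>s \<in> S\<close>] * fin by (auto simp: isom_def ball_recv)
    finally show "(\<Sum>d\<in>?D. ?g d (Recv m0 (Ctrl s a)) * cnj (?g d (Recv m0' (Ctrl s' a')))) =
      of_bool (Recv m0 (Ctrl s a) = Recv m0' (Ctrl s' a'))" .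
  next
    fix m0 j m0' j'
    assume *: "m0 \<in> M0" "j \<in> J" "m0' \<in> M0" "j' \<in> J"
    have "(\<Sum>d\<in>?D. ?g d (Recv m0 (Junk j)) * cnj (?g d (Recv m0' (Junk j')))) =
      (\<Sum>k\<in>M0. if k = m0 then (\<Sum>i\<in>J. if i = j then (\<Sum>m\<in>M. if m = m1 then of_bool (m0 = m0' \<and> j = j') else 0) else 0) else 0)"
      unfolding split ctrl_gate_simps mult_zero_left sum.neutral_const add_0_left m1_def[symmetric]
      by (intro sum.cong refl) (auto simp: of_bool_def intro!: sum.cong sum.neutral)
    also have "... = of_bool (Recv m0 (Junk j) = Recv m0' (Junk j'))"
      using * fin m1 by auto
    finally show "(\<Sum>d\<in>?D. ?g d (Recv m0 (Junk j)) * cnj (?g d (Recv m0' (Junk j')))) =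
      of_bool (Recv m0 (Junk j) = Recv m0' (Junk j'))" .
  qed (simp_all add: split)
qed

text \<open>
  \<open>lift\<close> runs a protocol for long inputs on short ones: one player completes \<open>v\<close> to \<open>f v\<close>, the other
  one keeps a string \<open>s\<close> in a control register and completes \<open>u\<close> to \<open>g u s\<close>. The Boolean says
  whether the player without control register moves next.
\<close>

primrec lift :: "(bool list \<Rightarrow> bool list) \<Rightarrow> (bool list \<Rightarrow> bool list \<Rightarrow> bool list) \<Rightarrow> bool list set \<Rightarrow>
    'm prot \<Rightarrow> bool \<Rightarrow> 'm mem set \<Rightarrow> 'm prot" where
  "lift f g S (Done Q) w J = Done (if w then (\<lambda>(s, a). Ctrl s a) ` (UNIV \<times> Q) else Q)"
| "lift f g S (Step M A' G p) w J =
     (if w then Step M A' (\<lambda>v. G (f v)) (lift f g S p False (recv M J))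
      else Step M (ctrl S A' J) (ctrl_gate g M G) (lift f g S p True J))"

lemma msgs_lift [simp]: "msgs (lift f g S p w J) = msgs p"
  by (induction p arbitrary: w J) auto

text \<open>Both halves go through one induction because the owner of the control register
  alternately waits and moves. In the second half a message has just arrived there, also on junk
  labels, hence \<open>recv M0 J\<close>.\<close>

lemma wf_prot_lift:
  assumes fg: "\<And>v. v \<in> inputs n' \<Longrightarrow> f v \<in> inputs n" "\<And>u s. u \<in> inputs n' \<Longrightarrow> s \<in> S \<Longrightarrow> g u s \<in> inputs n"
    and S: "finite S"
  shows "(wf_prot n p C A \<longrightarrow> finite A \<longrightarrow> finite J \<longrightarrow> wf_prot n' (lift f g S p True J) C (ctrl S A J)) \<and>
    (wf_prot n p (recv M0 A) C \<longrightarrow> finite A \<longrightarrow> finite J \<longrightarrow> finite M0 \<longrightarrow>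
       wf_prot n' (lift f g S p False (recv M0 J)) (recv M0 (ctrl S A J)) C)"
proof (induction p arbitrary: A C J M0)
  case (Done Q)
  then show ?case by simp
next
  case (Step M A' G p)
  show ?case
  proof (intro conjI impI)
    assume "wf_prot n (Step M A' G p) C A" "finite A" "finite J"
    then show "wf_prot n' (lift f g S (Step M A' G p) True J) C (ctrl S A J)"
      using Step.IH[where A=A and C=A' and J=J and ?M0.0=M] fg S by simp
  next
    assume "wf_prot n (Step M A' G p) (recv M0 A) C" "finite A" "finite J" "finite M0"
    then show "wf_prot n' (lift f g S (Step M A' G p) False (recv M0 J)) (recv M0 (ctrl S A J)) C"
      using Step.IH[where C="recv M C" and A=A' and J="recv M0 J"] fg S by (auto intro!: isom_ctrl_gate)
  qed
qed

text \<open>No gate changes the control register, so branches with different \<open>s\<close> never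
  interfere and their acceptance probabilities add with the common weight \<open>(cmod k)^2\<close>;
  junk amplitudes stay 0.\<close>

lemma acc_lift:
  assumes S: "finite S"
  shows "(finite A \<longrightarrow> finite J \<longrightarrow>
      (\<forall>c\<in>C. \<forall>s\<in>S. \<forall>a\<in>A. \<Psi> c (Ctrl s a) = k * \<psi> s c a) \<longrightarrow> (\<forall>c\<in>C. \<forall>j\<in>J. \<Psi> c (Junk j) = 0) \<longrightarrow>
      wf_prot n p C A \<longrightarrow>
      acc (lift f g S p True J) C (ctrl S A J) v u \<Psi> = (cmod k)^2 * (\<Sum>s\<in>S. acc p C A (f v) (g u s) (\<psi> s))) \<and>
    (finite A \<longrightarrow> finite J \<longrightarrow> finite M0 \<longrightarrow>
      (\<forall>c\<in>C. \<forall>m\<in>M0. \<forall>s\<in>S. \<forall>a\<in>A. \<Psi> (Recv m (Ctrl s a)) c = k * \<psi> s (Recv m a) c) \<longrightarrow>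
      (\<forall>c\<in>C. \<forall>m\<in>M0. \<forall>j\<in>J. \<Psi> (Recv m (Junk j)) c = 0) \<longrightarrow>
      wf_prot n p (recv M0 A) C \<longrightarrow>
      acc (lift f g S p False (recv M0 J)) (recv M0 (ctrl S A J)) C u v \<Psi> =
        (cmod k)^2 * (\<Sum>s\<in>S. acc p (recv M0 A) C (g u s) (f v) (\<psi> s)))"
proof (induction p arbitrary: A C J M0 \<Psi> \<psi> u v)
  case (Done Q)
  let ?L = "acc (lift f g S (Done Q) True J) C (ctrl S A J) v u \<Psi>"
  let ?R = "(cmod k)^2 * (\<Sum>s\<in>S. acc (Done Q) C A (f v) (g u s) (\<psi> s))"
  let ?L' = "acc (lift f g S (Done Q) False (recv M0 J)) (recv M0 (ctrl S A J)) C u v \<Psi>"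
  let ?R' = "(cmod k)^2 * (\<Sum>s\<in>S. acc (Done Q) (recv M0 A) C (g u s) (f v) (\<psi> s))"
  show ?case
  proof (intro conjI impI)
    assume *: "finite A" "finite J" "\<forall>c\<in>C. \<forall>s\<in>S. \<forall>a\<in>A. \<Psi> c (Ctrl s a) = k * \<psi> s c a" "\<forall>c\<in>C. \<forall>j\<in>J. \<Psi> c (Junk j) = 0"
    have "?L =
      (\<Sum>c\<in>C. \<Sum>s\<in>S. \<Sum>a\<in>A. (cmod k)^2 * (of_bool (a \<in> Q) * (cmod (\<psi> s c a))^2))"
      using * S by (simp add: sum_ctrl del: sum_of_bool_mult_eq) (intro sum.cong refl, auto simp: norm_mult power_mult_distrib)
    also have "... = ?R"
      by (subst sum.swap) (simp add: sum_distrib_left)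
    finally show "?L =
      ?R" .
  next
    assume *: "finite A" "finite J" "finite M0" "\<forall>c\<in>C. \<forall>m\<in>M0. \<forall>s\<in>S. \<forall>a\<in>A. \<Psi> (Recv m (Ctrl s a)) c = k * \<psi> s (Recv m a) c"
      "\<forall>c\<in>C. \<forall>m\<in>M0. \<forall>j\<in>J. \<Psi> (Recv m (Junk j)) c = 0"
    have "?L' =
      (\<Sum>m\<in>M0. \<Sum>s\<in>S. \<Sum>a\<in>A. \<Sum>c\<in>C. (cmod k)^2 * (of_bool (c \<in> Q) * (cmod (\<psi> s (Recv m a) c))^2))"
      using * S by (simp add: sum_ctrl sum_recv del: sum_of_bool_mult_eq) (intro sum.cong refl, auto simp: norm_mult power_mult_distrib)
    also have "... = ?R'"
      by (subst sum.swap) (simp add: sum_distrib_left sum_recv)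
    finally show "?L' =
      ?R'" .
  qed
next
  case (Step M A' G p)
  show ?case
  proof (intro conjI impI)
    assume *: "finite A" "finite J" "\<forall>c\<in>C. \<forall>s\<in>S. \<forall>a\<in>A. \<Psi> c (Ctrl s a) = k * \<psi> s c a" "\<forall>c\<in>C. \<forall>j\<in>J. \<Psi> c (Junk j) = 0"
      "wf_prot n (Step M A' G p) C A"
    have "acc (lift f g S p False (recv M J)) (recv M (ctrl S A J)) A' u v (step_state C (G (f v)) \<Psi>) =
        (cmod k)^2 * (\<Sum>s\<in>S. acc p (recv M A) A' (g u s) (f v) (step_state C (G (f v)) (\<psi> s)))"
      using * by (intro Step.IH[THEN conjunct2, rule_format])
        (auto simp: step_state_Recv sum_distrib_left mult_ac intro!: sum.cong)
    then show "acc (lift f g S (Step M A' G p) True J) C (ctrl S A J) v u \<Psi> =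
        (cmod k)^2 * (\<Sum>s\<in>S. acc (Step M A' G p) C A (f v) (g u s) (\<psi> s))" by simp
  next
    assume *: "finite A" "finite J" "finite M0" "\<forall>c\<in>C. \<forall>m\<in>M0. \<forall>s\<in>S. \<forall>a\<in>A. \<Psi> (Recv m (Ctrl s a)) c = k * \<psi> s (Recv m a) c"
      "\<forall>c\<in>C. \<forall>m\<in>M0. \<forall>j\<in>J. \<Psi> (Recv m (Junk j)) c = 0" "wf_prot n (Step M A' G p) (recv M0 A) C"
    have "acc (lift f g S p True (recv M0 J)) (recv M C) (ctrl S A' (recv M0 J)) v u
         (step_state (recv M0 (ctrl S A J)) (ctrl_gate g M G u) \<Psi>) =
        (cmod k)^2 * (\<Sum>s\<in>S. acc p (recv M C) A' (f v) (g u s) (step_state (recv M0 A) (G (g u s)) (\<psi> s)))"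
    proof (intro Step.IH[THEN conjunct1, rule_format])
      fix c s a' assume c: "c \<in> recv M C" "s \<in> S" "a' \<in> A'"
      then obtain m b where mb: "c = Recv m b" "m \<in> M" "b \<in> C" by (auto simp: recv_def)
      have "step_state (recv M0 (ctrl S A J)) (ctrl_gate g M G u) \<Psi> c (Ctrl s a') =
         (\<Sum>m0\<in>M0. \<Sum>s0\<in>S. if s0 = s then \<Sum>a\<in>A. G (g u s) (a', m) (Recv m0 a) * \<Psi> (Recv m0 (Ctrl s a)) b else 0)"
        unfolding mb step_state_Recv sum_recv sum_ctrl[OF S *(1,2)] ctrl_gate_simps
          mult_zero_left sum.neutral_const add_0_right
        by (intro sum.cong refl) auto
      also have "... = k * step_state (recv M0 A) (G (g u s)) (\<psi> s) c a'"
        using * S c mb by (auto simp: step_state_Recv sum_recv sum_distrib_left mult_ac intro!: sum.cong)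
      finally show "step_state (recv M0 (ctrl S A J)) (ctrl_gate g M G u) \<Psi> c (Ctrl s a') =
        k * step_state (recv M0 A) (G (g u s)) (\<psi> s) c a'" .
    next
      fix c j assume c: "c \<in> recv M C" "j \<in> recv M0 J"
      then obtain m b where mb: "c = Recv m b" "m \<in> M" "b \<in> C" by (auto simp: recv_def)
      show "step_state (recv M0 (ctrl S A J)) (ctrl_gate g M G u) \<Psi> c (Junk j) = 0"
        using * S mb by (simp add: step_state_Recv sum_recv sum_ctrl)
    qed (use * in auto)
    then show "acc (lift f g S (Step M A' G p) False (recv M0 J)) (recv M0 (ctrl S A J)) C u v \<Psi> =
        (cmod k)^2 * (\<Sum>s\<in>S. acc (Step M A' G p) (recv M0 A) C (g u s) (f v) (\<psi> s))" by simp
  qed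
qed

section \<open>The hard distribution\<close>

lemma finite_inputs [simp]: "finite (inputs n)"
  using finite_lists_length_eq[of "UNIV :: bool set" n] by (simp add: inputs_def)

lemma card_inputs: "card (inputs n) = 2 ^ n"
  using card_lists_length_eq[of "UNIV :: bool set" n] by (simp add: inputs_def)

lemma inputs_append: "u \<in> inputs a \<Longrightarrow> v \<in> inputs b \<Longrightarrow> u @ v \<in> inputs (a + b)"
  by (simp add: inputs_def)

section \<open>Uniform averages over bit strings\<close>

definition avg :: "nat \<Rightarrow> (bool list \<Rightarrow> real) \<Rightarrow> real" where
  "avg n F = (\<Sum>x\<in>inputs n. F x) / 2 ^ n"

lemma avg_const [simp]: "avg n (\<lambda>_. c) = c"
  by (simp add: avg_def card_inputs)

lemma avg_add: "avg n (\<lambda>x. F x + G x) = avg n F + avg n G"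
  by (simp add: avg_def sum.distrib add_divide_distrib)

lemma avg_cmult: "avg n (\<lambda>x. c * F x) = c * avg n F"
  by (simp add: avg_def sum_distrib_left)

lemma avg_diff: "avg n (\<lambda>x. F x - G x) = avg n F - avg n G"
  by (simp add: avg_def sum_subtractf diff_divide_distrib)

lemma avg_sum: "avg n (\<lambda>x. \<Sum>i\<in>I. F i x) = (\<Sum>i\<in>I. avg n (F i))"
  unfolding avg_def by (subst sum.swap) (simp add: sum_divide_distrib)

lemma avg_divide: "avg n (\<lambda>x. F x / c) = avg n F / c"
  by (simp add: avg_def sum_divide_distrib mult.commute)

lemma avg_mono: "(\<And>x. x \<in> inputs n \<Longrightarrow> F x \<le> G x) \<Longrightarrow> avg n F \<le> avg n G"
  unfolding avg_def by (intro divide_right_mono sum_mono) auto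

lemma avg_cong: "(\<And>x. x \<in> inputs n \<Longrightarrow> F x = G x) \<Longrightarrow> avg n F = avg n G"
  unfolding avg_def by simp

lemma avg_swap: "avg n (\<lambda>x. avg m (\<lambda>y. F x y)) = avg m (\<lambda>y. avg n (\<lambda>x. F x y))"
  unfolding avg_def sum_divide_distrib[symmetric] divide_divide_eq_left
  by (subst sum.swap) (simp add: mult.commute)

lemma avg_append: "avg (a + b) F = avg a (\<lambda>x. avg b (\<lambda>y. F (x @ y)))"
proof -
  have "bij_betw (\<lambda>(x, y). x @ y) (inputs a \<times> inputs b) (inputs (a + b))"
  proof (rule bij_betwI[where g = "\<lambda>z. (take a z, drop a z)"])
  qed (auto simp: inputs_def)
  then have "(\<Sum>z\<in>inputs (a + b). F z) = (\<Sum>x\<in>inputs a. \<Sum>y\<in>inputs b. F (x @ y))"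
    by (simp add: sum.reindex_bij_betw[symmetric] sum.cartesian_product case_prod_unfold)
  then show ?thesis
    by (simp add: avg_def sum_divide_distrib[symmetric] power_add mult.commute)
qed

section \<open>Binary values and comparison by blocks\<close>

lemma bits_val_append: "bits_val (x @ y) = bits_val x * 2 ^ length y + bits_val y"
  by (simp add: bits_val_def horner_sum_append)

lemma bits_val_Cons: "bits_val (b # y) = of_bool b * 2 ^ length y + bits_val y"
  using bits_val_append[of "[b]" y] by (simp add: bits_val_def)

lemma bits_val_less: "bits_val u < 2 ^ length u"
proof (induction u)
  case (Cons b u)
  then show ?case by (cases b) (simp_all add: bits_val_Cons)
qed (simp add: bits_val_def)

lemma bits_val_inj: "length u = length v \<Longrightarrow> bits_val u = bits_val v \<Longrightarrow> u = v"
proof (induction u v rule: list_induct2)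
  case (Cons a u b v)
  then show ?case using bits_val_less[of u] bits_val_less[of v]
    by (cases a; cases b) (auto simp: bits_val_Cons)
qed simp

lemma bij_bits_val: "bij_betw bits_val (inputs m) {..<2 ^ m}"
proof -
  have inj: "inj_on bits_val (inputs m)" by (auto simp: inj_on_def inputs_def intro: bits_val_inj)
  have "bits_val ` inputs m \<subseteq> {..<2 ^ m}" using bits_val_less by (fastforce simp: inputs_def)
  moreover have "card (bits_val ` inputs m) = card {..<2 ^ m :: nat}"
    by (simp add: card_image[OF inj] card_inputs)
  ultimately have "bits_val ` inputs m = {..<2 ^ m}" by (intro card_subset_eq) auto
  then show ?thesis using inj by (simp add: bij_betw_def)
qed

definition numeral_bits :: "nat \<Rightarrow> nat \<Rightarrow> bool list" where
  "numeral_bits m i = inv_into (inputs m) bits_val i"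

lemma numeral_bits_in: "i < 2 ^ m \<Longrightarrow> numeral_bits m i \<in> inputs m"
  and bits_val_numeral_bits: "i < 2 ^ m \<Longrightarrow> bits_val (numeral_bits m i) = i"
  using bij_bits_val[of m] unfolding numeral_bits_def bij_betw_def
  by (auto intro!: inv_into_into f_inv_into_f)

lemma bij_numeral_bits: "bij_betw (numeral_bits m) {..<2 ^ m} (inputs m)"
  unfolding numeral_bits_def[abs_def] by (rule bij_betw_inv_into[OF bij_bits_val])

lemma GT_fun_swap: "length u = length v \<Longrightarrow> u \<noteq> v \<Longrightarrow> GT_fun v u \<longleftrightarrow> \<not> GT_fun u v"
  using bits_val_inj[of u v] unfolding GT_fun_def by (meson linorder_cases not_less_iff_gr_or_eq)

text \<open>A suffix is worth less than one unit in the last place of the block before it, so the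
  first differing block decides.\<close>

lemma GT_fun_block:
  assumes "length u = length v" "length s = length s'" "u \<noteq> v"
  shows "GT_fun (w @ u @ s) (w @ v @ s') \<longleftrightarrow> GT_fun u v"
proof -
  have *: "bits_val y * 2 ^ length t + bits_val t < bits_val x * 2 ^ length t + bits_val t'"
    if "bits_val y < bits_val x" "length t = length t'" for x y t t'
  proof -
    have "bits_val y * 2 ^ length t + bits_val t < Suc (bits_val y) * 2 ^ length t"
      using bits_val_less[of t] by simp
    also have "... \<le> bits_val x * 2 ^ length t" using that by (intro mult_right_mono) auto
    finally show ?thesis by simp
  qed
  have "bits_val u \<noteq> bits_val v" using assms bits_val_inj by blast
  then show ?thesis
    using *[of u v s s'] *[of v u s' s] *[of u v s' s] *[of v u s s'] assms
    unfolding GT_fun_def bits_val_append by (cases "bits_val u < bits_val v") auto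
qed

text \<open>
  The expectation under the hard distribution. At level \<open>0\<close> the inputs are cyclic neighbours, so that
  either input alone says almost nothing about the answer; equal inputs must be avoided, since then
  the later blocks would decide.
\<close>

primrec hard :: "nat \<Rightarrow> nat \<Rightarrow> nat \<Rightarrow> (bool list \<Rightarrow> bool list \<Rightarrow> real) \<Rightarrow> real" where
  "hard m k 0 F = (\<Sum>i<2 ^ m. F (numeral_bits m i) (numeral_bits m (Suc i mod 2 ^ m)) +
       F (numeral_bits m (Suc i mod 2 ^ m)) (numeral_bits m i)) / (2 * 2 ^ m)"
| "hard m k (Suc j) F = (\<Sum>i<k. avg (i * (m * k ^ j)) (\<lambda>w. avg ((k - 1 - i) * (m * k ^ j)) (\<lambda>s.
       avg ((k - 1 - i) * (m * k ^ j)) (\<lambda>s'. hard m k j (\<lambda>u v. F (w @ u @ s) (w @ v @ s')))))) / k"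

section \<open>The hard distribution as a positive linear functional\<close>

lemma hard_add: "hard m k j (\<lambda>u v. F u v + G u v) = hard m k j F + hard m k j G"
  by (induction j arbitrary: F G) (simp_all add: avg_add sum.distrib add_divide_distrib)

lemma hard_cmult: "hard m k j (\<lambda>u v. c * F u v) = c * hard m k j F"
proof (induction j arbitrary: F)
  case 0
  show ?case unfolding hard.simps distrib_left[symmetric] sum_distrib_left[symmetric] by simp
next
  case (Suc j)
  show ?case unfolding hard.simps Suc.IH avg_cmult sum_distrib_left[symmetric] by simp
qed

lemma hard_diff: "hard m k j (\<lambda>u v. F u v - G u v) = hard m k j F - hard m k j G"
  using hard_add[of m k j F "\<lambda>u v. (-1) * G u v"] hard_cmult[of m k j "-1" G] by simp

lemma hard_sum: "hard m k j (\<lambda>u v. \<Sum>i\<in>I. F i u v) = (\<Sum>i\<in>I. hard m k j (F i))"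
proof (induction I rule: infinite_finite_induct)
  case empty
  show ?case using hard_cmult[of m k j 0 "\<lambda>_ _. 0"] by simp
next
  case (infinite I)
  then show ?case using hard_cmult[of m k j 0 "\<lambda>_ _. 0"] by simp
qed (simp add: hard_add)

lemma hard_avg: "hard m k j (\<lambda>u v. avg n (\<lambda>s. F s u v)) = avg n (\<lambda>s. hard m k j (F s))"
  using hard_cmult[of m k j "1 / 2 ^ n" "\<lambda>u v. \<Sum>s\<in>inputs n. F s u v"]
  by (simp add: avg_def hard_sum)

lemma block_length:
  assumes "i < (k::nat)" shows "i * N + (N + (k - 1 - i) * N) = N * k"
proof -
  have "i * N + (N + (k - 1 - i) * N) = (i + (1 + (k - 1 - i))) * N" by (simp only: distrib_right mult_1)
  then show ?thesis using assms by (simp add: mult.commute)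
qed

lemma block_inputs:
  assumes "i < k" "w \<in> inputs (i * N)" "u \<in> inputs N" "s \<in> inputs ((k - 1 - i) * N)"
  shows "w @ u @ s \<in> inputs (N * k)"
  using assms block_length[OF assms(1), of N] by (simp add: inputs_def)

text \<open>Pairs of equal inputs carry no weight. This uses \<open>m \<ge> 1\<close>: with a single
  cyclic position the successor of 0 would be 0 itself.\<close>

lemma hard_mono:
  assumes "m \<ge> 1"
    and "\<And>u v. u \<in> inputs (m * k ^ j) \<Longrightarrow> v \<in> inputs (m * k ^ j) \<Longrightarrow> u \<noteq> v \<Longrightarrow> F u v \<le> G u v"
  shows "hard m k j F \<le> hard m k j G"
  using assms(2)
proof (induction j arbitrary: F G)
  case 0
  have ne: "numeral_bits m i \<noteq> numeral_bits m (Suc i mod 2 ^ m)" if "i < 2 ^ m" for i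
  proof
    assume "numeral_bits m i = numeral_bits m (Suc i mod 2 ^ m)"
    then have eq: "Suc i mod 2 ^ m = i"
      using bits_val_numeral_bits[OF that] bits_val_numeral_bits[of "Suc i mod 2 ^ m" m] by (metis mod_less_divisor zero_less_numeral zero_less_power)
    moreover have "(2::nat) ^ 1 \<le> 2 ^ m" using assms(1) by (intro power_increasing) auto
    moreover have "Suc i < 2 ^ m \<or> Suc i = 2 ^ m" using that by linarith
    ultimately show False using eq by (elim disjE) simp_all
  qed
  show ?case unfolding hard.simps
    by (intro divide_right_mono sum_mono add_mono 0)
       (auto intro!: numeral_bits_in simp: ne ne[symmetric])
next
  case (Suc j)
  let ?N = "m * k ^ j"
  have "hard m k j (\<lambda>u v. F (w @ u @ s) (w @ v @ s')) \<le> hard m k j (\<lambda>u v. G (w @ u @ s) (w @ v @ s'))"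
    if "i < k" "w \<in> inputs (i * ?N)" "s \<in> inputs ((k - 1 - i) * ?N)" "s' \<in> inputs ((k - 1 - i) * ?N)" for i w s s'
    using that block_inputs[of i k w ?N]
    by (intro Suc.IH Suc.prems) (auto simp: inputs_def mult_ac)
  then show ?case unfolding hard.simps
    by (intro divide_right_mono sum_mono avg_mono) auto
qed

lemma hard_cong:
  assumes "m \<ge> 1"
    and "\<And>u v. u \<in> inputs (m * k ^ j) \<Longrightarrow> v \<in> inputs (m * k ^ j) \<Longrightarrow> u \<noteq> v \<Longrightarrow> F u v = G u v"
  shows "hard m k j F = hard m k j G"
  using assms by (intro antisym hard_mono) auto

lemma hard_swap: "hard m k j (\<lambda>u v. F v u) = hard m k j F"
proof (induction j arbitrary: F)
  case 0
  then show ?case by (simp add: add.commute)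
next
  case (Suc j)
  have "hard m k j (\<lambda>u v. F (w @ v @ s') (w @ u @ s)) = hard m k j (\<lambda>u v. F (w @ u @ s') (w @ v @ s))" for w s s'
    by (rule Suc.IH)
  then show ?case by (simp only: hard.simps) (subst avg_swap, rule refl)
qed

text \<open>Each input alone is uniform, because the cyclic shift permutes the base level and
  uniform blocks concatenate to a uniform string. Hence the loss in
  \<open>round_elimination\<close>, which depends on the sender's block only, becomes a uniform
  average.\<close>

lemma hard_fst:
  assumes "k \<ge> 1"
  shows "hard m k j (\<lambda>u v. G u) = avg (m * k ^ j) G"
proof (induction j arbitrary: G)
  case 0
  let ?e = "numeral_bits m" and ?M = "2 ^ m :: nat"
  have e: "(\<Sum>i<?M. G (?e i)) = (\<Sum>u\<in>inputs m. G u)"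
    by (rule sum.reindex_bij_betw[OF bij_numeral_bits])
  have "bij_betw (\<lambda>i. Suc i mod ?M) {..<?M} {..<?M}"
  proof -
    have "inj_on (\<lambda>i. Suc i mod ?M) {..<?M}"
      by (auto simp: inj_on_def mod_Suc split: if_splits)
    moreover have "(\<lambda>i. Suc i mod ?M) ` {..<?M} \<subseteq> {..<?M}" by auto
    ultimately show ?thesis by (simp add: bij_betw_def endo_inj_surj)
  qed
  then have "(\<Sum>i<?M. G (?e (Suc i mod ?M))) = (\<Sum>i<?M. G (?e i))"
    by (rule sum.reindex_bij_betw)
  then show ?case using e by (simp add: avg_def sum.distrib)
next
  case (Suc j)
  let ?N = "m * k ^ j"
  have "avg (i * ?N) (\<lambda>w. avg ((k - 1 - i) * ?N) (\<lambda>s. avg ((k - 1 - i) * ?N) (\<lambda>s'.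
           hard m k j (\<lambda>u v. G (w @ u @ s))))) = avg (m * k ^ Suc j) G" if i: "i < k" for i
  proof -
    have "avg (i * ?N) (\<lambda>w. avg ((k - 1 - i) * ?N) (\<lambda>s. avg ((k - 1 - i) * ?N) (\<lambda>s'.
           hard m k j (\<lambda>u v. G (w @ u @ s))))) =
        avg (i * ?N) (\<lambda>w. avg ?N (\<lambda>u. avg ((k - 1 - i) * ?N) (\<lambda>s. G (w @ u @ s))))"
      by (simp add: Suc.IH) (subst avg_swap, rule refl)
    also have "... = avg (i * ?N + (?N + (k - 1 - i) * ?N)) G"
      by (simp only: avg_append)
    finally show ?thesis unfolding block_length[OF i] by (simp add: mult_ac)
  qed
  then show ?case using assms by simp
qed

lemma hard_const [simp]: "k \<ge> 1 \<Longrightarrow> hard m k j (\<lambda>u v. c) = c"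
  using hard_fst[of k m j "\<lambda>_. c"] by simp

text \<open>The error probability for computing \<open>GT_fun u v = c\<close> when \<open>True\<close> is output with probability \<open>q\<close>.\<close>

definition err :: "bool \<Rightarrow> bool list \<Rightarrow> bool list \<Rightarrow> real \<Rightarrow> real" where
  "err c u v q = (if GT_fun u v = c then 1 - q else q)"

lemma err_swap: "length u = length v \<Longrightarrow> u \<noteq> v \<Longrightarrow> err (\<not> c) v u q = err c u v q"
  using GT_fun_swap[of u v] by (auto simp: err_def)

lemma err_avg: "avg n (\<lambda>s. err c u v (q s)) = err c u v (avg n q)"
  by (simp add: err_def avg_diff)

lemma err_diff: "err c u v q \<le> err c u v q' + \<bar>q - q'\<bar>"
  by (auto simp: err_def)

text \<open>For an interior value the two neighbours demand opposite answers, so the two errors add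
  up to 1 whatever \<open>q\<close> is. The two extreme values, whose neighbours lie on the same
  side, are given up; this is the term \<open>1 / 2 ^ m\<close>.\<close>

lemma hard_zero_communication:
  assumes m: "m \<ge> 1" and q: "\<And>u. u \<in> inputs m \<Longrightarrow> 0 \<le> q u \<and> q u \<le> 1"
  shows "1 / 2 - 1 / 2 ^ m \<le> hard m k 0 (\<lambda>u v. err c u v (q u))"
proof -
  let ?e = "numeral_bits m" and ?M = "2 ^ m :: nat"
  let ?F = "\<lambda>i j. err c (?e i) (?e j) (q (?e i))"
  have M2: "?M \<ge> 2" using power_increasing[OF m, of "2::nat"] by simp
  have F0: "0 \<le> ?F i j" if "i < ?M" for i j
    using q[OF numeral_bits_in[OF that]] by (simp add: err_def)
  have pair: "?F (Suc i) (Suc (Suc i)) + ?F (Suc i) i = 1" if "i < ?M - 2" for i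
    using that by (auto simp: err_def GT_fun_def bits_val_numeral_bits)
  have "real (?M - 2) = (\<Sum>i<?M - 2. ?F (Suc i) (Suc (Suc i)) + ?F (Suc i) i)"
    by (simp add: pair)
  also have "... = (\<Sum>i<?M - 2. ?F (Suc i) (Suc (Suc i))) + (\<Sum>i<?M - 2. ?F (Suc i) i)"
    by (rule sum.distrib)
  also have "(\<Sum>i<?M - 2. ?F (Suc i) (Suc (Suc i))) = (\<Sum>i\<in>Suc ` {..<?M - 2}. ?F i (Suc i mod ?M))"
    by (subst sum.reindex) auto
  also have "... \<le> (\<Sum>i<?M. ?F i (Suc i mod ?M))"
    by (intro sum_mono2) (auto intro: F0)
  also have "(\<Sum>i<?M - 2. ?F (Suc i) i) = (\<Sum>i<?M - 2. ?F (Suc i mod ?M) i)"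
    by (intro sum.cong) auto
  also have "... \<le> (\<Sum>i<?M. ?F (Suc i mod ?M) i)"
    by (intro sum_mono2) (auto intro: F0)
  finally have "real (?M - 2) \<le> (\<Sum>i<?M. ?F i (Suc i mod ?M)) + (\<Sum>i<?M. ?F (Suc i mod ?M) i)" by simp
  moreover have "real (?M - 2) = 2 ^ m - 2" using M2 by (simp add: of_nat_diff)
  moreover have "hard m k 0 (\<lambda>u v. err c u v (q u)) = ((\<Sum>i<?M. ?F i (Suc i mod ?M)) + (\<Sum>i<?M. ?F (Suc i mod ?M) i)) / (2 * 2 ^ m)"
    by (simp add: sum.distrib)
  ultimately have "(2 ^ m - 2) / (2 * 2 ^ m) \<le> hard m k 0 (\<lambda>u v. err c u v (q u))"
    by (simp only: divide_right_mono)
  then show ?thesis by (simp add: diff_divide_distrib)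
qed

section \<open>Information in the first message\<close>

text \<open>A uniform superposition over the suffixes in the control register. Tracing out that
  register averages over the suffixes, so this is a purification of the averaged state
  \<open>avg_red\<close>.\<close>

definition tagged :: "nat \<Rightarrow> (bool list \<Rightarrow> 'm mem \<Rightarrow> 'm mem \<Rightarrow> complex) \<Rightarrow> 'm mem \<Rightarrow> 'm mem \<Rightarrow> complex" where
  "tagged r \<xi> c y = (case y of Ctrl s a \<Rightarrow> of_real (1 / sqrt (2 ^ r)) * \<xi> s c a | _ \<Rightarrow> 0)"

definition avg_red :: "'m mem set \<Rightarrow> nat \<Rightarrow> (bool list \<Rightarrow> 'm mem \<Rightarrow> 'm mem \<Rightarrow> complex) \<Rightarrow> 'm mem \<Rightarrow> 'm mem \<Rightarrow> complex" where
  "avg_red A r \<xi> = red (ctrl (inputs r) A {}) (tagged r \<xi>)"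

lemma tagged_simps [simp]:
  "tagged r \<xi> c (Ctrl s a) = of_real (1 / sqrt (2 ^ r)) * \<xi> s c a"
  "tagged r \<xi> c (Junk j) = 0"
  by (simp_all add: tagged_def)

lemma tag_weight: "(cmod (complex_of_real (1 / sqrt (2 ^ r))))^2 = 1 / 2 ^ r"
  by (simp add: norm_divide power_divide norm_power)

lemma qf_avg_red:
  assumes "finite A"
  shows "qf C (avg_red A r \<xi>) z = avg r (\<lambda>s. qf C (red A (\<xi> s)) z)"
  using assms unfolding avg_red_def qf_red
  by (simp add: sum_ctrl ip_scale_right norm_mult power_mult_distrib tag_weight avg_def sum_divide_distrib power_divide
      del: of_real_divide)

lemma nsq2_tagged:
  assumes "finite A" "finite J"
  shows "nsq2 C (ctrl (inputs r) A J) (tagged r \<xi>) = avg r (\<lambda>s. nsq2 C A (\<xi> s))"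
proof -
  have "nsq2 C (ctrl (inputs r) A J) (tagged r \<xi>) = (\<Sum>c\<in>C. \<Sum>s\<in>inputs r. \<Sum>a\<in>A. (cmod (\<xi> s c a))^2 / 2 ^ r)"
    using assms by (simp add: nsq2_def sum_ctrl norm_mult power_mult_distrib tag_weight power_divide del: of_real_divide)
  also have "... = (\<Sum>s\<in>inputs r. \<Sum>c\<in>C. \<Sum>a\<in>A. (cmod (\<xi> s c a))^2 / 2 ^ r)"
    by (rule sum.swap)
  finally show ?thesis by (simp add: avg_def nsq2_def sum_divide_distrib)
qed

lemma psd_avg_red: "psd C (avg_red A r \<xi>)"
  unfolding avg_red_def by (rule psd_red)

lemma herm_avg_red: "herm C (avg_red A r \<xi>)"
  using psd_avg_red unfolding psd_def by blast

lemma trace_avg_red: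
  "finite A \<Longrightarrow> trace_on C (avg_red A r \<xi>) = avg r (\<lambda>s. nsq2 C A (\<xi> s))"
  unfolding avg_red_def trace_red by (rule nsq2_tagged) simp_all

lemma avg_member_le:
  assumes "u \<in> inputs n" "\<And>x. x \<in> inputs n \<Longrightarrow> 0 \<le> F x"
  shows "F u \<le> 2 ^ n * avg n F"
  unfolding avg_def using member_le_sum[of u "inputs n" F] assms by simp

text \<open>In the following, \<open>\<xi> x\<close> is the state after the first message on input \<open>x\<close>, and \<open>\<rho> r w\<close> is the
  reduced state of the recipient for prefix \<open>w\<close>, averaged over the remaining \<open>r\<close> bits.\<close>

locale first_round =
  fixes A A' B :: "'m mem set" and M :: "'m set" and G :: "'m gate" and \<psi> :: "'m mem \<Rightarrow> 'm mem \<Rightarrow> complex"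
    and N k :: nat
  assumes fin: "finite A" "finite A'" "finite B" "finite M"
    and M_ne: "M \<noteq> {}"
    and G: "\<And>x. x \<in> inputs (N * k) \<Longrightarrow> isom (A' \<times> M) A (G x)"
    and unit: "nsq2 A B \<psi> = 1"
begin

definition C :: "'m mem set" where "C = recv M B"

definition \<xi> :: "bool list \<Rightarrow> 'm mem \<Rightarrow> 'm mem \<Rightarrow> complex" where
  "\<xi> x = step_state A (G x) \<psi>"

definition \<rho> :: "nat \<Rightarrow> bool list \<Rightarrow> 'm mem \<Rightarrow> 'm mem \<Rightarrow> complex" where
  "\<rho> r w = avg_red A' r (\<lambda>s. \<xi> (w @ s))"

lemma finC: "finite C" using fin by (simp add: C_def)

lemma nsq2_\<xi>: "x \<in> inputs (N * k) \<Longrightarrow> nsq2 C A' (\<xi> x) = 1"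
  unfolding C_def \<xi>_def by (simp add: nsq2_step_state[OF fin(1) G] unit)

lemma trace_\<rho>: "w \<in> inputs l \<Longrightarrow> l + r = N * k \<Longrightarrow> trace_on C (\<rho> r w) = 1"
proof -
  assume w: "w \<in> inputs l" "l + r = N * k"
  have "avg r (\<lambda>s. nsq2 C A' (\<xi> (w @ s))) = avg r (\<lambda>_. 1)"
    using w by (intro avg_cong nsq2_\<xi>) (simp add: inputs_def)
  then show ?thesis by (simp add: \<rho>_def trace_avg_red fin)
qed

lemma psd_\<rho>: "psd C (\<rho> r w)"
  unfolding \<rho>_def by (rule psd_avg_red)

lemma qf_\<rho>_nonneg: "0 \<le> qf C (\<rho> r w) z"
  using psd_\<rho> unfolding psd_def by blast

lemma qf_\<rho>_append: "qf C (\<rho> (l + r) w) z = avg l (\<lambda>u. qf C (\<rho> r (w @ u)) z)"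
  by (simp add: \<rho>_def qf_avg_red fin avg_append)

definition \<Delta> :: "nat \<Rightarrow> bool list \<Rightarrow> bool list \<Rightarrow> real" where
  "\<Delta> r w u = nsq2 C C (\<lambda>c a. canon C (\<rho> r (w @ u)) c a - canon C (\<rho> (N + r) w) c a)"

text \<open>Cross entropy is linear in its first argument and \<tau> is the average of the states
  for the different blocks \<open>u\<close>, so the mean relative entropy collapses to a difference
  of negative entropies.\<close>

lemma information_gain:
  assumes w: "w \<in> inputs l" and l: "l + (N + r) = N * k"
  shows "avg N (\<Delta> r w) \<le> avg N (\<lambda>u. eta C (\<rho> r (w @ u))) - eta C (\<rho> (N + r) w)"
proof -
  let ?\<tau> = "\<rho> (N + r) w"
  have "\<Delta> r w u \<le> eta C (\<rho> r (w @ u)) - cross C (\<rho> r (w @ u)) ?\<tau>" if u: "u \<in> inputs N" for u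
  proof -
    have "w @ u \<in> inputs (l + N)" using w u by (rule inputs_append)
    then have t: "trace_on C (\<rho> r (w @ u)) = 1" using l by (intro trace_\<rho>) auto
    have t': "trace_on C ?\<tau> = 1" using w l by (rule trace_\<rho>)
    \<comment> \<open>\<tau> contains each of these states with weight \<open>1 / 2 ^ N\<close>. So
      large a constant is harmless, because it does not enter the bound of
      \<open>relative_entropy_ge\<close>.\<close>
    have dom: "qf C (\<rho> r (w @ u)) z \<le> 2 ^ N * qf C ?\<tau> z" for z
      unfolding qf_\<rho>_append using u by (rule avg_member_le) (rule qf_\<rho>_nonneg)
    show ?thesis
      using relative_entropy_ge[OF finC psd_\<rho> psd_\<rho> dom] unfolding t t' \<Delta>_def by simp
  qed
  then have "avg N (\<Delta> r w) \<le> avg N (\<lambda>u. eta C (\<rho> r (w @ u)) - cross C (\<rho> r (w @ u)) ?\<tau>)"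
    by (rule avg_mono)
  also have "... = avg N (\<lambda>u. eta C (\<rho> r (w @ u))) - avg N (\<lambda>u. cross C (\<rho> r (w @ u)) ?\<tau>)"
    by (rule avg_diff)
  also have "avg N (\<lambda>u. cross C (\<rho> r (w @ u)) ?\<tau>) = cross C ?\<tau> ?\<tau>"
    unfolding cross_def avg_sum qf_\<rho>_append[symmetric]
    by (intro sum.cong refl) (simp add: qf_\<rho>_append avg_cmult[symmetric] mult.commute)
  also have "... = eta C ?\<tau>" by (rule cross_self[OF finC]) (simp add: \<rho>_def herm_avg_red)
  finally show ?thesis .
qed

text \<open>The maximally mixed message, tensored with the recipient's state before the message.\<close>

definition \<sigma> :: "'m mem \<Rightarrow> 'm mem \<Rightarrow> complex" where
  "\<sigma> = red (M \<times> A) (\<lambda>c (m, a). case c of Recv m' b \<Rightarrow> of_bool (m = m') * \<psi> a b / of_real (sqrt (card M)) | _ \<Rightarrow> 0)"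

lemma card_M: "real (card M) > 0"
  using fin M_ne by (simp add: card_gt_0_iff)

lemma qf_\<sigma>: "card M * qf C \<sigma> z = (\<Sum>m\<in>M. nsq A (\<lambda>a. \<Sum>b\<in>B. cnj (z (Recv m b)) * \<psi> a b))"
proof -
  have ip: "ip C z (\<lambda>c. case c of Recv m' b \<Rightarrow> of_bool (m = m') * \<psi> a b / of_real (sqrt (card M)) | _ \<Rightarrow> 0) =
     (\<Sum>b\<in>B. cnj (z (Recv m b)) * \<psi> a b) / of_real (sqrt (card M))" if "m \<in> M" for m a
  proof -
    have "ip C z (\<lambda>c. case c of Recv m' b \<Rightarrow> of_bool (m = m') * \<psi> a b / of_real (sqrt (card M)) | _ \<Rightarrow> 0) =
      (\<Sum>m'\<in>M. if m' = m then (\<Sum>b\<in>B. cnj (z (Recv m b)) * \<psi> a b / of_real (sqrt (card M))) else 0)"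
      unfolding ip_def C_def sum_recv by (intro sum.cong refl) auto
    then show ?thesis using fin that by (simp add: sum_divide_distrib)
  qed
  have "qf C \<sigma> z = (\<Sum>m\<in>M. \<Sum>a\<in>A. (cmod ((\<Sum>b\<in>B. cnj (z (Recv m b)) * \<psi> a b) / of_real (sqrt (card M))))^2)"
    unfolding \<sigma>_def qf_red sum.cartesian_product[symmetric]
    by (simp add: sum.cartesian_product case_prod_unfold)
       (intro sum.cong refl, auto simp: ip[symmetric] case_prod_unfold)
  also have "... = (\<Sum>m\<in>M. nsq A (\<lambda>a. \<Sum>b\<in>B. cnj (z (Recv m b)) * \<psi> a b)) / card M"
    by (simp only: norm_divide power_divide nsq_def sum_divide_distrib[symmetric] norm_of_real) simp
  finally show ?thesis using card_M by simp
qed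

lemma trace_\<sigma>: "trace_on C \<sigma> = 1"
proof -
  have "trace_on C \<sigma> = (\<Sum>m'\<in>M. \<Sum>b\<in>B. \<Sum>m\<in>M. \<Sum>a\<in>A. of_bool (m = m') * (cmod (\<psi> a b))^2 / card M)"
    unfolding \<sigma>_def trace_red nsq2_def C_def sum_recv
    by (intro sum.cong refl)
       (auto simp: sum.cartesian_product case_prod_unfold norm_mult norm_divide power_mult_distrib power_divide
         of_bool_def intro!: sum.cong)
  also have "... = (\<Sum>m'\<in>M. \<Sum>b\<in>B. \<Sum>m\<in>M. if m = m' then \<Sum>a\<in>A. (cmod (\<psi> a b))^2 / card M else 0)"
    by (intro sum.cong refl) auto
  also have "... = (\<Sum>m'\<in>M. \<Sum>b\<in>B. \<Sum>a\<in>A. (cmod (\<psi> a b))^2 / card M)"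
    using fin by simp
  also have "... = nsq2 A B \<psi>"
    using card_M by (simp add: nsq2_swap nsq_def sum_divide_distrib[symmetric])
  finally show ?thesis by (simp add: unit)
qed

lemma sum_sq_le:
  fixes f :: "'x \<Rightarrow> complex"
  assumes "finite S" shows "(cmod (\<Sum>m\<in>S. f m))^2 \<le> card S * (\<Sum>m\<in>S. (cmod (f m))^2)"
proof -
  have "(cmod (\<Sum>m\<in>S. f m))^2 \<le> (\<Sum>m\<in>S. \<bar>1\<bar> * \<bar>cmod (f m)\<bar>)^2"
    by (intro power_mono) (auto intro: norm_sum)
  also have "... \<le> (L2_set (\<lambda>_. 1) S * L2_set (\<lambda>m. cmod (f m)) S)^2"
    by (intro power_mono L2_set_mult_ineq sum_nonneg) auto
  also have "... = card S * (\<Sum>m\<in>S. (cmod (f m))^2)"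
    by (simp add: L2_set_def power_mult_distrib sum_nonneg)
  finally show ?thesis .
qed

text \<open>One factor \<open>card M\<close> comes from Cauchy-Schwarz over the message values, the
  other from the normalisation of \<sigma>. In between, each message value is treated separately,
  and extending its sum to all of \<open>A' \<times> M\<close> lets the isometry cancel.\<close>

lemma dominated:
  assumes x: "x \<in> inputs (N * k)"
  shows "qf C (red A' (\<xi> x)) z \<le> (card M)^2 * qf C \<sigma> z"
proof -
  define g where "g = (\<lambda>m a. \<Sum>b\<in>B. cnj (z (Recv m b)) * \<psi> a b)"
  have ip: "ip C z (\<lambda>c. \<xi> x c a') = (\<Sum>m\<in>M. \<Sum>a\<in>A. G x (a', m) a * g m a)" for a'
    unfolding ip_def C_def sum_recv \<xi>_def step_state_Recv g_def sum_distrib_left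
    by (rule sum.cong[OF refl], subst sum.swap, simp add: mult_ac)
  have "qf C (red A' (\<xi> x)) z \<le> (\<Sum>a'\<in>A'. card M * (\<Sum>m\<in>M. (cmod (\<Sum>a\<in>A. G x (a', m) a * g m a))^2))"
    unfolding qf_red ip by (intro sum_mono sum_sq_le fin)
  also have "... = card M * (\<Sum>m\<in>M. \<Sum>a'\<in>A'. (cmod (\<Sum>a\<in>A. G x (a', m) a * g m a))^2)"
    by (simp add: sum_distrib_left[symmetric]) (rule disjI2, rule sum.swap)
  also have "... \<le> card M * (\<Sum>m\<in>M. nsq (A' \<times> M) (\<lambda>y. \<Sum>a\<in>A. G x y a * g m a))"
  proof (intro mult_left_mono sum_mono)
    fix m assume m: "m \<in> M"
    have "(\<Sum>a'\<in>A'. (cmod (\<Sum>a\<in>A. G x (a', m) a * g m a))^2) =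
        (\<Sum>y\<in>(\<lambda>a'. (a', m)) ` A'. (cmod (\<Sum>a\<in>A. G x y a * g m a))^2)"
      by (subst sum.reindex) (auto simp: inj_on_def)
    also have "... \<le> nsq (A' \<times> M) (\<lambda>y. \<Sum>a\<in>A. G x y a * g m a)"
      unfolding nsq_def using m fin by (intro sum_mono2) auto
    finally show "(\<Sum>a'\<in>A'. (cmod (\<Sum>a\<in>A. G x (a', m) a * g m a))^2) \<le> nsq (A' \<times> M) (\<lambda>y. \<Sum>a\<in>A. G x y a * g m a)" .
  qed simp
  also have "... = card M * (\<Sum>m\<in>M. nsq A (g m))"
    by (simp add: isom_nsq[OF fin(1) G[OF x]])
  also have "... = (card M)^2 * qf C \<sigma> z"
    using qf_\<sigma>[of z] by (simp add: g_def power2_eq_square)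
  finally show ?thesis .
qed

text \<open>The mean relative entropy to \<sigma> exceeds the left-hand side by the relative entropy
  of the average state to \<sigma>, which is nonnegative; and each single one is at most
  \<open>ln ((card M)^2)\<close> by \<open>dominated\<close>.\<close>

lemma information_bound:
  "avg (N * k) (\<lambda>x. eta C (\<rho> 0 x)) - eta C (\<rho> (N * k) []) \<le> 2 * ln (card M)"
proof -
  have K: "real ((card M)^2) > 0" using card_M by simp
  have psd\<sigma>: "psd C \<sigma>" unfolding \<sigma>_def by (rule psd_red)
  have dom: "qf C (\<rho> 0 x) z \<le> (card M)^2 * qf C \<sigma> z" if "x \<in> inputs (N * k)" for x z
    using dominated[OF that, of z] by (simp add: \<rho>_def qf_avg_red fin avg_def inputs_def)
  have dom0: "qf C (\<rho> (N * k) []) z \<le> (card M)^2 * qf C \<sigma> z" for z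
  proof -
    have "qf C (\<rho> (N * k) []) z = avg (N * k) (\<lambda>x. qf C (\<rho> 0 x) z)"
      using qf_\<rho>_append[of "N * k" 0 "[]" z] by simp
    also have "... \<le> avg (N * k) (\<lambda>_. (card M)^2 * qf C \<sigma> z)" by (intro avg_mono dom)
    finally show ?thesis by simp
  qed
  have "eta C (\<rho> 0 x) - cross C (\<rho> 0 x) \<sigma> \<le> ln ((card M)^2)" if x: "x \<in> inputs (N * k)" for x
    using relative_entropy_le[OF finC psd_\<rho> psd\<sigma> K dom[OF x]] trace_\<rho>[OF x, of 0] by simp
  then have "avg (N * k) (\<lambda>x. eta C (\<rho> 0 x) - cross C (\<rho> 0 x) \<sigma>) \<le> avg (N * k) (\<lambda>_. ln ((card M)^2))"
    by (rule avg_mono)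
  then have "avg (N * k) (\<lambda>x. eta C (\<rho> 0 x)) - avg (N * k) (\<lambda>x. cross C (\<rho> 0 x) \<sigma>) \<le> 2 * ln (card M)"
    using card_M by (simp add: avg_diff ln_realpow)
  moreover have "avg (N * k) (\<lambda>x. cross C (\<rho> 0 x) \<sigma>) = cross C (\<rho> (N * k) []) \<sigma>"
    unfolding cross_def avg_sum
  proof (intro sum.cong refl)
    fix j
    show "avg (N * k) (\<lambda>x. qf C (\<rho> 0 x) (eigvec C \<sigma> j) * ln (eigval C \<sigma> j)) =
        qf C (\<rho> (N * k) []) (eigvec C \<sigma> j) * ln (eigval C \<sigma> j)"
      using qf_\<rho>_append[of "N * k" 0 "[]" "eigvec C \<sigma> j"]
        avg_cmult[of "N * k" "ln (eigval C \<sigma> j)" "\<lambda>x. qf C (\<rho> 0 x) (eigvec C \<sigma> j)"] by (simp add: mult.commute)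
  qed
  moreover have "0 \<le> eta C (\<rho> (N * k) []) - cross C (\<rho> (N * k) []) \<sigma>"
  proof -
    have "trace_on C (\<rho> (N * k) []) = 1" by (rule trace_\<rho>[of _ 0]) (simp_all add: inputs_def)
    then show ?thesis
      using relative_entropy_ge[OF finC psd_\<rho> psd\<sigma> dom0] nsq2_nonneg[of C C] trace_\<sigma>
      by (smt (verit, best))
  qed
  ultimately show ?thesis by linarith
qed

lemma total_information:
  "(\<Sum>i<k. avg (i * N) (\<lambda>w. avg N (\<Delta> ((k - 1 - i) * N) w))) \<le> 2 * ln (card M)"
proof -
  \<comment> \<open>The mean negative entropy once \<open>i\<close> blocks are known. Its increments
    bound the information in block \<open>i\<close>, so the chain rule is a telescoping sum.\<close>
  define H where "H = (\<lambda>i. avg (i * N) (\<lambda>w. eta C (\<rho> ((k - i) * N) w)))"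
  have "avg (i * N) (\<lambda>w. avg N (\<Delta> ((k - 1 - i) * N) w)) \<le> H (Suc i) - H i" if i: "i < k" for i
  proof -
    let ?r = "(k - 1 - i) * N"
    have r: "(k - i) * N = N + ?r" using i by (cases k) (auto simp: Suc_diff_le)
    have "avg (i * N) (\<lambda>w. avg N (\<Delta> ?r w)) \<le>
       avg (i * N) (\<lambda>w. avg N (\<lambda>u. eta C (\<rho> ?r (w @ u))) - eta C (\<rho> (N + ?r) w))"
      by (intro avg_mono information_gain) (use block_length[OF i] in auto)
    also have "... = avg (i * N + N) (\<lambda>x. eta C (\<rho> ?r x)) - H i"
      by (simp add: avg_diff avg_append H_def r)
    also have "avg (i * N + N) (\<lambda>x. eta C (\<rho> ?r x)) = H (Suc i)"
      by (simp add: H_def add.commute)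
    finally show ?thesis .
  qed
  then have "(\<Sum>i<k. avg (i * N) (\<lambda>w. avg N (\<Delta> ((k - 1 - i) * N) w))) \<le> (\<Sum>i<k. H (Suc i) - H i)"
    by (intro sum_mono) auto
  also have "... = H k - H 0" by (rule sum_lessThan_telescope)
  also have "... = avg (N * k) (\<lambda>x. eta C (\<rho> 0 x)) - eta C (\<rho> (N * k) [])"
    by (simp add: H_def mult.commute avg_def[of 0] inputs_def)
  also note information_bound
  finally show ?thesis .
qed

end

section \<open>Round elimination\<close>

text \<open>With \<open>le_sqrt_AM\<close> this replaces Jensen's inequality for the square root: a
  linear majorant passes through all nested averages, and \<open>e\<close> is optimised at the
  end.\<close>

lemma sqrt_le_AM: "0 \<le> x \<Longrightarrow> e > 0 \<Longrightarrow> sqrt x \<le> (x / e + e) / 2"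
proof -
  assume x: "0 \<le> x" and e: "e > 0"
  have "0 \<le> (sqrt x - e)^2" by simp
  then have "2 * (sqrt x * e) \<le> x + e * e" using x by (simp add: power2_eq_square algebra_simps)
  then show ?thesis using e by (simp add: field_simps)
qed

lemma le_sqrt_AM:
  assumes D: "0 \<le> D" and X: "\<And>e. e > 0 \<Longrightarrow> X \<le> (D / e + e) / 2"
  shows "X \<le> sqrt D"
proof (cases "D = 0")
  case True
  have "X \<le> 0 + e" if "e > 0" for e using X[OF that] that True by simp
  then show ?thesis using True field_le_epsilon[of X 0] by simp
next
  case False
  then have "D > 0" using D by simp
  then show ?thesis using X[of "sqrt D"] by (simp add: real_div_sqrt)
qed

context first_round
begin

lemma average_loss:
  assumes k: "k \<ge> 1"
  shows "(\<Sum>i<k. avg (i * N) (\<lambda>w. avg N (\<lambda>u. sqrt (\<Delta> ((k - 1 - i) * N) w u)))) / k \<le> sqrt (2 * ln (card M) / k)"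
proof (rule le_sqrt_AM)
  show "0 \<le> 2 * ln (card M) / k" using card_M by simp
next
  fix e :: real assume e: "e > 0"
  have "(\<Sum>i<k. avg (i * N) (\<lambda>w. avg N (\<lambda>u. sqrt (\<Delta> ((k - 1 - i) * N) w u)))) \<le>
     (\<Sum>i<k. avg (i * N) (\<lambda>w. avg N (\<lambda>u. (\<Delta> ((k - 1 - i) * N) w u / e + e) / 2)))"
    by (intro sum_mono avg_mono sqrt_le_AM e) (simp add: \<Delta>_def)
  also have "... = (\<Sum>i<k. (avg (i * N) (\<lambda>w. avg N (\<Delta> ((k - 1 - i) * N) w)) / e + e) / 2)"
    by (simp add: avg_divide avg_add)
  also have "... = ((\<Sum>i<k. avg (i * N) (\<lambda>w. avg N (\<Delta> ((k - 1 - i) * N) w))) / e + k * e) / 2"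
    by (simp add: sum_divide_distrib[symmetric] sum.distrib)
  also have "... \<le> (2 * ln (card M) / e + k * e) / 2"
    using total_information e by (intro divide_right_mono add_right_mono) auto
  finally show "(\<Sum>i<k. avg (i * N) (\<lambda>w. avg N (\<lambda>u. sqrt (\<Delta> ((k - 1 - i) * N) w u)))) / k \<le>
      (2 * ln (card M) / k / e + e) / 2"
    using k e by (simp add: field_simps)
qed

text \<open>The new protocol starts from the purification for a random block, and the sender applies
  \<open>V u\<close> to turn it nearly into the true state \<open>X u\<close>. The deviation is the
  square root of \<Delta>; the factor 2 is the sum of the norms of two unit vectors in
  \<open>acc_lipschitz\<close>.\<close>

lemma round_elimination:
  assumes i: "i < k" and w: "w \<in> inputs (i * N)" and s': "s' \<in> inputs ((k - 1 - i) * N)"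
    and N: "N = m * k ^ j" and m: "m \<ge> 1"
    and p: "wf_prot (N * k) p C A'" "msgs p \<noteq> []"
    and IH: "\<And>p' \<phi>. wf_prot N p' C C \<Longrightarrow> msgs p' = msgs p \<Longrightarrow> nsq2 C C \<phi> = 1 \<Longrightarrow>
        \<beta> \<le> hard m k j (\<lambda>u v. err (\<not> c) u v (acc p' C C u v \<phi>))"
  shows "\<beta> - 2 * avg N (\<lambda>u. sqrt (\<Delta> ((k - 1 - i) * N) w u)) \<le>
     avg ((k - 1 - i) * N) (\<lambda>s. hard m k j (\<lambda>u v. err c (w @ u @ s) (w @ v @ s')
       (acc (Step M A' G p) A B (w @ u @ s) (w @ v @ s') \<psi>)))"
proof -
  define r where "r = (k - 1 - i) * N"
  define \<tau> where "\<tau> = \<rho> (N + r) w"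
  define \<phi> where "\<phi> = canon C \<tau>"
  define D where "D = ctrl (inputs r) A' C"
  define f where "f = (\<lambda>v. w @ v @ s')"
  define g where "g = (\<lambda>u s. w @ u @ s)"
  define X where "X = (\<lambda>u. tagged r (\<lambda>s. \<xi> (w @ u @ s)))"
  \<comment> \<open>The recipient appends the fixed \<open>s'\<close>; the sender reads a suffix off
    the control register, so one run covers the average over all \<open>s\<close>.\<close>
  define p1 where "p1 = lift f g (inputs r) p True C"
  have len: "i * N + (N + r) = N * k" unfolding r_def by (rule block_length[OF i])
  have in_f: "f v \<in> inputs (N * k)" if "v \<in> inputs N" for v
    unfolding f_def using i w that s' by (rule block_inputs)
  have in_g: "g u s \<in> inputs (N * k)" if "u \<in> inputs N" "s \<in> inputs r" for u s
    unfolding g_def using i w that unfolding r_def by (rule block_inputs)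
  have in_wu: "w @ u \<in> inputs (i * N + N)" if "u \<in> inputs N" for u
    using w that by (rule inputs_append)
  have finD: "finite D" using fin finC by (simp add: D_def)
  have wf1: "wf_prot N p1 C D"
    unfolding p1_def D_def using wf_prot_lift[of N f "N * k" "inputs r" g p C A' C] in_f in_g p fin finC by auto
  have "\<exists>V. isom D C V \<and> (\<forall>c\<in>C. \<forall>d\<in>D. (\<Sum>a\<in>C. V d a * canon C (\<rho> r (w @ u)) c a) = X u c d)" for u
  proof -
    have DJ: "D = ctrl (inputs r) A' {} \<union> Junk ` C" by (auto simp: D_def ctrl_def)
    have "\<exists>V. isom (ctrl (inputs r) A' {} \<union> Junk ` C) C V \<and>
       (\<forall>c\<in>C. \<forall>d\<in>ctrl (inputs r) A' {}. (\<Sum>a\<in>C. V d a * canon C (\<rho> r (w @ u)) c a) = X u c d) \<and>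
       (\<forall>c\<in>C. \<forall>d\<in>Junk ` C. (\<Sum>a\<in>C. V d a * canon C (\<rho> r (w @ u)) c a) = 0)"
      by (rule polar[OF finC]) (use fin in \<open>auto simp: inj_on_def ctrl_def \<rho>_def avg_red_def X_def\<close>)
    then show ?thesis unfolding DJ by (force simp: X_def)
  qed
  then obtain V where V: "\<And>u. isom D C (V u)"
    and VX: "\<And>u c d. c \<in> C \<Longrightarrow> d \<in> D \<Longrightarrow> (\<Sum>a\<in>C. V u d a * canon C (\<rho> r (w @ u)) c a) = X u c d"
    by metis
  define p' where "p' = merge D V p1"
  have wf': "wf_prot N p' C C" unfolding p'_def using wf1 finD V by (intro wf_prot_merge)
  have msgs': "msgs p' = msgs p" by (simp add: p'_def p1_def)
  have \<phi>1: "nsq2 C C \<phi> = 1"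
    unfolding \<phi>_def \<tau>_def nsq2_canon[OF finC psd_\<rho>] using w len by (rule trace_\<rho>)
  have X1: "nsq2 C D (X u) = 1" if u: "u \<in> inputs N" for u
  proof -
    have "nsq2 C D (X u) = avg r (\<lambda>s. nsq2 C A' (\<xi> (g u s)))"
      unfolding X_def D_def using fin finC by (simp add: nsq2_tagged g_def)
    also have "... = avg r (\<lambda>_. 1)" by (intro avg_cong nsq2_\<xi> in_g u)
    finally show ?thesis by simp
  qed
  have Viso: "nsq2 C D (\<lambda>c d. \<Sum>a\<in>C. V u d a * \<delta> c a) = nsq2 C C \<delta>" for u \<delta>
    unfolding nsq2_def nsq_def[symmetric] by (simp add: isom_nsq[OF finC V])
  have key: "err c u v (acc p' C C v u \<phi>) - 2 * sqrt (\<Delta> r w u) \<le>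
      avg r (\<lambda>s. err c (w @ u @ s) (w @ v @ s') (acc (Step M A' G p) A B (w @ u @ s) (w @ v @ s') \<psi>))"
    if uv: "u \<in> inputs N" "v \<in> inputs N" "u \<noteq> v" for u v
  proof -
    let ?V = "\<lambda>c d. \<Sum>a\<in>C. V u d a * \<phi> c a"
    have "avg r (\<lambda>s. err c (w @ u @ s) (w @ v @ s') (acc (Step M A' G p) A B (w @ u @ s) (w @ v @ s') \<psi>)) =
       avg r (\<lambda>s. err c u v (acc p C A' (f v) (g u s) (\<xi> (g u s))))"
      using uv s' by (intro avg_cong) (simp add: err_def GT_fun_block inputs_def r_def C_def \<xi>_def f_def g_def)
    also have "... = err c u v (avg r (\<lambda>s. acc p C A' (f v) (g u s) (\<xi> (g u s))))"
      by (rule err_avg)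
    also have "avg r (\<lambda>s. acc p C A' (f v) (g u s) (\<xi> (g u s))) = acc p1 C D v u (X u)"
    proof -
      have "acc p1 C D v u (X u) = (cmod (complex_of_real (1 / sqrt (2 ^ r))))^2 *
          (\<Sum>s\<in>inputs r. acc p C A' (f v) (g u s) (\<xi> (g u s)))"
        unfolding p1_def D_def X_def
        by (rule acc_lift[THEN conjunct1, rule_format]) (use fin finC p in \<open>simp_all add: g_def del: of_real_divide\<close>)
      then show ?thesis unfolding tag_weight by (simp add: avg_def)
    qed
    finally have eq: "avg r (\<lambda>s. err c (w @ u @ s) (w @ v @ s') (acc (Step M A' G p) A B (w @ u @ s) (w @ v @ s') \<psi>)) =
       err c u v (acc p1 C D v u (X u))" .
    have m': "acc p' C C v u \<phi> = acc p1 C D v u ?V"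
      unfolding p'_def using wf1 finC finD V p by (intro acc_merge) (auto simp: p1_def)
    have "\<bar>acc p1 C D v u ?V - acc p1 C D v u (X u)\<bar> \<le>
       sqrt (nsq2 C D (\<lambda>c d. ?V c d - X u c d)) * (sqrt (nsq2 C D ?V) + sqrt (nsq2 C D (X u)))"
      by (rule acc_lipschitz[OF wf1 finC finD uv(2,1)])
    also have "nsq2 C D ?V = 1" by (simp add: Viso \<phi>1)
    also have "nsq2 C D (X u) = 1" by (rule X1[OF uv(1)])
    also have "nsq2 C D (\<lambda>c d. ?V c d - X u c d) = nsq2 C D (\<lambda>c d. \<Sum>a\<in>C. V u d a * (\<phi> c a - canon C (\<rho> r (w @ u)) c a))"
      unfolding nsq2_def by (intro sum.cong refl) (simp add: VX[symmetric] right_diff_distrib sum_subtractf)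
    also have "... = \<Delta> r w u"
      unfolding Viso unfolding nsq2_def \<Delta>_def \<phi>_def \<tau>_def by (intro sum.cong refl) (simp add: norm_minus_commute)
    finally have "\<bar>acc p1 C D v u ?V - acc p1 C D v u (X u)\<bar> \<le> 2 * sqrt (\<Delta> r w u)" by simp
    then show ?thesis
      unfolding eq m' using err_diff[of c u v "acc p1 C D v u ?V" "acc p1 C D v u (X u)"] by linarith
  qed
  \<comment> \<open>In \<open>p'\<close> the recipient moves first, so the hypothesis is applied to
    the complementary problem; the symmetry of \<open>hard\<close> and \<open>err_swap\<close>
    restore the original order.\<close>
  have "\<beta> \<le> hard m k j (\<lambda>u v. err (\<not> c) u v (acc p' C C u v \<phi>))"
    by (rule IH[OF wf' msgs' \<phi>1])
  also have "... = hard m k j (\<lambda>u v. err (\<not> c) v u (acc p' C C v u \<phi>))"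
    by (rule hard_swap[symmetric])
  also have "... = hard m k j (\<lambda>u v. err c u v (acc p' C C v u \<phi>))"
    using m by (rule hard_cong) (simp add: err_swap inputs_def)
  finally have "\<beta> - 2 * avg N (\<lambda>u. sqrt (\<Delta> r w u)) \<le>
      hard m k j (\<lambda>u v. err c u v (acc p' C C v u \<phi>)) - hard m k j (\<lambda>u v. 2 * sqrt (\<Delta> r w u))"
    using hard_fst[of k m j "\<lambda>u. 2 * sqrt (\<Delta> r w u)"] i by (simp add: N avg_cmult)
  also have "... = hard m k j (\<lambda>u v. err c u v (acc p' C C v u \<phi>) - 2 * sqrt (\<Delta> r w u))"
    by (rule hard_diff[symmetric])
  also have "... \<le> hard m k j (\<lambda>u v. avg r (\<lambda>s. err c (w @ u @ s) (w @ v @ s')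
      (acc (Step M A' G p) A B (w @ u @ s) (w @ v @ s') \<psi>)))"
    by (rule hard_mono[OF m]) (rule key, simp_all add: N)
  also have "... = avg r (\<lambda>s. hard m k j (\<lambda>u v. err c (w @ u @ s) (w @ v @ s')
      (acc (Step M A' G p) A B (w @ u @ s) (w @ v @ s') \<psi>)))"
    by (rule hard_avg)
  finally show ?thesis unfolding r_def .
qed

end

text \<open>Of the \<open>Suc j\<close> steps the last is the output gate, whose message costs
  nothing. The Boolean \<open>c\<close> is general because it flips with every eliminated
  round.\<close>

theorem hard_lower_bound:
  assumes m: "m \<ge> 1" and k: "k \<ge> 1"
    and "wf_prot (m * k ^ j) p A B" "finite A" "finite B" "nsq2 A B \<psi> = 1" "length (msgs p) = Suc j"
  shows "1 / 2 - 1 / 2 ^ m - (\<Sum>i<j. 2 * sqrt (2 * ln (msgs p ! i) / k)) \<le>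
     hard m k j (\<lambda>u v. err c u v (acc p A B u v \<psi>))"
  using assms(3-)
proof (induction j arbitrary: p A B \<psi> c)
  case 0
  then obtain M A' G Q where p: "p = Step M A' G (Done Q)"
    by (cases p; cases "case p of Step _ _ _ p' \<Rightarrow> p'") auto
  have u0: "replicate m False \<in> inputs m" by (simp add: inputs_def)
  \<comment> \<open>Only the output gate is left, so the mover's input determines the outcome; any
    string can stand for the other one.\<close>
  have ind: "acc p A B u v \<psi> = acc p A B u (replicate m False) \<psi>" for u v by (simp add: p)
  have q: "0 \<le> acc p A B u (replicate m False) \<psi> \<and> acc p A B u (replicate m False) \<psi> \<le> 1" if "u \<in> inputs m" for u
    using acc_le_nsq2[of m p A B u "replicate m False" \<psi>] 0 u0 that by (simp add: acc_nonneg)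
  show ?case
    using hard_zero_communication[OF m q, where c = c] by (subst ind) (simp del: hard.simps)
next
  case (Suc j)
  then obtain M A' G p1 where p: "p = Step M A' G p1" by (cases p) auto
  define N where "N = m * k ^ j"
  have Nk: "m * k ^ Suc j = N * k" by (simp add: N_def mult_ac)
  interpret first_round A A' B M G \<psi> N k
    using Suc.prems[unfolded Nk] by unfold_locales (simp_all add: p)
  have p1: "wf_prot (N * k) p1 C A'" "length (msgs p1) = Suc j" "msgs p1 \<noteq> []"
    using Suc.prems[unfolded Nk] by (auto simp: p C_def)
  define \<beta> where "\<beta> = 1 / 2 - 1 / 2 ^ m - (\<Sum>i<j. 2 * sqrt (2 * ln (msgs p1 ! i) / k))"
  have IH: "\<beta> \<le> hard m k j (\<lambda>u v. err (\<not> c) u v (acc p' C C u v \<phi>))"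
    if "wf_prot N p' C C" "msgs p' = msgs p1" "nsq2 C C \<phi> = 1" for p' \<phi>
    unfolding \<beta>_def that(2)[symmetric]
    by (rule Suc.IH) (use that p1 finC in \<open>simp_all add: N_def\<close>)
  let ?L = "\<lambda>i w. avg N (\<lambda>u. sqrt (\<Delta> ((k - 1 - i) * N) w u))"
  let ?F = "\<lambda>u v. err c u v (acc p A B u v \<psi>)"
  have step: "\<beta> - 2 * avg (i * N) (?L i) \<le>
       avg (i * N) (\<lambda>w. avg ((k - 1 - i) * N) (\<lambda>s. avg ((k - 1 - i) * N) (\<lambda>s'.
         hard m k j (\<lambda>u v. ?F (w @ u @ s) (w @ v @ s')))))" if i: "i < k" for i
  proof -
    let ?r = "(k - 1 - i) * N"
    have "\<beta> - 2 * ?L i w \<le> avg ?r (\<lambda>s. avg ?r (\<lambda>s'. hard m k j (\<lambda>u v. ?F (w @ u @ s) (w @ v @ s'))))"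
      if w: "w \<in> inputs (i * N)" for w
    proof -
      have "avg ?r (\<lambda>_. \<beta> - 2 * ?L i w) \<le> avg ?r (\<lambda>s'. avg ?r (\<lambda>s. hard m k j (\<lambda>u v. ?F (w @ u @ s) (w @ v @ s'))))"
        unfolding p by (intro avg_mono round_elimination i w N_def m p1 IH)
      then show ?thesis by (subst avg_swap) simp
    qed
    then have "avg (i * N) (\<lambda>w. \<beta> - 2 * ?L i w) \<le> avg (i * N) (\<lambda>w. avg ?r (\<lambda>s. avg ?r (\<lambda>s'.
         hard m k j (\<lambda>u v. ?F (w @ u @ s) (w @ v @ s')))))"
      by (rule avg_mono)
    then show ?thesis by (simp add: avg_diff avg_cmult)
  qed
  have "\<beta> - 2 * sqrt (2 * ln (card M) / k) \<le> \<beta> - 2 * ((\<Sum>i<k. avg (i * N) (?L i)) / k)"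
    using average_loss[OF k] by simp
  also have "... = (\<Sum>i<k. \<beta> - 2 * avg (i * N) (?L i)) / k"
    using k by (simp add: sum_subtractf sum_distrib_left[symmetric] field_simps)
  also have "... \<le> hard m k (Suc j) ?F"
    unfolding hard.simps N_def[symmetric] by (intro divide_right_mono sum_mono step) auto
  finally have "\<beta> - 2 * sqrt (2 * ln (card M) / k) \<le> hard m k (Suc j) ?F" .
  moreover have "(\<Sum>i<Suc j. 2 * sqrt (2 * ln (msgs p ! i) / k)) =
      2 * sqrt (2 * ln (card M) / k) + (\<Sum>i<j. 2 * sqrt (2 * ln (msgs p1 ! i) / k))"
    by (subst sum.lessThan_Suc_shift) (simp add: p)
  ultimately show ?case by (simp add: \<beta>_def del: hard.simps)
qed

section \<open>Quantum protocols in the abstract model\<close>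

lemma sum_Pow_Un:
  assumes "A \<inter> B = {}"
  shows "(\<Sum>w\<in>Pow (A \<union> B). f w) = (\<Sum>a\<in>Pow A. \<Sum>b\<in>Pow B. f (a \<union> b))"
proof -
  have "bij_betw (\<lambda>(a, b). a \<union> b) (Pow A \<times> Pow B) (Pow (A \<union> B))"
    by (rule bij_betwI[where g = "\<lambda>w. (w \<inter> A, w \<inter> B)"]) (use assms in auto)
  then show ?thesis
    by (simp add: sum.reindex_bij_betw[symmetric] sum.cartesian_product case_prod_unfold)
qed

definition flip :: "nat set \<Rightarrow> nat set \<Rightarrow> nat set" where
  "flip K z = (z - K) \<union> (K - z)"

lemma bij_flip: "K \<subseteq> H \<Longrightarrow> bij_betw (flip K) (Pow H) (Pow H)"
  by (rule bij_betwI[where g = "flip K"]) (auto simp: flip_def)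

lemma flip_empty [simp]: "flip {} z = z"
  by (simp add: flip_def)

fun strip :: "nat set mem \<Rightarrow> nat set" where
  "strip (Cell z) = z"
| "strip (Recv m b) = m \<union> strip b"
| "strip _ = {}"

lemma turn_Suc_Suc [simp]: "turn p (Suc (Suc i)) = turn p i"
  by (simp add: turn_def)

lemma other_other [simp]: "other (other p) = p"
  by (cases p) auto

lemma turn_Suc: "turn p (Suc i) = other (turn p i)"
  by (simp add: turn_def)

lemma other_neq [simp]: "other p \<noteq> p" "p \<noteq> other p"
  by (cases p; simp)+

lemma all_players: "(\<forall>q. P q) \<longleftrightarrow> P p \<and> P (other p)"
  by (cases p) (metis other.simps player.exhaust)+

lemma encode_subset: "encode qs u \<subseteq> set qs"
  by (auto simp: encode_def dest: set_zip_leftD)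

text \<open>
  The input registers start in state 0, and each player's first gate flips the bits of the input
  before applying the given unitary, so that the initial state does not depend on the inputs.
  \<open>h\<close> pads short inputs.
\<close>

locale quantum_embedding =
  fixes n n' t :: nat and Q :: quantum_protocol and h :: "bool list \<Rightarrow> bool list"
  assumes wf: "wf_quantum n t Q" and t: "t \<ge> 1" and h: "\<And>u. u \<in> inputs n' \<Longrightarrow> h u \<in> inputs n"
begin

definition pl :: "nat \<Rightarrow> player" where "pl i = turn (qstarter Q) i"

text \<open>Empty from \<open>t\<close> on, so that the output gate fits the model as a step with a
  one-element alphabet.\<close>

definition S :: "nat \<Rightarrow> nat set" where "S i = (if i < t then sent Q i else {})"

primrec HO :: "nat \<Rightarrow> nat set \<times> nat set" where
  "HO 0 = (held Q (pl 0) 0, held Q (pl 1) 0)"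
| "HO (Suc i) = (snd (HO i) \<union> S i, fst (HO i) - S i)"

text \<open>\<open>HA i\<close> are the qubits of the player who applies gate \<open>i\<close>, \<open>HB i\<close> those of the other player.\<close>

abbreviation HA :: "nat \<Rightarrow> nat set" where "HA i \<equiv> fst (HO i)"
abbreviation HB :: "nat \<Rightarrow> nat set" where "HB i \<equiv> snd (HO i)"

text \<open>After a gate the mover's memory is renamed to a single cell, whereas the label of the
  other player's memory still separates the message from the older contents; \<open>strip\<close>
  forgets the difference.\<close>

primrec MB :: "nat \<Rightarrow> nat set mem set" where
  "MB 0 = Cell ` Pow (HB 0)"
| "MB (Suc i) = Cell ` Pow (HA i - S i)"

primrec MA :: "nat \<Rightarrow> nat set mem set" where
  "MA 0 = Cell ` Pow (HA 0)"
| "MA (Suc i) = recv (Pow (S i)) (MB i)"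

definition key :: "nat \<Rightarrow> bool list \<Rightarrow> nat set" where
  "key i u = (if i < 2 then encode (inreg Q (pl i)) u else {})"

definition K :: "nat \<Rightarrow> nat set gate" where
  "K i u = (\<lambda>(y, m) a. qgate Q i (h u) (strip y \<union> m) (flip (key i (h u)) (strip a)))"

primrec aprot :: "nat \<Rightarrow> nat \<Rightarrow> nat set prot" where
  "aprot 0 i = Done {a. decode Q (strip a \<inter> ansreg Q)}"
| "aprot (Suc r) i = Step (Pow (S i)) (MB (Suc i)) (K i) (aprot r (Suc i))"

lemma pl_Suc_Suc [simp]: "pl (Suc (Suc i)) = pl i" by (simp add: pl_def)
lemma pl_Suc: "pl (Suc i) = other (pl i)" by (simp add: pl_def turn_Suc)

lemma HO_held: "i \<le> t \<Longrightarrow> HA i = held Q (pl i) i \<and> HB i = held Q (pl (Suc i)) i"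
proof (induction i)
  case (Suc i)
  then show ?case
    by (auto simp: S_def pl_def turn_Suc)
qed simp

lemma S_subset: "S i \<subseteq> HA i"
proof (cases "i < t")
  case True
  then show ?thesis using wf HO_held[of i] by (auto simp: S_def wf_quantum_def pl_def)
qed (simp add: S_def)

lemma all_players0: "(\<forall>q. P q) \<longleftrightarrow> P (pl 0) \<and> P (pl (Suc 0))"
  unfolding pl_Suc by (rule all_players)

lemma H0: "HA 0 = set (inreg Q (pl 0)) \<union> work Q (pl 0)" and O0: "HB 0 = set (inreg Q (pl (Suc 0))) \<union> work Q (pl (Suc 0))"
  by simp_all

lemma Alice_Bob: "f Alice \<union> f Bob = f (pl 0) \<union> f (pl (Suc 0))" "f Alice \<inter> f Bob = f (pl 0) \<inter> f (pl (Suc 0))"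
  unfolding pl_Suc by (cases "pl 0"; auto)+

lemma all_qubits_eq: "all_qubits Q = HA 0 \<union> HB 0"
  unfolding all_qubits_def by (simp only: Alice_Bob[of "\<lambda>p. held Q p 0"]) simp

lemma disj0: "HA 0 \<inter> HB 0 = {}"
proof -
  have "held Q Alice 0 \<inter> held Q Bob 0 = {}" using wf unfolding wf_quantum_def by blast
  then show ?thesis by (simp only: Alice_Bob[of "\<lambda>p. held Q p 0"]) simp
qed

lemma finite_held0: "finite (held Q p 0)"
  using wf by (simp add: wf_quantum_def)

lemma HO_facts: "HA i \<inter> HB i = {} \<and> HA i \<union> HB i = all_qubits Q \<and> finite (HA i) \<and> finite (HB i)"
proof (induction i)
  case 0
  then show ?case using disj0 finite_held0[of "pl 0"] finite_held0[of "pl (Suc 0)"] by (simp add: all_qubits_eq del: held.simps)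
next
  case (Suc i)
  moreover have "finite (S i)" by (rule finite_subset[OF S_subset]) (use Suc in simp)
  ultimately show ?case using S_subset[of i] by auto
qed

lemma finite_S: "finite (S i)"
  by (rule finite_subset[OF S_subset]) (use HO_facts[of i] in simp)

lemma strip_bij: "bij_betw strip (MA i) (Pow (HA i))" "bij_betw strip (MB i) (Pow (HB i))"
proof -
  have Cell: "bij_betw strip (Cell ` Pow Z) (Pow Z)" for Z
    by (rule bij_betwI[where g = Cell]) auto
  show B: "bij_betw strip (MB i) (Pow (HB i))" for i
    by (cases i) (simp_all only: MB.simps HO.simps snd_conv Cell)
  show "bij_betw strip (MA i) (Pow (HA i))"
  proof (cases i)
    case 0
    then show ?thesis by (simp only: MA.simps Cell)
  next
    case (Suc j)
    have disj: "S j \<inter> HB j = {}" using S_subset[of j] HO_facts[of j] by blast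
    have inj: "inj_on strip (MA i)"
    proof (rule inj_onI)
      fix a a' assume a: "a \<in> MA i" "a' \<in> MA i" "strip a = strip a'"
      then obtain m b m' b' where ab: "a = Recv m b" "a' = Recv m' b'" "m \<subseteq> S j" "m' \<subseteq> S j" "b \<in> MB j" "b' \<in> MB j"
        by (auto simp: Suc recv_def)
      have sub: "strip b \<subseteq> HB j" "strip b' \<subseteq> HB j" using B[of j] ab(5,6) by (auto simp: bij_betw_def)
      have eq: "m \<union> strip b = m' \<union> strip b'" using a(3) by (simp add: ab(1,2))
      have *: "(x \<union> y) \<inter> S j = x \<and> (x \<union> y) \<inter> HB j = y" if "x \<subseteq> S j" "y \<subseteq> HB j" for x y
        using that disj by blast
      have "m = m'" using *[OF ab(3) sub(1)] *[OF ab(4) sub(2)] unfolding eq by metis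
      moreover have "strip b = strip b'" using *[OF ab(3) sub(1)] *[OF ab(4) sub(2)] unfolding eq by metis
      moreover have "inj_on strip (MB j)" using B[of j] by (simp add: bij_betw_def)
      ultimately show "a = a'" using ab(5,6) unfolding ab(1,2) by (metis inj_on_eq_iff)
    qed
    have "strip ` MA i = (\<lambda>(m, b). m \<union> strip b) ` (Pow (S j) \<times> MB j)"
      unfolding Suc MA.simps recv_def image_image by (intro image_cong refl) (simp add: case_prod_unfold)
    also have "... = (\<lambda>(m, z). m \<union> z) ` (Pow (S j) \<times> strip ` MB j)"
    proof -
      have "(\<lambda>(m, b). (m, strip b)) ` (Pow (S j) \<times> MB j) = Pow (S j) \<times> strip ` MB j"
        using image_paired_Times[of "\<lambda>m. m" strip] by simp
      moreover have "(\<lambda>(m, b). m \<union> strip b) ` (Pow (S j) \<times> MB j) =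
          (\<lambda>(m, z). m \<union> z) ` ((\<lambda>(m, b). (m, strip b)) ` (Pow (S j) \<times> MB j))"
        unfolding image_image by (intro image_cong refl) (simp add: case_prod_unfold)
      ultimately show ?thesis by (simp only:)
    qed
    also have "strip ` MB j = Pow (HB j)" using B[of j] by (simp add: bij_betw_def)
    also have "(\<lambda>(m, z). m \<union> z) ` (Pow (S j) \<times> Pow (HB j)) = Pow (HB j \<union> S j)"
    proof -
      have "w \<in> (\<lambda>(m, z). m \<union> z) ` (Pow (S j) \<times> Pow (HB j))" if "w \<subseteq> HB j \<union> S j" for w
        using that by (intro image_eqI[of _ _ "(w \<inter> S j, w \<inter> HB j)"]) auto
      then show ?thesis by auto
    qed
    finally show ?thesis using inj by (simp add: bij_betw_def Suc)
  qed
qed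

lemma finite_MB: "finite (MB i)"
  using strip_bij(2)[of i] HO_facts[of i] bij_betw_finite by blast

lemma finite_MA: "finite (MA i)"
  using strip_bij(1)[of i] HO_facts[of i] bij_betw_finite by blast

lemma key_subset: "key i u \<subseteq> HA i"
proof -
  have "encode (inreg Q (pl 0)) u \<subseteq> HA 0" "encode (inreg Q (pl (Suc 0))) u \<subseteq> HA (Suc 0)"
    using encode_subset by fastforce+
  then show ?thesis by (cases "i = 0"; cases "i = 1") (auto simp: key_def)
qed

lemma sum_MA_flip: "(\<Sum>a\<in>MA i. f (flip (key i u) (strip a))) = (\<Sum>w\<in>Pow (HA i). f w)"
proof -
  have "(\<Sum>a\<in>MA i. f (flip (key i u) (strip a))) = (\<Sum>w\<in>Pow (HA i). f (flip (key i u) w))"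
    by (rule sum.reindex_bij_betw[OF strip_bij(1)])
  also have "... = (\<Sum>w\<in>Pow (HA i). f w)"
    by (rule sum.reindex_bij_betw[OF bij_flip[OF key_subset]])
  finally show ?thesis .
qed

lemma sum_MA_MB: "(\<Sum>a\<in>MA i. \<Sum>b\<in>MB i. g (strip a \<union> strip b)) = (\<Sum>z\<in>Pow (all_qubits Q). g z)"
proof -
  have "(\<Sum>a\<in>MA i. \<Sum>b\<in>MB i. g (strip a \<union> strip b)) = (\<Sum>a\<in>MA i. \<Sum>z\<in>Pow (HB i). g (strip a \<union> z))"
    by (intro sum.cong refl sum.reindex_bij_betw[OF strip_bij(2)])
  also have "... = (\<Sum>z'\<in>Pow (HA i). \<Sum>z\<in>Pow (HB i). g (z' \<union> z))"
    by (rule sum.reindex_bij_betw[OF strip_bij(1)])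
  also have "... = (\<Sum>z\<in>Pow (HA i \<union> HB i). g z)"
    using HO_facts by (intro sum_Pow_Un[symmetric]) blast
  finally show ?thesis using HO_facts by simp
qed

lemma unitary: "i \<le> t \<Longrightarrow> u \<in> inputs n \<Longrightarrow> unitary_on (HA i) (qgate Q i u)"
  using wf HO_held[of i] unfolding wf_quantum_def pl_def by auto

lemma isom_K:
  assumes i: "i \<le> t" and u: "u \<in> inputs n'"
  shows "isom (MB (Suc i) \<times> Pow (S i)) (MA i) (K i u)"
  unfolding isom_def
proof (intro ballI)
  fix a a' assume a: "a \<in> MA i" "a' \<in> MA i"
  let ?x = "\<lambda>a. flip (key i (h u)) (strip a)" and ?U = "qgate Q i (h u)"
  have bij: "bij_betw (\<lambda>a. ?x a) (MA i) (Pow (HA i))"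
    using bij_betw_trans[OF strip_bij(1) bij_flip[OF key_subset]] by (simp add: o_def)
  have "(\<Sum>d\<in>MB (Suc i) \<times> Pow (S i). K i u d a * cnj (K i u d a')) =
     (\<Sum>z\<in>Pow (HA i - S i). \<Sum>m\<in>Pow (S i). ?U (z \<union> m) (?x a) * cnj (?U (z \<union> m) (?x a')))"
  proof -
    have "(\<Sum>d\<in>MB (Suc i) \<times> Pow (S i). F d) = (\<Sum>y\<in>MB (Suc i). \<Sum>m\<in>Pow (S i). F (y, m))" for F :: "_ \<Rightarrow> complex"
      unfolding sum.cartesian_product by (simp only: case_prod_unfold prod.collapse)
    from this[of "\<lambda>d. K i u d a * cnj (K i u d a')"] show ?thesis
      by (rule trans) (simp only: MB.simps, subst sum.reindex, simp add: inj_on_def, simp add: K_def)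
  qed
  also have "... = (\<Sum>w\<in>Pow (HA i). ?U w (?x a) * cnj (?U w (?x a')))"
    by (subst sum_Pow_Un[symmetric]) (use S_subset[of i] in \<open>auto simp: Un_absorb2 intro!: sum.cong\<close>)
  also have "... = (\<Sum>w\<in>Pow (HA i). cnj (?U w (?x a')) * ?U w (?x a))"
    by (simp only: mult.commute)
  also have "... = of_bool (?x a' = ?x a)"
    by (rule conjunct2[OF bspec[OF bspec[OF unitary[OF i h[OF u], unfolded unitary_on_def]
          bij_betw_apply[OF bij a(2)]] bij_betw_apply[OF bij a(1)]]])
  also have "... = of_bool (a = a')"
    unfolding inj_on_eq_iff[OF bij_betw_imp_inj_on[OF bij] a(2,1)] by (simp only: eq_commute)
  finally show "(\<Sum>d\<in>MB (Suc i) \<times> Pow (S i). K i u d a * cnj (K i u d a')) = of_bool (a = a')" .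
qed

lemma wf_aprot: "i + r \<le> Suc t \<Longrightarrow> wf_prot n' (aprot r i) (MA i) (MB i)"
proof (induction r arbitrary: i)
  case (Suc r)
  then show ?case using Suc.IH[of "Suc i"] finite_S finite_MB[of "Suc i"] isom_K[of i] by (auto simp: Pow_not_empty)
qed simp

lemma msgs_aprot: "msgs (aprot r i) = map (\<lambda>j. 2 ^ card (S j)) [i..<i + r]"
proof (induction r arbitrary: i)
  case (Suc r)
  have "[i..<i + Suc r] = i # [Suc i..<Suc i + r]" by (subst upt_conv_Cons) simp_all
  then show ?case by (simp add: Suc.IH card_Pow finite_S del: upt_Suc)
qed simp

definition \<psi>0 :: "nat set mem \<Rightarrow> nat set mem \<Rightarrow> complex" where
  "\<psi>0 a b = (let z = strip a \<union> strip b in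
     if z \<inter> (set (inreg Q (pl 0)) \<union> set (inreg Q (pl (Suc 0)))) = {}
     then prior Q (z \<inter> (work Q Alice \<union> work Q Bob)) else 0)"

lemma work_eq: "work Q Alice \<union> work Q Bob = work Q (pl 0) \<union> work Q (pl (Suc 0))"
  by (rule Alice_Bob)

lemma reg_disj: "set (inreg Q p) \<inter> work Q p = {}"
  using wf unfolding wf_quantum_def by blast

lemma nsq2_\<psi>0: "nsq2 (MA 0) (MB 0) \<psi>0 = 1"
proof -
  define R where "R = set (inreg Q (pl 0)) \<union> set (inreg Q (pl (Suc 0)))"
  define W where "W = work Q Alice \<union> work Q Bob"
  have RW: "R \<inter> W = {}" "R \<union> W = HA 0 \<union> HB 0"
    using disj0 reg_disj[of "pl 0"] reg_disj[of "pl (Suc 0)"] unfolding R_def W_def work_eq H0 O0 by auto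
  have fin: "finite (HA 0 \<union> HB 0)" using HO_facts[of 0] by blast
  let ?F = "\<lambda>z. (cmod (if z \<inter> R = {} then prior Q (z \<inter> W) else 0))^2"
  have "nsq2 (MA 0) (MB 0) \<psi>0 = (\<Sum>a\<in>MA 0. \<Sum>b\<in>MB 0. ?F (strip a \<union> strip b))"
    unfolding nsq2_def \<psi>0_def Let_def R_def W_def ..
  also have "... = (\<Sum>z\<in>Pow (R \<union> W). ?F z)"
    unfolding RW(2) all_qubits_eq[symmetric] by (rule sum_MA_MB)
  also have "... = (\<Sum>z\<in>Pow W. ?F z)"
    using RW fin by (intro sum.mono_neutral_right) auto
  also have "... = (\<Sum>w\<in>Pow W. (cmod (prior Q w))^2)"
    using RW(1) by (intro sum.cong refl) (auto simp: Int_absorb2 disjoint_iff)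
  also have "... = 1" using wf unfolding wf_quantum_def W_def by blast
  finally show ?thesis .
qed

definition inp :: "bool list \<Rightarrow> bool list \<Rightarrow> nat \<Rightarrow> bool list" where
  "inp x y i = input_of (pl i) x y"

lemma h_inp: "h (inp x y i) = inp (h x) (h y) i"
  by (cases "pl i") (simp_all add: inp_def)

primrec \<Phi> :: "bool list \<Rightarrow> bool list \<Rightarrow> nat \<Rightarrow> nat set mem \<Rightarrow> nat set mem \<Rightarrow> complex" where
  "\<Phi> x y 0 = \<psi>0"
| "\<Phi> x y (Suc i) = step_state (MA i) (K i (inp x y i)) (\<Phi> x y i)"

definition key' :: "bool list \<Rightarrow> bool list \<Rightarrow> nat \<Rightarrow> nat set" where
  "key' x y i = (if i = 0 then key (Suc 0) (inp x y (Suc 0)) else {})"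

lemma key'_subset: "key' x y i \<subseteq> HB i"
proof (cases "i = 0")
  case True
  have "encode (inreg Q (pl (Suc 0))) (inp x y (Suc 0)) \<subseteq> set (inreg Q (pl (Suc 0)))" by (rule encode_subset)
  then show ?thesis using True by (auto simp: key'_def key_def)
qed (simp add: key'_def)

text \<open>The abstract state is the actual one up to the input flips still pending:
  \<open>key\<close> for the mover, \<open>key'\<close> for the waiting player, whose first gate is
  still to come only at time 0.\<close>

lemma state_correspondence:
  assumes "i \<le> Suc t" "a \<in> MA i" "b \<in> MB i"
  shows "\<Phi> x y i a b = qstate_at Q (h x) (h y) i
    (flip (key i (inp (h x) (h y) i)) (strip a) \<union> flip (key' (h x) (h y) i) (strip b))"
  using assms
proof (induction i arbitrary: a b)
  case 0
  let ?X = "h x" and ?Y = "h y"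
  let ?e = "\<lambda>i. encode (inreg Q (pl i)) (inp ?X ?Y i)"
  let ?z = "flip (?e 0) (strip a) \<union> flip (?e (Suc 0)) (strip b)"
  have sub: "strip a \<subseteq> HA 0" "strip b \<subseteq> HB 0"
    using 0 strip_bij[of 0] unfolding bij_betw_def by auto
  have e: "?e 0 \<subseteq> set (inreg Q (pl 0))" "?e (Suc 0) \<subseteq> set (inreg Q (pl (Suc 0)))"
    by (rule encode_subset)+
  note d = disj0[unfolded H0 O0] reg_disj[of "pl 0"] reg_disj[of "pl (Suc 0)"]
  have r0: "?z \<inter> set (inreg Q (pl 0)) = flip (?e 0) (strip a \<inter> set (inreg Q (pl 0)))"
    using d e sub unfolding H0 O0 flip_def by blast
  have r1: "?z \<inter> set (inreg Q (pl (Suc 0))) = flip (?e (Suc 0)) (strip b \<inter> set (inreg Q (pl (Suc 0))))"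
    using d e sub unfolding H0 O0 flip_def by blast
  have w: "?z \<inter> (work Q Alice \<union> work Q Bob) = (strip a \<union> strip b) \<inter> (work Q Alice \<union> work Q Bob)"
    using d e sub unfolding H0 O0 flip_def work_eq by blast
  have f: "flip K z = K \<longleftrightarrow> z = {}" for K z by (auto simp: flip_def)
  have c: "strip a \<inter> set (inreg Q (pl 0)) = {} \<and> strip b \<inter> set (inreg Q (pl (Suc 0))) = {} \<longleftrightarrow>
     (strip a \<union> strip b) \<inter> (set (inreg Q (pl 0)) \<union> set (inreg Q (pl (Suc 0)))) = {}"
    using d sub unfolding H0 O0 by blast
  have "initial_state Q ?X ?Y ?z = \<psi>0 a b"
    unfolding initial_state_def all_players0 w unfolding inp_def[symmetric] r0 r1 f c
    by (simp add: \<psi>0_def Let_def)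
  then show ?case by (simp add: key_def key'_def)
next
  case (Suc i)
  let ?X = "h x" and ?Y = "h y"
  have i: "i \<le> t" using Suc.prems by simp
  obtain m b' where a: "a = Recv m b'" "m \<subseteq> S i" "b' \<in> MB i" using Suc.prems by (auto simp: recv_def)
  obtain z where b: "b = Cell z" "z \<subseteq> HA i - S i" using Suc.prems by auto
  have b'O: "strip b' \<subseteq> HB i" using a(3) strip_bij(2)[of i] unfolding bij_betw_def by auto
  let ?k = "key' ?X ?Y i"
  let ?xb = "flip ?k (strip b')"
  have xb: "?xb \<subseteq> HB i" using b'O key'_subset[of ?X ?Y i] by (auto simp: flip_def)
  have mH: "m \<subseteq> HA i" using a(2) S_subset[of i] by blast
  have dis: "HA i \<inter> HB i = {}" using HO_facts by blast
  have "key (Suc i) (inp ?X ?Y (Suc i)) = ?k" by (simp add: key'_def key_def)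
  then have Z: "flip (key (Suc i) (inp ?X ?Y (Suc i))) (strip a) \<union> flip (key' ?X ?Y (Suc i)) (strip b) = ?xb \<union> (z \<union> m)"
    using key'_subset[of ?X ?Y i] mH dis by (auto simp: key'_def a b flip_def)
  have ZH: "(?xb \<union> (z \<union> m)) \<inter> HA i = z \<union> m" "(?xb \<union> (z \<union> m)) - HA i = ?xb"
    using xb dis b(2) mH by auto
  have "\<Phi> x y (Suc i) a b = (\<Sum>a\<in>MA i. qgate Q i (inp ?X ?Y i) (z \<union> m) (flip (key i (inp ?X ?Y i)) (strip a)) *
      qstate_at Q ?X ?Y i (flip (key i (inp ?X ?Y i)) (strip a) \<union> ?xb))"
    using Suc.IH[OF _ _ a(3)] i by (simp add: a b step_state_Recv K_def h_inp)
  also have "... = (\<Sum>w\<in>Pow (HA i). qgate Q i (inp ?X ?Y i) (z \<union> m) w * qstate_at Q ?X ?Y i (w \<union> ?xb))"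
    by (rule sum_MA_flip)
  also have "... = qstate_at Q ?X ?Y (Suc i) (?xb \<union> (z \<union> m))"
    unfolding qstate_at.simps Let_def apply_on_def pl_def[symmetric] inp_def[symmetric]
      HO_held[OF i, THEN conjunct1, symmetric] ZH by (simp only: Un_commute)
  finally show ?case unfolding Z .
qed

lemma acc_aprot_shift:
  "acc (aprot r i) (MA i) (MB i) (inp x y i) (inp x y (Suc i)) (\<Phi> x y i) =
   acc (aprot 0 (i + r)) (MA (i + r)) (MB (i + r)) (inp x y (i + r)) (inp x y (Suc (i + r))) (\<Phi> x y (i + r))"
proof (induction r arbitrary: i)
  case (Suc r)
  have "acc (aprot (Suc r) i) (MA i) (MB i) (inp x y i) (inp x y (Suc i)) (\<Phi> x y i) =
     acc (aprot r (Suc i)) (MA (Suc i)) (MB (Suc i)) (inp x y (Suc i)) (inp x y (Suc (Suc i))) (\<Phi> x y (Suc i))"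
    by (simp add: inp_def)
  then show ?case using Suc.IH[of "Suc i"] by simp
qed simp

lemma acc_aprot:
  "acc (aprot (Suc t) 0) (MA 0) (MB 0) (inp x y 0) (inp x y (Suc 0)) \<psi>0 = qprob t Q (h x) (h y) True"
proof -
  let ?q = "qstate_at Q (h x) (h y) (Suc t)"
  let ?F = "\<lambda>z. of_bool (decode Q (z \<inter> ansreg Q)) * (cmod (?q z))^2"
  \<comment> \<open>Since \<open>t \<ge> 1\<close>, gates 0 and 1 have both been applied, so no flip
    is pending at the end.\<close>
  have k0: "key (Suc t) u = {}" "key' (h x) (h y) (Suc t) = {}" for u
    using t by (simp_all add: key_def key'_def)
  have St: "S t = {}" by (simp add: S_def)
  have dis: "HA (Suc t) \<inter> HB (Suc t) = {}" using HO_facts by blast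
  have ans: "ansreg Q \<subseteq> HB (Suc t)"
    using wf HO_held[of t] by (simp add: wf_quantum_def St pl_def)
  have fin: "finite (all_qubits Q)" using HO_facts[of 0] by (metis finite_UnI)
  have "acc (aprot (Suc t) 0) (MA 0) (MB 0) (inp x y 0) (inp x y (Suc 0)) \<psi>0 =
     acc (aprot 0 (Suc t)) (MA (Suc t)) (MB (Suc t)) (inp x y (Suc t)) (inp x y (Suc (Suc t))) (\<Phi> x y (Suc t))"
    using acc_aprot_shift[of "Suc t" 0 x y] by simp
  also have "... = (\<Sum>a\<in>MA (Suc t). \<Sum>b\<in>MB (Suc t). of_bool (b \<in> {a. decode Q (strip a \<inter> ansreg Q)}) * (cmod (\<Phi> x y (Suc t) a b))^2)"
    by (simp only: aprot.simps acc.simps)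
  also have "... = (\<Sum>a\<in>MA (Suc t). \<Sum>b\<in>MB (Suc t). ?F (strip a \<union> strip b))"
  proof (intro sum.cong refl)
    fix a b assume ab: "a \<in> MA (Suc t)" "b \<in> MB (Suc t)"
    then have "strip a \<subseteq> HA (Suc t)" "strip b \<subseteq> HB (Suc t)"
      using strip_bij[of "Suc t"] unfolding bij_betw_def by blast+
    then have "(strip a \<union> strip b) \<inter> ansreg Q = strip b \<inter> ansreg Q" using ans dis by blast
    then show "of_bool (b \<in> {a. decode Q (strip a \<inter> ansreg Q)}) * (cmod (\<Phi> x y (Suc t) a b))^2 = ?F (strip a \<union> strip b)"
      by (simp only: state_correspondence[OF order_refl ab] k0 flip_empty mem_Collect_eq)
  qed
  also have "... = (\<Sum>z\<in>Pow (all_qubits Q). ?F z)" by (rule sum_MA_MB)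
  also have "... = qprob t Q (h x) (h y) True"
    unfolding qprob_def using fin
    by (intro sum.mono_neutral_cong_right) (auto simp: finite_Pow_iff)
  finally show ?thesis .
qed

end

text \<open>No-signalling: without communication the outcome does not depend on the input of the player
  who does not produce it, which is the first mover exactly if the number of steps is even.\<close>

lemma acc_zero_communication:
  assumes "wf_prot n p A B" "finite A" "finite B" "\<forall>d\<in>set (msgs p). d = 1"
    and "u \<in> inputs n" "u' \<in> inputs n" "v \<in> inputs n" "v' \<in> inputs n"
  shows "(even (length (msgs p)) \<longrightarrow>
       (\<forall>b\<in>B. \<forall>b'\<in>B. red A (\<lambda>b a. \<psi> a b) b b' = red A (\<lambda>b a. \<phi> a b) b b') \<longrightarrow>
       acc p A B u v \<psi> = acc p A B u' v \<phi>) \<and>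
     (odd (length (msgs p)) \<longrightarrow> (\<forall>a\<in>A. \<forall>a'\<in>A. red B \<psi> a a' = red B \<phi> a a') \<longrightarrow>
       acc p A B u v \<psi> = acc p A B u v' \<phi>)"
  using assms
proof (induction p arbitrary: A B u u' v v' \<psi> \<phi>)
  case (Done Q)
  have "acc (Done Q) A B u v \<psi> = acc (Done Q) A B u' v \<phi>"
    if eq: "\<forall>b\<in>B. \<forall>b'\<in>B. red A (\<lambda>b a. \<psi> a b) b b' = red A (\<lambda>b a. \<phi> a b) b b'"
  proof -
    have r: "red A (\<lambda>b a. \<psi> a b) b b = of_real (nsq A (\<lambda>a. \<psi> a b))" for b and \<psi> :: "'a mem \<Rightarrow> 'a mem \<Rightarrow> complex"
      unfolding ip_self[symmetric] by (simp add: red_def ip_def mult.commute)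
    have "nsq A (\<lambda>a. \<psi> a b) = nsq A (\<lambda>a. \<phi> a b)" if "b \<in> B" for b
      using eq that r[of \<psi> b] r[of \<phi> b] by (metis of_real_eq_iff)
    moreover have "acc (Done Q) A B u v \<psi> = (\<Sum>b\<in>B. of_bool (b \<in> Q) * nsq A (\<lambda>a. \<psi> a b))" for u v \<psi>
      unfolding acc.simps nsq_def sum_distrib_left by (rule sum.swap)
    ultimately show ?thesis by (simp del: acc.simps cong: sum.cong)
  qed
  then show ?case by simp
next
  case (Step M A' G p)
  then obtain m where M: "M = {m}" by (auto simp: card_1_singleton_iff)
  have w: "wf_prot n p (recv M B) A'" "finite (recv M B)" "finite A'" "\<forall>d\<in>set (msgs p). d = 1"
    using Step.prems by auto
  have G: "isom (A' \<times> M) A (G u)" if "u \<in> inputs n" for u using Step.prems that by simp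
  have eo: "even (length (msgs (Step M A' G p))) = odd (length (msgs p))" by simp
  let ?\<psi> = "\<lambda>u. step_state A (G u) \<psi>" and ?\<phi> = "\<lambda>u. step_state A (G u) \<phi>"
  \<comment> \<open>The mover's isometry leaves the other player's reduced state unchanged, whatever
    the input; by \<open>second\<close> the mover's new reduced state depends on the old one and the
    mover's input alone.\<close>
  have first: "red A' (step_state A (G u) \<psi>) (Recv m b) (Recv m b') = red A (\<lambda>b a. \<psi> a b) b b'"
    if "u \<in> inputs n" for b b' u and \<psi> :: "'a mem \<Rightarrow> 'a mem \<Rightarrow> complex"
  proof -
    have "red A' (step_state A (G u) \<psi>) (Recv m b) (Recv m b') =
      ip (A' \<times> M) (\<lambda>d. \<Sum>a\<in>A. G u d a * \<psi> a b') (\<lambda>d. \<Sum>a\<in>A. G u d a * \<psi> a b)"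
    proof -
      have "(\<Sum>d\<in>A' \<times> M. F d) = (\<Sum>a'\<in>A'. \<Sum>m\<in>M. F (a', m))" for F :: "_ \<Rightarrow> complex"
        by (simp only: sum.cartesian_product case_prod_unfold prod.collapse)
      then show ?thesis by (simp add: M ip_def red_def step_state_Recv mult.commute)
    qed
    also have "... = ip A (\<lambda>a. \<psi> a b') (\<lambda>a. \<psi> a b)"
      by (rule isom_ip[OF Step.prems(2) G[OF that]])
    finally show ?thesis by (simp add: ip_def red_def mult.commute)
  qed
  have second: "red (recv M B) (\<lambda>b a. step_state A (G u) \<psi> a b) c c' =
     (\<Sum>a\<in>A. \<Sum>a'\<in>A. G u (c, m) a * cnj (G u (c', m) a') * red B \<psi> a a')"
     for c c' u and \<psi> :: "'a mem \<Rightarrow> 'a mem \<Rightarrow> complex"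
  proof -
    have "red (recv M B) (\<lambda>b a. step_state A (G u) \<psi> a b) c c' =
       (\<Sum>b\<in>B. \<Sum>a\<in>A. \<Sum>a'\<in>A. G u (c, m) a * cnj (G u (c', m) a') * (\<psi> a b * cnj (\<psi> a' b)))"
      unfolding red_def sum_recv M step_state_Recv cnj_sum sum_product by (simp add: mult_ac)
    also have "... = (\<Sum>a\<in>A. \<Sum>a'\<in>A. \<Sum>b\<in>B. G u (c, m) a * cnj (G u (c', m) a') * (\<psi> a b * cnj (\<psi> a' b)))"
      by (subst sum.swap, rule sum.cong[OF refl], rule sum.swap)
    finally show ?thesis by (simp add: red_def sum_distrib_left)
  qed
  show ?case
  proof (intro conjI impI)
    assume e: "even (length (msgs (Step M A' G p)))"
      and eq: "\<forall>b\<in>B. \<forall>b'\<in>B. red A (\<lambda>b a. \<psi> a b) b b' = red A (\<lambda>b a. \<phi> a b) b b'"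
    have "\<forall>c\<in>recv M B. \<forall>c'\<in>recv M B. red A' (?\<psi> u) c c' = red A' (?\<phi> u') c c'"
      using eq Step.prems by (auto simp: recv_def M first)
    then show "acc (Step M A' G p) A B u v \<psi> = acc (Step M A' G p) A B u' v \<phi>"
      using Step.IH[OF w, of v v u u' "?\<psi> u" "?\<phi> u'"] Step.prems e by simp
  next
    assume e: "odd (length (msgs (Step M A' G p)))"
      and eq: "\<forall>a\<in>A. \<forall>a'\<in>A. red B \<psi> a a' = red B \<phi> a a'"
    have "\<forall>c\<in>A'. \<forall>c'\<in>A'. red (recv M B) (\<lambda>b a. ?\<psi> u a b) c c' = red (recv M B) (\<lambda>b a. ?\<phi> u a b) c c'"
      using eq by (simp add: second)
    then show "acc (Step M A' G p) A B u v \<psi> = acc (Step M A' G p) A B u v' \<phi>"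
      using Step.IH[OF w, of v v' u u "?\<psi> u" "?\<phi> u"] Step.prems e by simp
  qed
qed

section \<open>Numerical constants and the quantum bound\<close>

lemma sum_sqrt_le:
  assumes "\<And>i. i < t \<Longrightarrow> 0 \<le> f i"
  shows "(\<Sum>i<t. sqrt (f i)) \<le> sqrt (real t * (\<Sum>i<t. f i))"
proof -
  have "(\<Sum>i<t. sqrt (f i)) = (\<Sum>i<t. \<bar>1\<bar> * \<bar>sqrt (f i)\<bar>)" using assms by (intro sum.cong) auto
  also have "... \<le> L2_set (\<lambda>_. 1) {..<t} * L2_set (\<lambda>i. sqrt (f i)) {..<t}" by (rule L2_set_mult_ineq)
  also have "... = sqrt (real t * (\<Sum>i<t. f i))"
    using assms by (simp add: L2_set_def real_sqrt_mult)
  finally show ?thesis .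
qed

text \<open>Four-bit blocks give \<open>1/2 - 1/16 = 35/80\<close> at level 0. By Cauchy-Schwarz
  over the rounds the total loss is at most \<open>2 * sqrt (2 / 800) = 8/80\<close>, and the
  remaining 27/80 still exceeds 1/3.\<close>

lemma hard_error_ge:
  assumes k: "k \<ge> 1" and p: "wf_prot (4 * k ^ t) p A B" "finite A" "finite B" "nsq2 A B \<psi> = 1" "length (msgs p) = Suc t"
    and pos: "\<And>i. i < t \<Longrightarrow> 1 \<le> msgs p ! i"
    and small: "800 * (real t * (\<Sum>i<t. ln (msgs p ! i))) \<le> real k"
  shows "27 / 80 \<le> hard 4 k t (\<lambda>u v. err c u v (acc p A B u v \<psi>))"
proof -
  let ?l = "\<lambda>i. ln (real (msgs p ! i))"
  have l: "0 \<le> ?l i" if "i < t" for i using pos[OF that] by simp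
  have "(\<Sum>i<t. 2 * sqrt (2 * ?l i / k)) = 2 * (\<Sum>i<t. sqrt (2 * ?l i / k))"
    by (simp add: sum_distrib_left)
  also have "... \<le> 2 * sqrt (real t * (\<Sum>i<t. 2 * ?l i / k))"
    by (intro mult_left_mono sum_sqrt_le) (simp_all add: l)
  also have "... \<le> 2 * sqrt ((1 / 20)^2)"
  proof (intro mult_left_mono real_sqrt_le_mono)
    have "real t * (\<Sum>i<t. 2 * ?l i / k) = 2 * (real t * (\<Sum>i<t. ?l i)) / k"
      by (simp add: sum_distrib_left sum_divide_distrib mult_ac)
    also have "... \<le> 2 * (k / 800) / k" using small by (intro divide_right_mono mult_left_mono) auto
    finally show "real t * (\<Sum>i<t. 2 * ?l i / k) \<le> (1 / 20)^2" using k by (simp add: power2_eq_square)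
  qed simp
  also have "... = 1 / 10" by (subst real_sqrt_abs) simp
  finally show ?thesis
    using hard_lower_bound[OF _ k p, of c] by simp
qed

lemma GT_fun_pad: "length x = length y \<Longrightarrow> GT_fun (replicate d False @ x) (replicate d False @ y) = GT_fun x y"
  by (simp add: GT_fun_def bits_val_append)

lemma GT_fun_extremes:
  assumes "n \<ge> 1"
  shows "GT_fun (replicate n True) (replicate n False)" "\<not> GT_fun x x"
proof -
  have z: "bits_val (replicate n False) = 0" by (induction n) (simp_all add: bits_val_Cons, simp add: bits_val_def)
  obtain m where n: "n = Suc m" using assms by (cases n) auto
  have "bits_val (replicate n True) > 0" unfolding n replicate_Suc bits_val_Cons by simp
  then show "GT_fun (replicate n True) (replicate n False)" by (simp add: GT_fun_def z)
qed (simp add: GT_fun_def)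

context quantum_embedding
begin

lemma nsq2_\<Phi>:
  assumes "x \<in> inputs n'" "y \<in> inputs n'" shows "i \<le> Suc t \<Longrightarrow> nsq2 (MA i) (MB i) (\<Phi> x y i) = 1"
proof (induction i)
  case 0
  then show ?case using nsq2_\<psi>0 by simp
next
  case (Suc i)
  have "inp x y i \<in> inputs n'" using assms by (cases "pl i") (simp_all add: inp_def)
  then have iso: "isom (MB (Suc i) \<times> Pow (S i)) (MA i) (K i (inp x y i))" using Suc.prems by (intro isom_K) auto
  show ?case
    using Suc.IH Suc.prems nsq2_step_state[OF finite_MA iso, of "MB i" "\<Phi> x y i"] by (simp del: MB.simps)
qed

lemma qprob_total:
  assumes "x \<in> inputs n'" "y \<in> inputs n'"
  shows "qprob t Q (h x) (h y) True + qprob t Q (h x) (h y) False = 1"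
proof -
  let ?f = "\<lambda>z. (cmod (qstate_at Q (h x) (h y) (Suc t) z))^2"
  have k0: "key (Suc t) u = {}" "key' (h x) (h y) (Suc t) = {}" for u
    using t by (simp_all add: key_def key'_def)
  have fin: "finite (all_qubits Q)" using HO_facts[of 0] by (metis finite_UnI)
  have "1 = nsq2 (MA (Suc t)) (MB (Suc t)) (\<Phi> x y (Suc t))"
    using nsq2_\<Phi>[OF assms order_refl] by (rule sym)
  also have "... = (\<Sum>a\<in>MA (Suc t). \<Sum>b\<in>MB (Suc t). ?f (strip a \<union> strip b))"
    unfolding nsq2_def
    by (intro sum.cong refl) (simp only: state_correspondence[OF order_refl] k0 flip_empty)
  also have "... = (\<Sum>z\<in>Pow (all_qubits Q). ?f z)" by (rule sum_MA_MB)
  also have "Pow (all_qubits Q) = {z. z \<subseteq> all_qubits Q \<and> decode Q (z \<inter> ansreg Q) = True} \<union>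
      {z. z \<subseteq> all_qubits Q \<and> decode Q (z \<inter> ansreg Q) = False}" by auto
  also have "(\<Sum>z\<in>.... ?f z) = qprob t Q (h x) (h y) True + qprob t Q (h x) (h y) False"
    unfolding qprob_def by (rule sum.union_disjoint) (use fin in auto)
  finally show ?thesis by simp
qed

lemma card_S: "i < t \<Longrightarrow> card (S i) = card (sent Q i)"
  by (simp add: S_def)

lemma hard_qprob_ge:
  assumes n': "n' = 4 * k ^ t" and k: "k \<ge> 1" and small: "800 * (t * quantum_cost t Q) \<le> k"
  shows "\<exists>u\<in>inputs n'. \<exists>v\<in>inputs n'. u \<noteq> v \<and> 1 / 3 \<le> qprob t Q (h u) (h v) (\<not> GT_fun u v)"
proof (rule ccontr)
  assume contr: "\<not> ?thesis"
  \<comment> \<open>\<open>acc\<close> takes the first mover's input first; if Bob starts, the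
    exchanged inputs turn the task into the complement of \<open>GT_fun\<close>.\<close>
  define c where "c = (pl 0 = Alice)"
  let ?p = "aprot (Suc t) 0"
  let ?q = "\<lambda>u v. acc ?p (MA 0) (MB 0) u v \<psi>0"
  have msgs: "msgs ?p ! i = 2 ^ card (sent Q i)" if "i < t" for i
    using that by (simp only: msgs_aprot) (simp add: card_S del: upt_Suc)
  have len: "length (msgs ?p) = Suc t" by (simp only: msgs_aprot) simp
  have "(\<Sum>i<t. ln (msgs ?p ! i)) = (\<Sum>i<t. card (sent Q i) * ln 2)"
    using msgs by (intro sum.cong refl) (simp add: ln_realpow)
  also have "... = quantum_cost t Q * ln 2" by (simp add: quantum_cost_def sum_distrib_right)
  also have "... \<le> quantum_cost t Q"
    using ln_2_less_1 mult_left_mono[of "ln 2" 1 "real (quantum_cost t Q)"] by simp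
  finally have "800 * (real t * (\<Sum>i<t. ln (msgs ?p ! i))) \<le> 800 * (real t * quantum_cost t Q)"
    by (intro mult_left_mono) auto
  also have "... \<le> real k" using small by (metis of_nat_le_iff of_nat_mult of_nat_numeral)
  finally have sm: "800 * (real t * (\<Sum>i<t. ln (msgs ?p ! i))) \<le> real k" .
  have "27 / 80 \<le> hard 4 k t (\<lambda>u v. err c u v (?q u v))"
    by (rule hard_error_ge[OF k _ finite_MA finite_MB nsq2_\<psi>0 len _ sm])
       (use wf_aprot[of 0 "Suc t"] msgs in \<open>auto simp: n'[symmetric] simp del: aprot.simps MA.simps MB.simps\<close>)
  also have "... \<le> hard 4 k t (\<lambda>u v. 1 / 3)"
  proof (rule hard_mono)
    fix u v assume uv: "u \<in> inputs (4 * k ^ t)" "v \<in> inputs (4 * k ^ t)" "u \<noteq> v"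
    then have uv': "u \<in> inputs n'" "v \<in> inputs n'" by (simp_all add: n')
    have len: "length u = length v" using uv by (simp add: inputs_def)
    have "err c u v (?q u v) = (if c then qprob t Q (h u) (h v) (\<not> GT_fun u v) else qprob t Q (h v) (h u) (\<not> GT_fun v u))"
    proof (cases "pl 0")
      case Alice
      then have "pl (Suc 0) = Bob" by (simp add: pl_Suc)
      then have "?q u v = qprob t Q (h u) (h v) True" using acc_aprot[of u v] Alice by (simp add: inp_def del: aprot.simps)
      then show ?thesis using qprob_total[OF uv'] Alice by (auto simp: err_def c_def)
    next
      case Bob
      then have "pl (Suc 0) = Alice" by (simp add: pl_Suc)
      then have "?q u v = qprob t Q (h v) (h u) True" using acc_aprot[of v u] Bob by (simp add: inp_def del: aprot.simps)
      then show ?thesis using qprob_total[OF uv'(2,1)] Bob GT_fun_swap[OF len uv(3)] by (auto simp: err_def c_def)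
    qed
    moreover have "qprob t Q (h a) (h b) (\<not> GT_fun a b) \<le> 1 / 3" if "a \<in> inputs n'" "b \<in> inputs n'" "a \<noteq> b" for a b
      using contr that by (meson linear)
    ultimately show "err c u v (?q u v) \<le> 1 / 3" using uv' uv(3) by presburger
  qed simp
  also have "... = 1 / 3" using k by simp
  finally show False by simp
qed

lemma qprob_zero_communication:
  assumes cost: "quantum_cost t Q = 0"
    and x: "x \<in> inputs n'" "x' \<in> inputs n'" "y \<in> inputs n'" "y' \<in> inputs n'"
  shows "qprob t Q (h x) (h y) True = qprob t Q (h x') (h y) True \<or> qprob t Q (h x) (h y) True = qprob t Q (h x) (h y') True"
proof -
  let ?p = "aprot (Suc t) 0"
  let ?q = "\<lambda>u v. acc ?p (MA 0) (MB 0) u v \<psi>0"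
  have S0: "card (S i) = 0" for i using cost by (cases "i < t") (auto simp: S_def quantum_cost_def)
  have "wf_prot n' ?p (MA 0) (MB 0)" by (rule wf_aprot) simp
  moreover have "\<forall>d\<in>set (msgs ?p). d = 1" unfolding msgs_aprot S0 by auto
  ultimately have ind: "?q u v = ?q u' v \<or> ?q u v = ?q u v'"
    if "u \<in> inputs n'" "u' \<in> inputs n'" "v \<in> inputs n'" "v' \<in> inputs n'" for u u' v v'
    using acc_zero_communication[of n' ?p "MA 0" "MB 0" u u' v v' \<psi>0 \<psi>0] finite_MA finite_MB that by blast
  show ?thesis
  proof (cases "pl 0")
    case Alice
    then have "pl (Suc 0) = Bob" by (simp add: pl_Suc)
    then have "?q u v = qprob t Q (h u) (h v) True" for u v using acc_aprot[of u v] Alice by (simp add: inp_def del: aprot.simps)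
    then show ?thesis using ind x by metis
  next
    case Bob
    then have "pl (Suc 0) = Alice" by (simp add: pl_Suc)
    then have "?q u v = qprob t Q (h v) (h u) True" for u v using acc_aprot[of v u] Bob by (simp add: inp_def del: aprot.simps)
    then show ?thesis using ind x by metis
  qed
qed

end

text \<open>The factor 4 is absorbed in \<open>4 ^ t\<close>. With \<open>k\<close> equal to 800
  times \<open>t\<close> times the quantum cost this gives the constant 3200, and 6400 in the
  classical case.\<close>

lemma powr_root_le:
  assumes "n \<le> 4 * k ^ t" "k \<ge> 1" "t \<ge> 1"
  shows "real n powr (1 / real t) \<le> 4 * real k"
proof -
  have "real n \<le> 4 * real k ^ t" using assms(1) by (metis of_nat_le_iff of_nat_mult of_nat_numeral of_nat_power)
  also have "... \<le> 4 ^ t * real k ^ t"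
    using assms by (intro mult_right_mono self_le_power) auto
  also have "... = (4 * real k) powr real t" using assms by (simp add: powr_realpow power_mult_distrib)
  finally have "real n powr (1 / real t) \<le> ((4 * real k) powr real t) powr (1 / real t)"
    by (intro powr_mono2) auto
  also have "... = 4 * real k" using assms by (simp add: powr_powr)
  finally show ?thesis .
qed

lemma quantum_cost_bound:
  assumes n: "n \<ge> 1" and t: "t \<ge> 1" and Q: "bounded_error_quantum n t GT_fun Q"
  shows "1 / 3200 * (real n powr (1 / real t) / real t) \<le> quantum_cost t Q"
proof (cases "quantum_cost t Q = 0")
  case True
  interpret quantum_embedding n n t Q "\<lambda>u. u"
    using Q t by unfold_locales (auto simp: bounded_error_quantum_def)
  \<comment> \<open>Without communication one input alone determines the outcome distribution. The
    pair \<open>?o\<close>, \<open>?z\<close> shares either input with an equal pair, for which the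
    answer is the opposite one.\<close>
  let ?z = "replicate n False" and ?o = "replicate n True"
  have in': "?z \<in> inputs n" "?o \<in> inputs n" by (simp_all add: inputs_def)
  have err: "qprob t Q x y (\<not> GT_fun x y) < 1 / 3" if "x \<in> inputs n" "y \<in> inputs n" for x y
    using Q that by (simp add: bounded_error_quantum_def)
  have "qprob t Q ?o ?z False < 1 / 3" "qprob t Q ?z ?z True < 1 / 3" "qprob t Q ?o ?o True < 1 / 3"
    using err[OF in'(2,1)] err[OF in'(1,1)] err[OF in'(2,2)] GT_fun_extremes[OF n] by simp_all
  then show ?thesis
    using qprob_zero_communication[OF True in'(2,1,1,2)] qprob_total[OF in'(2,1)] by force
next
  case False
  define k where "k = 800 * (t * quantum_cost t Q)"
  have k: "k \<ge> 1" using False t by (simp add: k_def)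
  have "n \<le> 4 * k ^ t"
  proof (rule ccontr)
    assume "\<not> n \<le> 4 * k ^ t"
    then have lt: "4 * k ^ t < n" by simp
    \<comment> \<open>Leading zeros do not change the comparison, so a protocol for \<open>n\<close>
      bits also solves the shorter hard instances.\<close>
    let ?h = "\<lambda>u. replicate (n - 4 * k ^ t) False @ u"
    interpret quantum_embedding n "4 * k ^ t" t Q ?h
      using Q t lt by unfold_locales (auto simp: bounded_error_quantum_def inputs_def)
    obtain u v where uv: "u \<in> inputs (4 * k ^ t)" "v \<in> inputs (4 * k ^ t)" "1 / 3 \<le> qprob t Q (?h u) (?h v) (\<not> GT_fun u v)"
      using hard_qprob_ge[OF refl k] by (auto simp: k_def)
    have "GT_fun (?h u) (?h v) = GT_fun u v" using uv by (intro GT_fun_pad) (simp add: inputs_def)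
    then have "qprob t Q (?h u) (?h v) (\<not> GT_fun u v) < 1 / 3"
      using Q h[OF uv(1)] h[OF uv(2)] unfolding bounded_error_quantum_def by metis
    then show False using uv(3) by simp
  qed
  from powr_root_le[OF this k t] have "real n powr (1 / real t) \<le> 3200 * (real t * real (quantum_cost t Q))"
    by (simp add: k_def)
  then show ?thesis using t by (simp add: field_simps)
qed

section \<open>Public coin protocols\<close>

primrec history :: "'m mem \<Rightarrow> 'm list" where
  "history (Cell m) = []"
| "history (Recv m b) = history b @ [m]"
| "history (Ctrl s b) = []"
| "history (Junk b) = []"

definition basis_state :: "'m mem \<Rightarrow> 'm mem \<Rightarrow> 'm mem \<Rightarrow> complex" where
  "basis_state w a b = of_bool (a = w \<and> b = w)"

lemma nsq2_basis_state:
  assumes "finite A" "w \<in> A" shows "nsq2 A A (basis_state w) = 1"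
proof -
  have "nsq2 A A (basis_state w) = (\<Sum>a\<in>A. \<Sum>b\<in>A. if b = w then of_bool (a = w) else 0)"
    unfolding nsq2_def by (intro sum.cong refl) (auto simp: basis_state_def)
  then show ?thesis using assms by simp
qed

text \<open>The sender keeps a copy of the message, which makes the map on labels injective and
  keeps the memories of both players identical, so that each holds the full transcript.\<close>

definition copy_gate :: "(bool list \<Rightarrow> 'm mem \<Rightarrow> 'm) \<Rightarrow> 'm gate" where
  "copy_gate f u = (\<lambda>(y, m) a. of_bool (m = f u a \<and> y = Recv (f u a) a))"

lemma isom_copy_gate:
  assumes "finite M" "finite A" "\<And>a. a \<in> A \<Longrightarrow> f u a \<in> M"
  shows "isom (recv M A \<times> M) A (copy_gate f u)"
  unfolding isom_def
proof (intro ballI)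
  fix a a' assume a: "a \<in> A" "a' \<in> A"
  have "(\<Sum>d\<in>recv M A \<times> M. copy_gate f u d a * cnj (copy_gate f u d a')) =
     (\<Sum>d\<in>recv M A \<times> M. if d = (Recv (f u a) a, f u a) then of_bool (a = a') else 0)"
    by (intro sum.cong refl) (auto simp: copy_gate_def)
  also have "... = of_bool (a = a')"
    using assms a by (auto simp: recv_def)
  finally show "(\<Sum>d\<in>recv M A \<times> M. copy_gate f u d a * cnj (copy_gate f u d a')) = of_bool (a = a')" .
qed

lemma step_copy_gate:
  assumes "finite A" "w \<in> A"
  shows "step_state A (copy_gate f u) (basis_state w) (Recv m b) y = of_bool (m = f u w \<and> y = Recv (f u w) w \<and> b = w)"
proof -
  have "step_state A (copy_gate f u) (basis_state w) (Recv m b) y =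
     (\<Sum>a\<in>A. if a = w then of_bool (m = f u w \<and> y = Recv (f u w) w \<and> b = w) else 0)"
    unfolding step_state_Recv by (intro sum.cong refl) (auto simp: copy_gate_def basis_state_def)
  then show ?thesis using assms by simp
qed

locale classical_embedding =
  fixes n n' t c :: nat and P :: det_protocol and h :: "bool list \<Rightarrow> bool list"
  assumes cost: "\<And>x y. x \<in> inputs n \<Longrightarrow> y \<in> inputs n \<Longrightarrow> bits_sent t P x y \<le> c"
    and h: "\<And>u. u \<in> inputs n' \<Longrightarrow> h u \<in> inputs n"
begin

text \<open>Messages may have any length and need not be prefix-free, so the length is itself
  information and the alphabet contains all shorter strings.\<close>

definition M :: "bool list set" where "M = {m. length m \<le> c}"

text \<open>Over-long messages, which only occur on unreachable histories, are cut so that the message alphabet is finite.\<close>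

definition f :: "bool list \<Rightarrow> bool list mem \<Rightarrow> bool list" where
  "f u a = take c (msg P (h u) (history a))"

definition g :: "bool list \<Rightarrow> bool list mem \<Rightarrow> bool list" where
  "g u a = [ans P (h u) (history a)]"

text \<open>The answer is treated as one more message; the accepting labels read it off the copy
  that the last recipient keeps.\<close>

primrec cprot :: "nat \<Rightarrow> bool list mem set \<Rightarrow> bool list prot" where
  "cprot 0 A = Step {[False], [True]} (recv {[False], [True]} A) (copy_gate g) (Done (range (Recv [True])))"
| "cprot (Suc r) A = Step M (recv M A) (copy_gate f) (cprot r (recv M A))"

primrec run :: "nat \<Rightarrow> bool list mem \<Rightarrow> bool list \<Rightarrow> bool list \<Rightarrow> bool" where
  "run 0 w u v = ans P (h u) (history w)"
| "run (Suc r) w u v = run r (Recv (f u w) w) v u"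

lemma finite_M: "finite M"
  using finite_lists_length_le[of "UNIV :: bool set" c] by (simp add: M_def)

lemma card_M: "card M \<le> 2 ^ (c + 1)"
proof -
  have "card M = (\<Sum>i\<le>c. 2 ^ i)"
    using card_lists_length_le[of "UNIV :: bool set" c] by (simp add: M_def)
  also have "... \<le> 2 ^ (c + 1)" by (induction c) auto
  finally show ?thesis .
qed

lemma f_in_M: "f u a \<in> M"
  by (simp add: f_def M_def)

lemma M_ne: "M \<noteq> {}"
  using f_in_M by blast

lemma wf_cprot: "finite A \<Longrightarrow> wf_prot n' (cprot r A) A A"
proof (induction r arbitrary: A)
  case 0
  then show ?case by (auto intro!: isom_copy_gate simp: g_def)
next
  case (Suc r)
  then show ?case by (auto intro!: isom_copy_gate simp: finite_M M_ne f_in_M)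
qed

lemma msgs_cprot: "msgs (cprot r A) = replicate r (card M) @ [2]"
  by (induction r arbitrary: A) simp_all

lemma acc_cprot: "finite A \<Longrightarrow> w \<in> A \<Longrightarrow> acc (cprot r A) A A u v (basis_state w) = of_bool (run r w u v)"
proof (induction r arbitrary: A w u v)
  case 0
  let ?T = "{[False], [True]}"
  have "acc (cprot 0 A) A A u v (basis_state w) =
     (\<Sum>m\<in>?T. \<Sum>b\<in>A. \<Sum>y\<in>recv ?T A. if y = Recv (g u w) w then (if b = w then (if m = g u w then of_bool (ans P (h u) (history w)) else 0) else 0) else 0)"
    unfolding cprot.simps acc.simps
    by (subst sum_recv, intro sum.cong refl, subst step_copy_gate[OF 0]) (auto simp: g_def)
  also have "... = of_bool (ans P (h u) (history w))"
  proof -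
    have "Recv (g u w) w \<in> recv ?T A" using 0 by (auto simp: g_def recv_def)
    then show ?thesis using 0 by (cases "ans P (h u) (history w)") (simp_all add: g_def)
  qed
  finally show ?case by simp
next
  case (Suc r)
  let ?w = "Recv (f u w) w"
  have w: "?w \<in> recv M A" using Suc.prems f_in_M by (auto simp: recv_def)
  have "acc (cprot (Suc r) A) A A u v (basis_state w) = acc (cprot r (recv M A)) (recv M A) (recv M A) v u (step_state A (copy_gate f u) (basis_state w))"
    by simp
  also have "... = acc (cprot r (recv M A)) (recv M A) (recv M A) v u (basis_state ?w)"
    by (rule acc_cong) (auto simp: recv_def step_copy_gate[OF Suc.prems] basis_state_def)
  also have "... = of_bool (run r ?w v u)"
    using w Suc.prems finite_M by (intro Suc.IH) auto
  finally show ?case by simp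
qed

lemma run_transcript:
  assumes xy: "x \<in> inputs n'" "y \<in> inputs n'" and "i + r = t"
    and "history w = transcript P (h x) (h y) i"
  shows "run r w (input_of (turn (starter P) i) x y) (input_of (turn (starter P) (Suc i)) x y) = det_output t P (h x) (h y)"
  using assms(3,4)
proof (induction r arbitrary: i w)
  have hi: "h (input_of p x y) = input_of p (h x) (h y)" for p by (cases p) simp_all
  case 0
  then show ?case by (simp add: det_output_def hi)
next
  have hi: "h (input_of p x y) = input_of p (h x) (h y)" for p by (cases p) simp_all
  case (Suc r)
  let ?m = "msg P (input_of (turn (starter P) i) (h x) (h y)) (transcript P (h x) (h y) i)"
  have len: "length (transcript P x y j) = j" for x y j by (induction j) simp_all
  have nth: "j < l \<Longrightarrow> transcript P x y l ! j = msg P (input_of (turn (starter P) j) x y) (transcript P x y j)" for x y j l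
    by (induction l) (auto simp: nth_append len less_Suc_eq)
  \<comment> \<open>One message is at most as long as the whole transcript, so the cut at
    \<open>c\<close> leaves it intact on actual histories.\<close>
  have "?m \<in> set (transcript P (h x) (h y) t)"
    using nth[of i t "h x" "h y"] len[of "h x" "h y" t] Suc.prems(1) by (metis add_Suc_right less_add_Suc1 nth_mem)
  then have "length ?m \<le> bits_sent t P (h x) (h y)"
    unfolding bits_sent_def by (intro member_le_sum_list) auto
  also have "... \<le> c" by (intro cost h xy)
  finally have "take c ?m = ?m" by simp
  then have "history (Recv (f (input_of (turn (starter P) i) x y) w) w) = transcript P (h x) (h y) (Suc i)"
    using Suc.prems by (simp add: f_def hi)
  then show ?case using Suc.IH[of "Suc i"] Suc.prems by simp
qed

text \<open>\<open>card M \<le> 2 ^ (c + 1)\<close> gives \<open>ln (card M) \<le> 2 * c\<close> for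
  \<open>c \<ge> 1\<close>, which doubles 800 to 1600. One \<open>t\<close> stems from
  Cauchy-Schwarz over the rounds, the other from charging all \<open>t\<close> messages the full
  alphabet.\<close>

lemma hard_det_error_ge:
  assumes n': "n' = 4 * k ^ t" and k: "k \<ge> 1" and c: "c \<ge> 1" and small: "1600 * (t ^ 2 * c) \<le> k"
  shows "27 / 80 \<le> hard 4 k t (\<lambda>x y. of_bool (det_output t P (h x) (h y) \<noteq> GT_fun x y))"
proof -
  define b where "b = (starter P = Alice)"
  let ?A = "{Cell []} :: bool list mem set"
  let ?p = "cprot t ?A"
  let ?q = "\<lambda>u v. acc ?p ?A ?A u v (basis_state (Cell []))"
  have len: "length (msgs ?p) = Suc t" by (simp add: msgs_cprot)
  have cm: "1 \<le> card M" using finite_M M_ne by (simp add: Suc_le_eq card_gt_0_iff)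
  have msgs: "msgs ?p ! i = card M" if "i < t" for i using that by (simp add: msgs_cprot nth_append)
  have "real (card M) \<le> 2 ^ (c + 1)" using card_M by (metis of_nat_le_iff of_nat_numeral of_nat_power)
  then have "ln (card M) \<le> ln (2 ^ (c + 1))" using cm by simp
  also have "... = (c + 1) * ln 2" by (rule ln_realpow)
  also have "... \<le> real (c + 1)"
    using ln_2_less_1 mult_left_mono[of "ln 2" 1 "real (c + 1)"] by simp
  also have "... \<le> 2 * c" using c by simp
  finally have lnM: "ln (card M) \<le> 2 * c" .
  have "(\<Sum>i<t. ln (msgs ?p ! i)) = t * ln (card M)" using msgs by simp
  also have "... \<le> real t * real (2 * c)" using lnM by (intro mult_left_mono) auto
  finally have "800 * (real t * (\<Sum>i<t. ln (msgs ?p ! i))) \<le> 800 * (real t * (real t * real (2 * c)))"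
    by (intro mult_left_mono) auto
  also have "... = real (1600 * (t ^ 2 * c))" by (simp add: power2_eq_square)
  also have "... \<le> real k" using small by (simp only: of_nat_le_iff)
  finally have sm: "800 * (real t * (\<Sum>i<t. ln (msgs ?p ! i))) \<le> real k" .
  have "27 / 80 \<le> hard 4 k t (\<lambda>u v. err b u v (?q u v))"
    by (rule hard_error_ge[OF k _ _ _ _ len _ sm])
       (use wf_cprot[of ?A t] msgs cm in \<open>auto simp: n'[symmetric] nsq2_basis_state\<close>)
  also have "... = hard 4 k t (\<lambda>u v. if b then of_bool (det_output t P (h u) (h v) \<noteq> GT_fun u v)
      else of_bool (det_output t P (h v) (h u) \<noteq> GT_fun v u))"
  proof (rule hard_cong)
    fix u v assume uv: "u \<in> inputs (4 * k ^ t)" "v \<in> inputs (4 * k ^ t)" "u \<noteq> v"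
    then have uv': "u \<in> inputs n'" "v \<in> inputs n'" by (simp_all add: n')
    have len: "length u = length v" using uv by (simp add: inputs_def)
    have q: "?q u v = of_bool (run t (Cell []) u v)" by (rule acc_cprot) simp_all
    show "err b u v (?q u v) = (if b then of_bool (det_output t P (h u) (h v) \<noteq> GT_fun u v)
      else of_bool (det_output t P (h v) (h u) \<noteq> GT_fun v u))"
    proof (cases "starter P")
      case Alice
      then have "run t (Cell []) u v = det_output t P (h u) (h v)"
        using run_transcript[OF uv', of 0 t "Cell []"] by (simp add: turn_def)
      then show ?thesis unfolding q using Alice by (auto simp: err_def b_def)
    next
      case Bob
      then have "run t (Cell []) u v = det_output t P (h v) (h u)"
        using run_transcript[OF uv'(2,1), of 0 t "Cell []"] by (simp add: turn_def)
      then show ?thesis unfolding q using Bob GT_fun_swap[OF len uv(3)] by (auto simp: err_def b_def)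
    qed
  qed simp
  also have "... = hard 4 k t (\<lambda>x y. of_bool (det_output t P (h x) (h y) \<noteq> GT_fun x y))"
    using hard_swap[of 4 k t "\<lambda>x y. of_bool (det_output t P (h x) (h y) \<noteq> GT_fun x y)"] by (cases b) simp_all
  finally show ?thesis .
qed

end

section \<open>Averaging over the public coins\<close>

lemma transcript_zero_cost:
  assumes "bits_sent t P x y = 0" shows "transcript P x y t = replicate t []"
proof -
  have "length (transcript P x y i) = i" for i by (induction i) simp_all
  moreover have "\<forall>m\<in>set (transcript P x y t). m = []"
    using assms by (auto simp: bits_sent_def sum_list_eq_0_iff)
  ultimately show ?thesis by (metis replicate_length_same)
qed

lemma public_coin_cost_bound:
  assumes n: "n \<ge> 1" and t: "t \<ge> 1" and R: "public_coin_protocol n t GT_fun R"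
  shows "1 / 6400 * (real n powr (1 / real t) / real t ^ 2) \<le> public_coin_cost n t R"
proof -
  define c where "c = public_coin_cost n t R"
  have finR: "finite (set_pmf R)" using R by (simp add: public_coin_protocol_def)
  have err: "measure_pmf.prob R {P. det_output t P x y \<noteq> GT_fun x y} < 1 / 3" if "x \<in> inputs n" "y \<in> inputs n" for x y
    using R that by (simp add: public_coin_protocol_def)
  have cost: "bits_sent t P x y \<le> c" if "P \<in> set_pmf R" "x \<in> inputs n" "y \<in> inputs n" for P x y
  proof -
    let ?B = "{bits_sent t P x y | P x y. P \<in> set_pmf R \<and> x \<in> inputs n \<and> y \<in> inputs n}"
    have "?B = (\<lambda>(P, x, y). bits_sent t P x y) ` (set_pmf R \<times> inputs n \<times> inputs n)" by force
    then have "finite ?B" using finR by simp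
    then show ?thesis unfolding c_def public_coin_cost_def by (rule Max_ge) (use that in blast)
  qed
  have prob: "measure_pmf.prob R {P. E P} = (\<Sum>P\<in>set_pmf R. pmf R P * of_bool (E P))" for E
  proof -
    have "measure_pmf.prob R {P. E P} = measure_pmf.prob R ({P. E P} \<inter> set_pmf R)"
      by (simp add: measure_Int_set_pmf)
    also have "... = (\<Sum>P\<in>{P. E P} \<inter> set_pmf R. pmf R P)" using finR by (intro measure_measure_pmf_finite) auto
    also have "... = (\<Sum>P\<in>set_pmf R. pmf R P * of_bool (E P))"
      using finR by (intro sum.mono_neutral_cong_left) auto
    finally show ?thesis .
  qed
  have total: "(\<Sum>P\<in>set_pmf R. pmf R P) = 1" using finR by (rule sum_pmf_eq_1) simp
  show ?thesis
  proof (cases "c = 0")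
    case True
    let ?z = "replicate n False" and ?o = "replicate n True"
    let ?e = "\<lambda>P x y. det_output t P x y \<noteq> GT_fun x y"
    have in': "?z \<in> inputs n" "?o \<in> inputs n" by (simp_all add: inputs_def)
    \<comment> \<open>The output depends on the input of one player only, so it coincides on
      \<open>(?o, ?z)\<close> and one of the equal pairs, and one of the two answers is wrong. Three
      error probabilities strictly below 1/3 cannot add up to 1.\<close>
    have "1 \<le> of_bool (?e P ?o ?z) + of_bool (?e P ?z ?z) + (of_bool (?e P ?o ?o) :: real)" if P: "P \<in> set_pmf R" for P
    proof -
      have "det_output t P x y = ans P (input_of (turn (starter P) t) x y) (replicate t [])" if "x \<in> inputs n" "y \<in> inputs n" for x y
        using transcript_zero_cost[of t P x y] cost[OF P that] True by (simp add: det_output_def)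
      then show ?thesis using in' GT_fun_extremes[OF n] by (cases "turn (starter P) t") auto
    qed
    then have "(\<Sum>P\<in>set_pmf R. pmf R P * 1) \<le> (\<Sum>P\<in>set_pmf R. pmf R P * (of_bool (?e P ?o ?z) + of_bool (?e P ?z ?z) + of_bool (?e P ?o ?o)))"
      by (intro sum_mono mult_left_mono) auto
    also have "... = measure_pmf.prob R {P. ?e P ?o ?z} + measure_pmf.prob R {P. ?e P ?z ?z} + measure_pmf.prob R {P. ?e P ?o ?o}"
      unfolding prob by (simp only: distrib_left sum.distrib)
    also have "... < 1" using err[OF in'(2,1)] err[OF in'(1,1)] err[OF in'(2,2)] by linarith
    finally show ?thesis using total by simp
  next
    case False
    define k where "k = 1600 * (t ^ 2 * c)"
    have k: "k \<ge> 1" using False t by (simp add: k_def)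
    have "n \<le> 4 * k ^ t"
    proof (rule ccontr)
      assume "\<not> n \<le> 4 * k ^ t"
      then have lt: "4 * k ^ t < n" by simp
      let ?h = "\<lambda>u. replicate (n - 4 * k ^ t) False @ u"
      let ?e = "\<lambda>P x y. det_output t P (?h x) (?h y) \<noteq> GT_fun x y"
      have h: "?h u \<in> inputs n" if "u \<in> inputs (4 * k ^ t)" for u using that lt by (simp add: inputs_def)
      have "27 / 80 \<le> hard 4 k t (\<lambda>x y. of_bool (?e P x y))" if P: "P \<in> set_pmf R" for P
      proof -
        interpret classical_embedding n "4 * k ^ t" t c P ?h
          using cost[OF P] h by unfold_locales auto
        show ?thesis by (rule hard_det_error_ge) (use k False in \<open>auto simp: k_def\<close>)
      qed
      then have "(\<Sum>P\<in>set_pmf R. pmf R P * (27 / 80)) \<le> (\<Sum>P\<in>set_pmf R. pmf R P * hard 4 k t (\<lambda>x y. of_bool (?e P x y)))"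
        by (intro sum_mono mult_left_mono) auto
      \<comment> \<open>The easy direction of Yao's principle: \<open>hard\<close> is linear, so the
        average over the coins can be exchanged with the expectation over the inputs.\<close>
      also have "... = hard 4 k t (\<lambda>x y. measure_pmf.prob R {P. ?e P x y})"
        unfolding prob hard_sum hard_cmult ..
      also have "... \<le> hard 4 k t (\<lambda>x y. 1 / 3)"
      proof (rule hard_mono)
        fix x y assume xy: "x \<in> inputs (4 * k ^ t)" "y \<in> inputs (4 * k ^ t)" "x \<noteq> y"
        then have "GT_fun (?h x) (?h y) = GT_fun x y" by (intro GT_fun_pad) (simp add: inputs_def)
        then show "measure_pmf.prob R {P. ?e P x y} \<le> 1 / 3" using err[OF h[OF xy(1)] h[OF xy(2)]] by simp
      qed simp
      also have "... = 1 / 3" using k by simp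
      finally show False using total by (simp add: sum_divide_distrib[symmetric] sum_distrib_right[symmetric])
    qed
    from powr_root_le[OF this k t] have "real n powr (1 / real t) \<le> 6400 * (real t ^ 2 * real c)"
      by (simp add: k_def)
    then show ?thesis using t by (simp add: c_def[symmetric] field_simps)
  qed
qed

theorem mainTheorem3:
  "(\<exists>c::real. c > 0 \<and> (\<forall>n t :: nat. n \<ge> 1 \<longrightarrow> t \<ge> 1 \<longrightarrow>
      ereal (c * (real n powr (1 / real t) / real t ^ 2)) \<le> ereal_of_enat (public_coin_cc n t GT_fun))) \<and>
   (\<exists>c::real. c > 0 \<and> (\<forall>n t :: nat. n \<ge> 1 \<longrightarrow> t \<ge> 1 \<longrightarrow>
      ereal (c * (real n powr (1 / real t) / real t)) \<le> ereal_of_enat (quantum_cc n t GT_fun)))"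
proof -
  \<comment> \<open>An infimum of \<open>enat\<close> values is attained unless the set is empty;
    then it is infinite and the bound is trivial.\<close>
  have INF: "ereal b \<le> ereal_of_enat (INF x\<in>X. enat (f x))" if "\<And>x. x \<in> X \<Longrightarrow> b \<le> real (f x)" for b X and f :: "'x \<Rightarrow> nat"
  proof (cases "X = {}")
    case True
    then show ?thesis by (simp add: top_enat_def)
  next
    case False
    then have "(INF x\<in>X. enat (f x)) \<in> (\<lambda>x. enat (f x)) ` X"
      by (intro wellorder_InfI[where k = "enat (f (SOME x. x \<in> X))"]) (auto simp: some_in_eq)
    then obtain x where "x \<in> X" "(INF x\<in>X. enat (f x)) = enat (f x)" by blast
    then show ?thesis using that by simp
  qed
  show ?thesis
  proof (intro conjI)
    show "\<exists>c::real. c > 0 \<and> (\<forall>n t :: nat. n \<ge> 1 \<longrightarrow> t \<ge> 1 \<longrightarrow>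
      ereal (c * (real n powr (1 / real t) / real t ^ 2)) \<le> ereal_of_enat (public_coin_cc n t GT_fun))"
      by (intro exI[of _ "1 / 6400"] conjI allI impI) (simp, unfold public_coin_cc_def, rule INF, rule public_coin_cost_bound, auto)
    show "\<exists>c::real. c > 0 \<and> (\<forall>n t :: nat. n \<ge> 1 \<longrightarrow> t \<ge> 1 \<longrightarrow>
      ereal (c * (real n powr (1 / real t) / real t)) \<le> ereal_of_enat (quantum_cc n t GT_fun))"
      by (intro exI[of _ "1 / 3200"] conjI allI impI) (simp, unfold quantum_cc_def, rule INF, rule quantum_cost_bound, auto)
  qed
qed

end
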